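(* Let $T,S\in\mathcal{B}_A(\mathcal{H})$, $\alpha\in [0,1]$, $r\geq 1$ and $\beta\geq 0$. Then $$\begin{aligned} w_A^{4r}(S^{\sharp_A} T)&\leq \frac{(2\beta+1)(1+\alpha^2)+2\alpha}{16(1+\beta)}\left\|\left(T^{\sharp_A} T\right)^{2r}+\left(S^{\sharp_A} S\right)^{2r}\right\|_A^2\\ &\quad+ \frac{(1-\alpha)\left[2+(1+\alpha)(1+2\beta)\right]}{8(1+\beta)}\left\|\left(T^{\sharp_A} T\right)^{2r}+\left(S^{\sharp_A} S\right)^{2r}\right\|_A\, w_A^{r}\left(S^{\sharp_A} S\,T^{\sharp_A} T\right). \end{aligned}$$
   Context: $(\mathcal{H},\langle\cdot,\cdot\rangle)$ is a nontrivial complex Hilbert space, $\mathcal{B}(\mathcal{H})$ is the algebra of bounded linear operators on $\mathcal{H}$, and $A\in\mathcal{B}(\mathcal{H})$ is a positive operator, i.e. $\langle Ax,x\rangle\ge 0$ for all $x\in\mathcal{H}$. The semi-inner product induced by $A$ is $\langle x,y\rangle_A=\langle Ax,y\rangle$, with seminorm $\|x\|_A=\sqrt{\langle x,x\rangle_A}$ on $\mathcal{H}$. $\mathcal{B}_A(\mathcal{H})=\{T\in\mathcal{B}(\mathcal{H}): \operatorname{ran}(T^*A)\subseteq\operatorname{ran}(A)\}$ is the set of operators admitting an $A$-adjoint. For $T\in\mathcal{B}_A(\mathcal{H})$, $T^{\sharp_A}=A^{\dagger}T^*A$ (with $A^\dagger$ the Moore-Penrose inverse of $A$) is the unique bounded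 solution $X$ of $AX=T^*A$ whose range is contained in $\overline{\operatorname{ran}(A)}$; it satisfies $\langle Tx,y\rangle_A=\langle x,T^{\sharp_A}y\rangle_A$ for all $x,y\in\mathcal{H}$. For $T\in\mathcal{B}_A(\mathcal{H})$, the $A$-operator seminorm is $\|T\|_A=\sup\{\|Tx\|_A: x\in\mathcal{H},\ \|x\|_A=1\}$ and the $A$-numerical radius is $w_A(T)=\sup\{|\langle Tx,x\rangle_A|: x\in\mathcal{H},\ \|x\|_A=1\}$; $w_A^s(T)$ means $(w_A(T))^s$. Convention on powers: an operator $P$ is $A$-positive if $AP$ is positive; $T^{\sharp_A}T$ and $S^{\sharp_A}S$ are $A$-positive. For integer exponents, powers are ordinary operator powers. For non-integer $s\ge 1$, powers of $A$-positive operators $P\in\mathcal{B}_A(\mathcal{H})$ are understood on the Hilbert space $\mathcal{H}_A$ obtained by completing $\mathcal{H}/\ker A$ with respect to $\langle\cdot,\cdot\rangle_A$: $P$ induces a bounded positive operator $\widetilde P$ on $\mathcal{H}_A$, $P^s$ stands for $\widetilde P^{\,s}$ (continuous functional calculus), and the $A$-seminorm of a sum of such powers is the operator norm on $\mathcal{H}_A$ (for integer $s$ this agrees with the seminorm above). *)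

theory Defs
  imports "HOL-Analysis.Analysis"
begin

section \<open>Complex Hilbert spaces and bounded operators\<close>

text \<open>
  A complex Hilbert space, with inner product linear in the first argument.  The real structure
  inherited from \<^class>\<open>real_inner\<close> (inner product, norm, topology) is the one underlying the complex
  structure, so positive definiteness of \<open>cinner\<close> and completeness come from the superclasses.
\<close>

class chilbert_space = real_inner + complete_space +
  fixes scaleC :: "complex \<Rightarrow> 'a \<Rightarrow> 'a"  (infixr \<open>*\<^sub>C\<close> 75)
    and cinner :: "'a \<Rightarrow> 'a \<Rightarrow> complex"
  assumes scaleC_add_right: "c *\<^sub>C (x + y) = c *\<^sub>C x + c *\<^sub>C y"
    and scaleC_add_left: "(c + d) *\<^sub>C x = c *\<^sub>C x + d *\<^sub>C x"
    and scaleC_scaleC: "c *\<^sub>C d *\<^sub>C x = (c * d) *\<^sub>C x"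
    and scaleR_eq_scaleC: "t *\<^sub>R x = complex_of_real t *\<^sub>C x"
    and cinner_commute: "cinner x y = cnj (cinner y x)"
    and cinner_add_left: "cinner (x + y) z = cinner x z + cinner y z"
    and cinner_scaleC_left: "cinner (c *\<^sub>C x) y = c * cinner x y"
    and inner_eq_Re_cinner: "inner x y = Re (cinner x y)"

definition bounded_clinear :: "('a::chilbert_space \<Rightarrow> 'a) \<Rightarrow> bool" where
  "bounded_clinear T \<longleftrightarrow> bounded_linear T \<and> (\<forall>c x. T (c *\<^sub>C x) = c *\<^sub>C T x)"

definition positive_operator :: "('a::chilbert_space \<Rightarrow> 'a) \<Rightarrow> bool" where
  "positive_operator A \<longleftrightarrow> bounded_clinear A \<and> (\<forall>x. cinner (A x) x \<in> \<real>\<^sub>\<ge>\<^sub>0)"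

definition adjoint_op :: "('a::chilbert_space \<Rightarrow> 'a) \<Rightarrow> 'a \<Rightarrow> 'a" where
  "adjoint_op T = (THE S. \<forall>x y. cinner (T x) y = cinner x (S y))"

definition orth_compl :: "'a::chilbert_space set \<Rightarrow> 'a set" where
  "orth_compl M = {x. \<forall>y\<in>M. cinner x y = 0}"

text \<open>
  The Moore-Penrose inverse, meaningful on its domain: the algebraic sum of the range of \<open>A\<close>
  and the orthogonal complement of that range.
\<close>

definition moore_penrose :: "('a::chilbert_space \<Rightarrow> 'a) \<Rightarrow> 'a \<Rightarrow> 'a" where
  "moore_penrose A y = (THE x. x \<in> orth_compl {z. A z = 0} \<and> y - A x \<in> orth_compl (range A))"


section \<open>The semi-Hilbertian structure induced by A\<close>

definition cinner_A :: "('a::chilbert_space \<Rightarrow> 'a) \<Rightarrow> 'a \<Rightarrow> 'a \<Rightarrow> complex" where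
  "cinner_A A x y = cinner (A x) y"

definition norm_A :: "('a::chilbert_space \<Rightarrow> 'a) \<Rightarrow> 'a \<Rightarrow> real" where
  "norm_A A x = sqrt (Re (cinner_A A x x))"

definition B_A :: "('a::chilbert_space \<Rightarrow> 'a) \<Rightarrow> ('a \<Rightarrow> 'a) set" where
  "B_A A = {T. bounded_clinear T \<and> range (adjoint_op T \<circ> A) \<subseteq> range A}"

definition sharp_A :: "('a::chilbert_space \<Rightarrow> 'a) \<Rightarrow> ('a \<Rightarrow> 'a) \<Rightarrow> 'a \<Rightarrow> 'a" where
  "sharp_A A T = moore_penrose A \<circ> adjoint_op T \<circ> A"

text \<open>
  The suprema below are suprema of sets of nonnegative numbers.  Inserting \<open>0\<close> only matters for
  \<open>A = 0\<close>, where no vector has seminorm one: the supremum of the empty set is then \<open>0\<close>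
  instead of an unspecified real number.
\<close>

definition opnorm_A :: "('a::chilbert_space \<Rightarrow> 'a) \<Rightarrow> ('a \<Rightarrow> 'a) \<Rightarrow> real" where
  "opnorm_A A T = Sup (insert 0 {norm_A A (T x) | x. norm_A A x = 1})"

definition w_A :: "('a::chilbert_space \<Rightarrow> 'a) \<Rightarrow> ('a \<Rightarrow> 'a) \<Rightarrow> real" where
  "w_A A T = Sup (insert 0 {cmod (cinner_A A (T x) x) | x. norm_A A x = 1})"


section \<open>Functional calculus on a Hilbert space given by a carrier set\<close>

text \<open>
  The completion of \<open>H / ker A\<close> depends on the operator \<open>A\<close>, so it cannot be a type.  It is
  represented by a record consisting of a carrier set and operations on it.
\<close>

record 'v hspace =
  vecs :: "'v set"
  vadd :: "'v \<Rightarrow> 'v \<Rightarrow> 'v"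
  vscale :: "complex \<Rightarrow> 'v \<Rightarrow> 'v"
  vinner :: "'v \<Rightarrow> 'v \<Rightarrow> complex"

definition vnorm :: "'v hspace \<Rightarrow> 'v \<Rightarrow> real" where
  "vnorm K u = sqrt (Re (vinner K u u))"

text \<open>
  Operators are extensional functions on the carrier (undefined outside of it), so that equality
  of operators is equality on the carrier.
\<close>

definition bounded_ops :: "'v hspace \<Rightarrow> ('v \<Rightarrow> 'v) set" where
  "bounded_ops K = {Q \<in> vecs K \<rightarrow>\<^sub>E vecs K.
     (\<forall>u\<in>vecs K. \<forall>v\<in>vecs K. Q (vadd K u v) = vadd K (Q u) (Q v)) \<and>
     (\<forall>c. \<forall>u\<in>vecs K. Q (vscale K c u) = vscale K c (Q u)) \<and>
     (\<exists>C. \<forall>u\<in>vecs K. vnorm K (Q u) \<le> C * vnorm K u)}"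

definition opnorm :: "'v hspace \<Rightarrow> ('v \<Rightarrow> 'v) \<Rightarrow> real" where
  "opnorm K Q = Sup (insert 0 {vnorm K (Q u) | u. u \<in> vecs K \<and> vnorm K u = 1})"

definition op_id :: "'v hspace \<Rightarrow> 'v \<Rightarrow> 'v" where
  "op_id K = (\<lambda>u\<in>vecs K. u)"

definition op_add :: "'v hspace \<Rightarrow> ('v \<Rightarrow> 'v) \<Rightarrow> ('v \<Rightarrow> 'v) \<Rightarrow> 'v \<Rightarrow> 'v" where
  "op_add K Q R = (\<lambda>u\<in>vecs K. vadd K (Q u) (R u))"

definition op_scale :: "'v hspace \<Rightarrow> complex \<Rightarrow> ('v \<Rightarrow> 'v) \<Rightarrow> 'v \<Rightarrow> 'v" where
  "op_scale K c Q = (\<lambda>u\<in>vecs K. vscale K c (Q u))"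

definition op_comp :: "'v hspace \<Rightarrow> ('v \<Rightarrow> 'v) \<Rightarrow> ('v \<Rightarrow> 'v) \<Rightarrow> 'v \<Rightarrow> 'v" where
  "op_comp K Q R = compose (vecs K) Q R"

definition op_diff :: "'v hspace \<Rightarrow> ('v \<Rightarrow> 'v) \<Rightarrow> ('v \<Rightarrow> 'v) \<Rightarrow> 'v \<Rightarrow> 'v" where
  "op_diff K Q R = op_add K Q (op_scale K (-1) R)"

text \<open>\<open>p(Q)\<close> by Horner's scheme: \<open>(pCons a p)(Q) = a I + Q p(Q)\<close>.\<close>

definition op_poly :: "'v hspace \<Rightarrow> real poly \<Rightarrow> ('v \<Rightarrow> 'v) \<Rightarrow> 'v \<Rightarrow> 'v" where
  "op_poly K p Q =
     fold_coeffs (\<lambda>a R. op_add K (op_scale K (complex_of_real a) (op_id K)) (op_comp K Q R)) p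
       (op_scale K 0 (op_id K))"

definition op_spectrum :: "'v hspace \<Rightarrow> ('v \<Rightarrow> 'v) \<Rightarrow> complex set" where
  "op_spectrum K Q = {z. \<not> (\<exists>R\<in>bounded_ops K.
     op_comp K R (op_diff K Q (op_scale K z (op_id K))) = op_id K \<and>
     op_comp K (op_diff K Q (op_scale K z (op_id K))) R = op_id K)}"

text \<open>
  Continuous functional calculus for a self-adjoint \<open>Q\<close> (whose spectrum is real) and a real function
  \<open>f\<close> continuous on the spectrum: \<open>f(Q)\<close> is the operator norm limit of \<open>p\<^sub>n(Q)\<close> whenever
  the polynomials \<open>p\<^sub>n\<close> converge to \<open>f\<close> uniformly on the spectrum.
\<close>

definition cont_fun_calc :: "'v hspace \<Rightarrow> (real \<Rightarrow> real) \<Rightarrow> ('v \<Rightarrow> 'v) \<Rightarrow> 'v \<Rightarrow> 'v" where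
  "cont_fun_calc K f Q = (THE R. R \<in> bounded_ops K \<and>
     (\<forall>p :: nat \<Rightarrow> real poly.
        uniform_limit {t. complex_of_real t \<in> op_spectrum K Q} (\<lambda>n. poly (p n)) f sequentially \<longrightarrow>
        (\<lambda>n. opnorm K (op_diff K (op_poly K (p n) Q) R)) \<longlonglongrightarrow> 0))"


section \<open>The completion and powers of A-positive operators\<close>

definition Cauchy_A :: "('a::chilbert_space \<Rightarrow> 'a) \<Rightarrow> (nat \<Rightarrow> 'a) set" where
  "Cauchy_A A = {X. \<forall>e>0. \<exists>N. \<forall>m\<ge>N. \<forall>n\<ge>N. norm_A A (X m - X n) < e}"

definition null_rel_A :: "('a::chilbert_space \<Rightarrow> 'a) \<Rightarrow> ((nat \<Rightarrow> 'a) \<times> (nat \<Rightarrow> 'a)) set" where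
  "null_rel_A A =
     {(X, Y). X \<in> Cauchy_A A \<and> Y \<in> Cauchy_A A \<and> (\<lambda>n. norm_A A (X n - Y n)) \<longlonglongrightarrow> 0}"

text \<open>
  The completion of \<open>H / ker A\<close>: Cauchy sequences for the seminorm modulo null sequences.  Since
  \<open>ker A\<close> is the set of vectors of seminorm zero, this also performs the quotient by \<open>ker A\<close>.
\<close>

definition H_A :: "('a::chilbert_space \<Rightarrow> 'a) \<Rightarrow> (nat \<Rightarrow> 'a) set hspace" where
  "H_A A = \<lparr> vecs = Cauchy_A A // null_rel_A A,
     vadd = (\<lambda>u v. \<Union>X\<in>u. \<Union>Y\<in>v. null_rel_A A `` {\<lambda>n. X n + Y n}),
     vscale = (\<lambda>c u. \<Union>X\<in>u. null_rel_A A `` {\<lambda>n. c *\<^sub>C X n}),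
     vinner = (\<lambda>u v. THE l. \<exists>X\<in>u. \<exists>Y\<in>v. (\<lambda>n. cinner_A A (X n) (Y n)) \<longlonglongrightarrow> l) \<rparr>"

definition embed_A :: "('a::chilbert_space \<Rightarrow> 'a) \<Rightarrow> 'a \<Rightarrow> (nat \<Rightarrow> 'a) set" where
  "embed_A A x = null_rel_A A `` {\<lambda>_. x}"

definition induced_op ::
  "('a::chilbert_space \<Rightarrow> 'a) \<Rightarrow> ('a \<Rightarrow> 'a) \<Rightarrow> (nat \<Rightarrow> 'a) set \<Rightarrow> (nat \<Rightarrow> 'a) set" where
  "induced_op A P =
     (THE Q. Q \<in> bounded_ops (H_A A) \<and> (\<forall>x. Q (embed_A A x) = embed_A A (P x)))"

definition powr_A ::
  "('a::chilbert_space \<Rightarrow> 'a) \<Rightarrow> ('a \<Rightarrow> 'a) \<Rightarrow> real \<Rightarrow> (nat \<Rightarrow> 'a) set \<Rightarrow> (nat \<Rightarrow> 'a) set" where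
  "powr_A A P s = cont_fun_calc (H_A A) (\<lambda>t. t powr s) (induced_op A P)"

text \<open>
  The seminorm of \<open>P\<^sup>s + Q\<^sup>s\<close> for \<open>A\<close>-positive \<open>P\<close>, \<open>Q\<close> and \<open>s \<ge> 1\<close>: ordinary operator powers
  for integer \<open>s\<close>, powers on the completion otherwise.
\<close>

definition seminorm_sum_powers ::
  "('a::chilbert_space \<Rightarrow> 'a) \<Rightarrow> ('a \<Rightarrow> 'a) \<Rightarrow> ('a \<Rightarrow> 'a) \<Rightarrow> real \<Rightarrow> real" where
  "seminorm_sum_powers A P Q s =
     (if s \<in> \<nat> then opnorm_A A (\<lambda>x. (P ^^ nat \<lfloor>s\<rfloor>) x + (Q ^^ nat \<lfloor>s\<rfloor>) x)
      else opnorm (H_A A) (op_add (H_A A) (powr_A A P s) (powr_A A Q s)))"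

end

theory Submission
  imports Defs "HOL-Computational_Algebra.Fundamental_Theorem_Algebra"
begin

text \<open>
  Write \<open>P\<close> and \<open>Q\<close> for the products of \<open>T\<close> and of \<open>S\<close> with their A-adjoints, \<open>w\<close> for the A-numerical radius
  of \<open>Q P\<close>, and \<open>2 n\<close> for the seminorm of \<open>P\<^sup>2\<^sup>r + Q\<^sup>2\<^sup>r\<close>.  For a vector \<open>x\<close> of seminorm one, the squared modulus of
  the numerical value of \<open>S\<^sup># T\<close> at \<open>x\<close> is at most \<open>\<langle>P x,x\<rangle> \<langle>x,Q x\<rangle>\<close>, and Buzano's inequality
  (\<open>Buzano_inequality\<close>) bounds this product by the mean of \<open>\<parallel>P x\<parallel> \<parallel>Q x\<parallel>\<close> and \<open>\<bar>\<langle>P x,Q x\<rangle>\<bar> \<le> w\<close>.  The McCarthy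
  inequality gives \<open>\<parallel>P x\<parallel>\<^sup>2\<^sup>r + \<parallel>Q x\<parallel>\<^sup>2\<^sup>r \<le> 2 n\<close>, so convexity of the \<open>r\<close>-th power turns the bound into
  \<open>((n + W) / 2)\<^sup>2\<close> for the \<open>4r\<close>-th power of the numerical radius, where \<open>W = w\<^sup>r \<le> n\<close> (\<open>w_A_powr_bounds\<close>).
  In terms of \<open>n\<close> and \<open>W\<close> the claimed bound is \<open>c n\<^sup>2 + (1 - c) n W\<close> with \<open>c \<ge> 1/4\<close>, and this is larger because
  \<open>W \<le> n\<close> (\<open>mean_square_le_weighted\<close>).

  What remains is analysis.  First, \<open>P\<close> and \<open>Q\<close> have to be bounded for the seminorm: the A-adjoint is
  bounded by the uniform boundedness principle (\<open>bounded_clinear_sharp_A\<close>), and a bounded operator that is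
  symmetric for the semi-inner product is bounded for the seminorm (\<open>A_symmetric_imp_A_bounded\<close>).

  Second, \<open>\<parallel>P x\<parallel>\<^sup>2\<^sup>r + \<parallel>Q x\<parallel>\<^sup>2\<^sup>r \<le> 2 n\<close> has to be proved, for a non-integral \<open>2r\<close> with powers defined by the
  functional calculus on the completion (\<open>powers_le_seminorm_sum_powers\<close>).  Polynomials of \<open>P\<close> are handled on the original space, with its
  seminorm: unless \<open>A = 0\<close>, the norm of \<open>p(P)\<close> is the value of \<open>\<bar>p\<bar>\<close> at some point of the approximate point
  spectrum (\<open>approximate_spectrum_attains_norm\<close>), so a polynomial that is nonnegative on \<open>[0, \<parallel>P\<parallel>]\<close> is a positive
  operator, and the McCarthy inequality follows from a tangent line (\<open>McCarthy_inequality\<close>).  The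
  passage to the completion uses only operators induced by uniformly Cauchy sequences of operators on
  the original space (\<open>lift\<close>); the powers of \<open>P\<close> are of this kind (\<open>cont_fun_calc_eq_lift\<close>).
\<close>

section \<open>Elementary facts on complex Hilbert spaces\<close>

lemma scaleC_zero_left [simp]: "0 *\<^sub>C (x::'a::chilbert_space) = 0"
  using scaleR_eq_scaleC[of 0 x] by simp

lemma scaleC_one [simp]: "1 *\<^sub>C (x::'a::chilbert_space) = x"
  using scaleR_eq_scaleC[of 1 x] by simp

lemma scaleC_minus_one [simp]: "(-1) *\<^sub>C (x::'a::chilbert_space) = - x"
  using scaleR_eq_scaleC[of "-1" x] by simp

lemma scaleC_zero_right [simp]: "c *\<^sub>C (0::'a::chilbert_space) = 0"
  using scaleC_add_right[of c "0::'a" 0] by simp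

lemma scaleC_minus_right: "c *\<^sub>C (- x) = - (c *\<^sub>C (x::'a::chilbert_space))"
  using scaleC_add_right[of c x "- x"] by (simp add: eq_neg_iff_add_eq_0 add.commute)

lemma scaleC_minus_left: "(- c) *\<^sub>C x = - (c *\<^sub>C (x::'a::chilbert_space))"
  using scaleC_add_left[of "-c" c x] by (simp add: eq_neg_iff_add_eq_0)

lemma scaleC_diff_right: "c *\<^sub>C (x - y) = c *\<^sub>C x - c *\<^sub>C (y::'a::chilbert_space)"
  using scaleC_add_right[of c x "- y"] by (simp add: scaleC_minus_right)

lemma scaleC_diff_left: "(c - d) *\<^sub>C x = c *\<^sub>C x - d *\<^sub>C (x::'a::chilbert_space)"
  using scaleC_add_left[of c "- d" x] by (simp add: scaleC_minus_left)

lemma cinner_add_right: "cinner x (y + z) = cinner x y + cinner x (z::'a::chilbert_space)"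
  by (metis cinner_commute cinner_add_left complex_cnj_add)

lemma cinner_scaleC_right: "cinner x (c *\<^sub>C y) = cnj c * cinner x (y::'a::chilbert_space)"
  by (metis cinner_commute cinner_scaleC_left complex_cnj_mult)

lemma cinner_zero_left [simp]: "cinner 0 (y::'a::chilbert_space) = 0"
  using cinner_scaleC_left[of 0 0 y] by simp

lemma cinner_zero_right [simp]: "cinner (y::'a::chilbert_space) 0 = 0"
  using cinner_scaleC_right[of y 0 0] by simp

lemma cinner_minus_left: "cinner (- x) (y::'a::chilbert_space) = - cinner x y"
  using cinner_scaleC_left[of "-1" x y] by simp

lemma cinner_minus_right: "cinner x (- (y::'a::chilbert_space)) = - cinner x y"
  using cinner_scaleC_right[of x "-1" y] by simp

lemma cinner_diff_left: "cinner (x - y) (z::'a::chilbert_space) = cinner x z - cinner y z"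
  using cinner_add_left[of x "- y" z] by (simp add: cinner_minus_left)

lemma cinner_diff_right: "cinner x (y - (z::'a::chilbert_space)) = cinner x y - cinner x z"
  using cinner_add_right[of x y "- z"] by (simp add: cinner_minus_right)

lemma cinner_self_eq_0_iff: "cinner x x = 0 \<longleftrightarrow> (x::'a::chilbert_space) = 0"
  using inner_eq_Re_cinner[of x x] by auto

lemma orth_compl_add: "x \<in> orth_compl M \<Longrightarrow> y \<in> orth_compl M \<Longrightarrow> x + y \<in> orth_compl M"
  by (simp add: orth_compl_def cinner_add_left)

lemma orth_compl_scaleC: "x \<in> orth_compl M \<Longrightarrow> c *\<^sub>C x \<in> orth_compl M"
  by (simp add: orth_compl_def cinner_scaleC_left)

lemma cinner_eqI:
  fixes u v :: "'a::chilbert_space"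
  assumes "\<And>x. cinner x u = cinner x v"
  shows "u = v"
  using assms[of "u - v"] cinner_self_eq_0_iff[of "u - v"] by (simp add: cinner_diff_right)

lemma Im_cinner_eq_inner: "Im (cinner x y) = - inner (\<i> *\<^sub>C x) (y::'a::chilbert_space)"
  by (simp add: inner_eq_Re_cinner cinner_scaleC_left)

lemma bounded_clinear_add: "bounded_clinear T \<Longrightarrow> T (x + y) = T x + T y"
  by (simp add: bounded_clinear_def linear_simps)

lemma bounded_clinear_diff: "bounded_clinear T \<Longrightarrow> T (x - y) = T x - T y"
  by (simp add: bounded_clinear_def linear_simps)

lemma bounded_clinear_zero: "bounded_clinear T \<Longrightarrow> T 0 = 0"
  by (simp add: bounded_clinear_def linear_simps)

lemma bounded_clinear_scaleC: "bounded_clinear T \<Longrightarrow> T (c *\<^sub>C x) = c *\<^sub>C T x"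
  by (simp add: bounded_clinear_def)

lemma bounded_clinear_comp:
  assumes "bounded_clinear T" "bounded_clinear S"
  shows "bounded_clinear (T \<circ> S)"
  using assms bounded_linear_compose[of T S] by (simp add: bounded_clinear_def o_def)

lemma subspace_closure:
  fixes M :: "'a::real_normed_vector set"
  assumes "subspace M"
  shows "subspace (closure M)"
  unfolding subspace_def
proof (intro conjI ballI allI)
  show "0 \<in> closure M" using subspace_0[OF assms] closure_subset by blast
next
  fix x y assume "x \<in> closure M" "y \<in> closure M"
  then obtain f g where "\<And>n. f n \<in> M" "f \<longlonglongrightarrow> x" "\<And>n. g n \<in> M" "g \<longlonglongrightarrow> y"
    by (auto simp: closure_sequential)
  then show "x + y \<in> closure M" unfolding closure_sequential
    by (intro exI[of _ "\<lambda>n. f n + g n"]) (auto intro: tendsto_add subspace_add assms)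
next
  fix c x assume "x \<in> closure M"
  then obtain f where "\<And>n. f n \<in> M" "f \<longlonglongrightarrow> x" by (auto simp: closure_sequential)
  then show "c *\<^sub>R x \<in> closure M" unfolding closure_sequential
    by (intro exI[of _ "\<lambda>n. c *\<^sub>R f n"]) (auto intro: tendsto_scaleR subspace_scale assms)
qed

text \<open>
  A sequence in the subspace whose distances to the given point approach the infimum is Cauchy by the
  parallelogram law; its limit is the foot of the perpendicular.
\<close>

lemma closed_subspace_orthogonal_decomposition:
  fixes M :: "'a::{real_inner,complete_space} set"
  assumes M: "closed M" "subspace M"
  shows "\<exists>m\<in>M. \<forall>k\<in>M. inner (x - m) k = 0"
proof -
  define D where "D = (\<lambda>m. (norm (x - m))\<^sup>2) ` M"
  define d where "d = Inf D"
  have "0 \<in> M" using M(2) by (rule subspace_0)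
  then have ne: "D \<noteq> {}" by (auto simp: D_def)
  have bdd: "bdd_below D" by (rule bdd_belowI[of _ 0]) (auto simp: D_def)
  have d_le: "d \<le> (norm (x - m))\<^sup>2" if "m \<in> M" for m
    unfolding d_def using bdd that by (intro cInf_lower) (auto simp: D_def)
  have "\<exists>m\<in>M. (norm (x - m))\<^sup>2 < d + 1 / real (Suc n)" for n
  proof -
    have "Inf D < d + 1 / real (Suc n)" by (simp add: d_def)
    then obtain e where "e \<in> D" "e < d + 1 / real (Suc n)"
      using cInf_lessD[OF ne] by blast
    then show ?thesis by (auto simp: D_def)
  qed
  then obtain f where f: "\<And>n. f n \<in> M" "\<And>n. (norm (x - f n))\<^sup>2 < d + 1 / real (Suc n)"
    by metis
  have par: "(norm (f i - f j))\<^sup>2 \<le> 2 * (1 / real (Suc i) + 1 / real (Suc j))" for i j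
  proof -
    let ?h = "(1/2) *\<^sub>R (f i + f j)"
    have "?h \<in> M" using f M(2) by (intro subspace_scale subspace_add)
    then have "d \<le> (norm (x - ?h))\<^sup>2" by (rule d_le)
    moreover have "(norm (f i - f j))\<^sup>2 = 2 * (norm (x - f i))\<^sup>2 + 2 * (norm (x - f j))\<^sup>2 - 4 * (norm (x - ?h))\<^sup>2"
      by (simp add: power2_norm_eq_inner inner_diff_left inner_diff_right inner_add_left inner_add_right
          inner_commute algebra_simps)
    ultimately show ?thesis using f(2)[of i] f(2)[of j] by (simp add: algebra_simps)
  qed
  have "Cauchy f"
  proof (rule metric_CauchyI)
    fix e :: real assume e: "e > 0"
    then obtain N where N: "4 / e\<^sup>2 < real N" using reals_Archimedean2 by blast
    have "dist (f i) (f j) < e" if "i \<ge> N" "j \<ge> N" for i j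
    proof -
      have Np: "0 < real N" using N e by (smt (verit) divide_pos_pos zero_less_power)
      have "1 / real (Suc i) \<le> 1 / real N" "1 / real (Suc j) \<le> 1 / real N"
        using that Np by (auto intro!: divide_left_mono)
      then have "(norm (f i - f j))\<^sup>2 \<le> 2 * (1 / real N + 1 / real N)"
        by (intro order_trans[OF par] mult_left_mono add_mono) simp_all
      also have "\<dots> = 4 / real N" by simp
      also have "\<dots> < e\<^sup>2" using N Np e by (simp add: field_simps)
      finally show ?thesis using e by (simp add: dist_norm power2_less_imp_less)
    qed
    then show "\<exists>N. \<forall>m\<ge>N. \<forall>n\<ge>N. dist (f m) (f n) < e" by blast
  qed
  then obtain m where m: "f \<longlonglongrightarrow> m" using Cauchy_convergent convergent_def by blast
  have mM: "m \<in> M" using closed_sequentially[OF M(1)] f(1) m by blast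
  have "(\<lambda>n. (norm (x - f n))\<^sup>2) \<longlonglongrightarrow> (norm (x - m))\<^sup>2" using m by (intro tendsto_intros)
  moreover have "(\<lambda>n. d + 1 / real (Suc n)) \<longlonglongrightarrow> d + 0"
    by (intro tendsto_add tendsto_const LIMSEQ_Suc lim_inverse_n'[unfolded inverse_eq_divide])
  ultimately have m_le: "(norm (x - m))\<^sup>2 \<le> d"
    using f(2) by (intro LIMSEQ_le[of _ _ "\<lambda>n. d + 1 / real (Suc n)"]) (auto intro: less_imp_le)
  have "inner (x - m) k = 0" if k: "k \<in> M" for k
  proof (cases "k = 0")
    case False
    define t where "t = inner (x - m) k / inner k k"
    have kk: "inner k k > 0" using False by simp
    have "m + t *\<^sub>R k \<in> M" using mM k M(2) by (intro subspace_add subspace_scale)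
    then have "(norm (x - m))\<^sup>2 \<le> (norm (x - (m + t *\<^sub>R k)))\<^sup>2" using d_le order_trans[OF m_le] by blast
    also have "\<dots> = (norm (x - m))\<^sup>2 - 2 * t * inner (x - m) k + t\<^sup>2 * inner k k"
      unfolding power2_norm_eq_inner inner_diff_left inner_diff_right inner_add_left inner_add_right
      by (simp add: inner_commute algebra_simps power2_eq_square)
    also have "\<dots> = (norm (x - m))\<^sup>2 - (inner (x - m) k)\<^sup>2 / inner k k"
      using kk by (simp add: t_def power2_eq_square field_simps)
    finally have "(inner (x - m) k)\<^sup>2 / inner k k \<le> 0" by simp
    then show ?thesis using kk by (simp add: divide_le_0_iff)
  qed simp
  then show ?thesis using mM by blast
qed

theorem Riesz_representation:
  fixes f :: "'a::{real_inner,complete_space} \<Rightarrow> real"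
  assumes "bounded_linear f"
  shows "\<exists>z. \<forall>x. f x = inner x z"
proof (cases "\<forall>x. f x = 0")
  case True
  then show ?thesis by (intro exI[of _ 0]) simp
next
  case False
  then obtain u where u: "f u \<noteq> 0" by blast
  interpret f: bounded_linear f by fact
  have "closed {x. f x = 0}"
    by (intro closed_Collect_eq continuous_on_const linear_continuous_on assms)
  moreover have "subspace {x. f x = 0}"
    by (auto simp: subspace_def f.add f.scaleR f.zero)
  ultimately obtain m where m: "f m = 0" "\<And>k. f k = 0 \<Longrightarrow> inner (u - m) k = 0"
    using closed_subspace_orthogonal_decomposition[of "{x. f x = 0}" u] by blast
  define n where "n = u - m"
  have fn: "f n \<noteq> 0" using u m by (simp add: n_def f.diff)
  then have nn: "inner n n \<noteq> 0" using f.zero by auto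
  have "f x = inner x ((f n / inner n n) *\<^sub>R n)" for x
  proof -
    have "f (x - (f x / f n) *\<^sub>R n) = 0" using fn by (simp add: f.diff f.scaleR)
    then have "inner n (x - (f x / f n) *\<^sub>R n) = 0" using m(2) by (simp add: n_def)
    then show ?thesis using fn nn by (simp add: inner_diff_right inner_commute field_simps)
  qed
  then show ?thesis by blast
qed

text \<open>
  By the Baire category theorem one of the closed sets on which the whole family is bounded by \<open>n\<close>
  contains a ball; translating this ball to the origin gives the bound on the norms.
\<close>

theorem uniform_boundedness_principle:
  fixes F :: "('a::{real_normed_vector,complete_space} \<Rightarrow> real) set"
  assumes lin: "\<And>f. f \<in> F \<Longrightarrow> bounded_linear f"
    and pw: "\<And>x. \<exists>C. \<forall>f\<in>F. \<bar>f x\<bar> \<le> C"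
  shows "\<exists>C. \<forall>f\<in>F. \<forall>x. \<bar>f x\<bar> \<le> C * norm x"
proof -
  define E where "E n = {x. \<forall>f\<in>F. \<bar>f x\<bar> \<le> real n}" for n :: nat
  have cl: "closed (E n)" for n
  proof -
    have "E n = (\<Inter>f\<in>F. {x. \<bar>f x\<bar> \<le> real n})" by (auto simp: E_def)
    also have "closed \<dots>"
      by (intro closed_INT ballI closed_Collect_le continuous_on_rabs linear_continuous_on lin continuous_on_const)
    finally show ?thesis .
  qed
  have cover: "\<Union>(range E) = UNIV"
  proof -
    have "\<exists>n. x \<in> E n" for x
    proof -
      obtain C where C: "\<forall>f\<in>F. \<bar>f x\<bar> \<le> C" using pw by blast
      obtain n where "C \<le> real n" using real_arch_simple by blast
      then show ?thesis using C unfolding E_def by (intro exI[of _ n]) (auto intro: order_trans)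
    qed
    then show ?thesis by blast
  qed
  have "\<exists>n. interior (E n) \<noteq> {}"
  proof (rule ccontr)
    assume "\<not> ?thesis"
    then have "Met_TC.mtopology interior_of \<Union>(range E) = {}"
      using cl by (intro Met_TC.metric_Baire_category_alt) (auto simp: complete_UNIV)
    then show False by (simp add: cover)
  qed
  then obtain n y e where e: "e > 0" "cball y e \<subseteq> E n"
    by (metis ex_in_conv mem_interior_cball)
  have "\<bar>f x\<bar> \<le> (2 * real n / e) * norm x" if f: "f \<in> F" for f x
  proof (cases "x = 0")
    case True
    then show ?thesis using lin[OF f] by (simp add: linear_simps)
  next
    case False
    interpret f: bounded_linear f by (rule lin) fact
    define z where "z = (e / norm x) *\<^sub>R x"
    have "norm z = e" using False e by (simp add: z_def)
    then have "y + z \<in> E n" "y \<in> E n" using e by (auto simp: dist_norm subset_iff)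
    then have "\<bar>f (y + z)\<bar> \<le> real n" "\<bar>f y\<bar> \<le> real n" using f by (auto simp: E_def)
    then have "\<bar>f z\<bar> \<le> 2 * real n" by (simp add: f.add)
    then show ?thesis using False e by (simp add: z_def f.scaleR abs_mult field_simps)
  qed
  then show ?thesis by blast
qed

lemma cinner_adjoint_op:
  assumes T: "bounded_clinear T"
  shows "cinner (T x) y = cinner x (adjoint_op T y)"
proof -
  have ex: "\<exists>z. \<forall>x. cinner (T x) y = cinner x z" for y
  proof -
    have "bounded_linear (\<lambda>x. inner (T x) y)"
      using T bounded_linear_compose[OF bounded_linear_inner_left[of y], of T]
      by (simp add: bounded_clinear_def)
    then obtain z where z: "\<And>x. inner (T x) y = inner x z" using Riesz_representation by blast
    have "cinner (T x) y = cinner x z" for x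
    proof (rule complex_eqI)
      show "Re (cinner (T x) y) = Re (cinner x z)" using z[of x] by (simp add: inner_eq_Re_cinner)
      show "Im (cinner (T x) y) = Im (cinner x z)"
        using z[of "\<i> *\<^sub>C x"] T by (simp add: Im_cinner_eq_inner bounded_clinear_scaleC)
    qed
    then show ?thesis by blast
  qed
  then obtain S where S: "\<And>x y. cinner (T x) y = cinner x (S y)" by metis
  have "adjoint_op T = S" unfolding adjoint_op_def
  proof (rule the_equality)
    fix S' assume "\<forall>x y. cinner (T x) y = cinner x (S' y)"
    then show "S' = S" using S by (intro ext cinner_eqI) simp
  qed (use S in blast)
  then show ?thesis using S by simp
qed


section \<open>The semi-inner product induced by a positive operator\<close>

locale positive_op =
  fixes A :: "'a::chilbert_space \<Rightarrow> 'a"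
  assumes pos: "positive_operator A"
begin

abbreviation sip :: "'a \<Rightarrow> 'a \<Rightarrow> complex" where "sip \<equiv> cinner_A A"
abbreviation nrm :: "'a \<Rightarrow> real" where "nrm \<equiv> norm_A A"

lemma bounded_clinear_A: "bounded_clinear A"
  using pos by (simp add: positive_operator_def)

lemma sip_self_nonneg: "sip x x \<in> \<real>\<^sub>\<ge>\<^sub>0"
  using pos by (simp add: positive_operator_def cinner_A_def)

lemma sip_add_left: "sip (x + y) z = sip x z + sip y z"
  by (simp add: cinner_A_def bounded_clinear_add[OF bounded_clinear_A] cinner_add_left)

lemma sip_add_right: "sip z (x + y) = sip z x + sip z y"
  by (simp add: cinner_A_def cinner_add_right)

lemma sip_diff_left: "sip (x - y) z = sip x z - sip y z"
  by (simp add: cinner_A_def bounded_clinear_diff[OF bounded_clinear_A] cinner_diff_left)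

lemma sip_diff_right: "sip z (x - y) = sip z x - sip z y"
  by (simp add: cinner_A_def cinner_diff_right)

lemma sip_scaleC_left: "sip (c *\<^sub>C x) y = c * sip x y"
  by (simp add: cinner_A_def bounded_clinear_scaleC[OF bounded_clinear_A] cinner_scaleC_left)

lemma sip_scaleC_right: "sip x (c *\<^sub>C y) = cnj c * sip x y"
  by (simp add: cinner_A_def cinner_scaleC_right)

lemma sip_zero [simp]: "sip 0 x = 0" "sip x 0 = 0"
  using sip_scaleC_left[of 0 0 x] sip_scaleC_right[of x 0 0] by simp_all

text \<open>Hermitian symmetry comes from real values on the diagonal, by polarization.\<close>

lemma sip_commute: "sip x y = cnj (sip y x)"
proof -
  have im: "Im (sip z z) = 0" for z using sip_self_nonneg[of z] by (auto simp: nonneg_Reals_def)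
  have "Im (sip (x + y) (x + y)) = 0" "Im (sip (x + \<i> *\<^sub>C y) (x + \<i> *\<^sub>C y)) = 0" by (rule im)+
  then show ?thesis using im[of x] im[of y]
    by (simp add: complex_eq_iff sip_add_left sip_add_right sip_scaleC_left sip_scaleC_right)
qed

lemma nrm_square: "(nrm x)\<^sup>2 = Re (sip x x)"
  using sip_self_nonneg[of x] by (auto simp: norm_A_def nonneg_Reals_def)

lemma sip_self: "sip x x = complex_of_real ((nrm x)\<^sup>2)"
  using sip_self_nonneg[of x] by (auto simp: nrm_square nonneg_Reals_def)

lemma nrm_nonneg [simp]: "0 \<le> nrm x"
  using sip_self_nonneg[of x] by (auto simp: norm_A_def nonneg_Reals_def)

lemma nrm_zero [simp]: "nrm 0 = 0"
  by (simp add: norm_A_def)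

lemma nrm_scaleC: "nrm (c *\<^sub>C x) = cmod c * nrm x"
proof -
  have "(nrm (c *\<^sub>C x))\<^sup>2 = (cmod c * nrm x)\<^sup>2"
  proof -
    have "sip (c *\<^sub>C x) (c *\<^sub>C x) = (c * cnj c) * sip x x"
      by (simp add: sip_scaleC_left sip_scaleC_right)
    also have "c * cnj c = complex_of_real ((cmod c)\<^sup>2)" by (simp only: complex_norm_square)
    finally show ?thesis by (simp add: nrm_square power_mult_distrib)
  qed
  then show ?thesis by (simp add: power2_eq_iff_nonneg)
qed

lemma nrm_minus: "nrm (- x) = nrm x"
  using nrm_scaleC[of "-1" x] by simp

lemma nrm_diff_commute: "nrm (x - y) = nrm (y - x)"
  using nrm_minus[of "x - y"] by simp

lemma sip_Cauchy_Schwarz: "cmod (sip x y) \<le> nrm x * nrm y"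
proof -
  define c where "c = sip x y"
  have ineq: "2 * t * (cmod c)\<^sup>2 \<le> (nrm x)\<^sup>2 + t\<^sup>2 * (cmod c)\<^sup>2 * (nrm y)\<^sup>2" for t :: real
  proof -
    let ?d = "complex_of_real t * c"
    have cc: "c * cnj c = complex_of_real ((cmod c)\<^sup>2)" by (simp only: complex_norm_square)
    have "sip (x - ?d *\<^sub>C y) (x - ?d *\<^sub>C y) = complex_of_real ((nrm x)\<^sup>2)
        - 2 * complex_of_real t * (c * cnj c) + complex_of_real (t\<^sup>2) * (c * cnj c) * complex_of_real ((nrm y)\<^sup>2)"
      using sip_commute[of y x]
      unfolding c_def sip_diff_left sip_diff_right sip_scaleC_left sip_scaleC_right sip_self[of x] sip_self[of y]
      by (simp add: power2_eq_square algebra_simps)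
    also have "\<dots> = complex_of_real ((nrm x)\<^sup>2 - 2 * t * (cmod c)\<^sup>2 + t\<^sup>2 * (cmod c)\<^sup>2 * (nrm y)\<^sup>2)"
      unfolding cc by simp
    finally have "(nrm (x - ?d *\<^sub>C y))\<^sup>2 = (nrm x)\<^sup>2 - 2 * t * (cmod c)\<^sup>2 + t\<^sup>2 * (cmod c)\<^sup>2 * (nrm y)\<^sup>2"
      by (simp only: nrm_square Re_complex_of_real)
    then show ?thesis by (smt (verit) zero_le_power2)
  qed
  have "(cmod c)\<^sup>2 \<le> (nrm x)\<^sup>2 * (nrm y)\<^sup>2"
  proof (cases "nrm y = 0")
    case True
    have "c = 0"
    proof (rule ccontr)
      assume "c \<noteq> 0"
      then have "(cmod c)\<^sup>2 > 0" by simp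
      moreover have "2 * (((nrm x)\<^sup>2 + 1) / (2 * (cmod c)\<^sup>2)) * (cmod c)\<^sup>2 \<le> (nrm x)\<^sup>2"
        using ineq[of "((nrm x)\<^sup>2 + 1) / (2 * (cmod c)\<^sup>2)"] True by simp
      ultimately show False by (simp add: field_simps)
    qed
    then show ?thesis by simp
  next
    case False
    define q where "q = (nrm y)\<^sup>2"
    have q: "q > 0" using False by (simp add: q_def)
    have "2 * (1 / q) * (cmod c)\<^sup>2 \<le> (nrm x)\<^sup>2 + (1 / q)\<^sup>2 * (cmod c)\<^sup>2 * q"
      using ineq[of "1 / q"] by (simp add: q_def)
    also have "(1 / q)\<^sup>2 * (cmod c)\<^sup>2 * q = (1 / q) * (cmod c)\<^sup>2"
      using q by (simp add: power2_eq_square)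
    finally have "(cmod c)\<^sup>2 / q \<le> (nrm x)\<^sup>2" by simp
    then show ?thesis using q by (simp add: pos_divide_le_eq flip: q_def)
  qed
  then show ?thesis
    by (simp add: c_def flip: power_mult_distrib)
qed

lemma nrm_triangle: "nrm (x + y) \<le> nrm x + nrm y"
proof -
  have "(nrm (x + y))\<^sup>2 = (nrm x)\<^sup>2 + (nrm y)\<^sup>2 + 2 * Re (sip x y)"
    using sip_commute[of y x] by (simp add: nrm_square sip_add_left sip_add_right)
  also have "\<dots> \<le> (nrm x)\<^sup>2 + (nrm y)\<^sup>2 + 2 * (nrm x * nrm y)"
    using sip_Cauchy_Schwarz[of x y] complex_Re_le_cmod[of "sip x y"] by linarith
  also have "\<dots> = (nrm x + nrm y)\<^sup>2" by (simp add: power2_sum)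
  finally show ?thesis by (rule power2_le_imp_le) simp
qed

lemma nrm_triangle_diff: "nrm (x - z) \<le> nrm (x - y) + nrm (y - z)"
  using nrm_triangle[of "x - y" "y - z"] by simp

lemma nrm_reverse_triangle: "\<bar>nrm x - nrm y\<bar> \<le> nrm (x - y)"
  using nrm_triangle[of "x - y" y] nrm_triangle[of "y - x" x] by (simp add: nrm_diff_commute abs_le_iff)

text \<open>Buzano's inequality: \<open>2\<langle>a,e\<rangle>e - a\<close> is a reflection of \<open>a\<close>, so it has the seminorm of \<open>a\<close>.\<close>

lemma Buzano_inequality:
  assumes e: "nrm e = 1"
  shows "cmod (sip a e) * cmod (sip e b) \<le> (nrm a * nrm b + cmod (sip a b)) / 2"
proof -
  define d where "d = 2 * sip a e"
  define v where "v = d *\<^sub>C e - a"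
  have "sip v v = sip a a"
    using sip_self[of e] e sip_commute[of e a]
    by (simp add: v_def d_def sip_diff_left sip_diff_right sip_scaleC_left sip_scaleC_right algebra_simps)
  then have "nrm v = nrm a" by (simp add: norm_A_def)
  moreover have "sip v b = d * sip e b - sip a b"
    by (simp add: v_def sip_diff_left sip_scaleC_left)
  ultimately have "cmod (d * sip e b - sip a b) \<le> nrm a * nrm b"
    using sip_Cauchy_Schwarz[of v b] by simp
  moreover have "cmod (d * sip e b) \<le> cmod (d * sip e b - sip a b) + cmod (sip a b)"
    by (metis diff_add_cancel norm_triangle_ineq)
  ultimately show ?thesis by (simp add: d_def norm_mult)
qed

lemma nrm_bounded_by_norm: "\<exists>C>0. \<forall>x. nrm x \<le> C * norm x"
proof -
  obtain K where K: "K > 0" "\<And>x. norm (A x) \<le> norm x * K"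
    using bounded_clinear_A bounded_linear.pos_bounded[of A] by (auto simp: bounded_clinear_def)
  have "nrm x \<le> sqrt K * norm x" for x
  proof -
    have "(nrm x)\<^sup>2 = inner (A x) x" by (simp add: nrm_square cinner_A_def inner_eq_Re_cinner)
    also have "\<dots> \<le> norm (A x) * norm x" by (rule norm_cauchy_schwarz)
    also have "\<dots> \<le> (norm x * K) * norm x" by (intro mult_right_mono K) simp
    also have "\<dots> = (sqrt K * norm x)\<^sup>2" using K(1) by (simp add: power_mult_distrib power2_eq_square)
    finally show ?thesis by (rule power2_le_imp_le) (use K(1) in simp)
  qed
  then show ?thesis using K(1) by (intro exI[of _ "sqrt K"]) simp
qed


subsection \<open>The A-adjoint\<close>

lemma A_selfadjoint: "cinner (A x) y = cinner x (A y)"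
  using sip_commute[of x y] cinner_commute[of x "A y"] by (simp add: cinner_A_def)

lemma ker_A_decomposition: "\<exists>w. A w = A x \<and> w \<in> orth_compl {z. A z = 0}"
proof -
  have "closed {z. A z = 0}" using bounded_clinear_A
    by (intro closed_Collect_eq continuous_on_const linear_continuous_on) (simp add: bounded_clinear_def)
  moreover have "subspace {z. A z = 0}"
    by (auto simp: subspace_def bounded_clinear_add[OF bounded_clinear_A] bounded_clinear_zero[OF bounded_clinear_A]
        scaleR_eq_scaleC bounded_clinear_scaleC[OF bounded_clinear_A])
  ultimately obtain m where m: "A m = 0" "\<And>k. A k = 0 \<Longrightarrow> inner (x - m) k = 0"
    using closed_subspace_orthogonal_decomposition[of "{z. A z = 0}" x] by blast
  have "cinner (x - m) k = 0" if k: "A k = 0" for k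
  proof -
    have "A (\<i> *\<^sub>C k) = 0" by (simp add: bounded_clinear_scaleC[OF bounded_clinear_A] k)
    then have "inner (x - m) (\<i> *\<^sub>C k) = 0" by (rule m(2))
    with m(2)[OF k] show ?thesis by (simp add: inner_eq_Re_cinner cinner_scaleC_right complex_eq_iff)
  qed
  then show ?thesis using m(1)
    by (intro exI[of _ "x - m"]) (auto simp: orth_compl_def bounded_clinear_diff[OF bounded_clinear_A])
qed

lemma orth_compl_ker_unique:
  assumes "A w = A w'" "w \<in> orth_compl {z. A z = 0}" "w' \<in> orth_compl {z. A z = 0}"
  shows "w = w'"
proof -
  have "A (w - w') = 0" using assms(1) by (simp add: bounded_clinear_diff[OF bounded_clinear_A])
  then have "cinner w (w - w') = 0" "cinner w' (w - w') = 0"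
    using assms(2,3) by (auto simp: orth_compl_def)
  then have "cinner (w - w') (w - w') = 0" by (simp add: cinner_diff_left)
  then show ?thesis using cinner_self_eq_0_iff[of "w - w'"] by simp
qed

lemma moore_penrose_A:
  assumes "w \<in> orth_compl {z. A z = 0}"
  shows "moore_penrose A (A w) = w"
  unfolding moore_penrose_def
proof (rule the_equality)
  show "w \<in> orth_compl {z. A z = 0} \<and> A w - A w \<in> orth_compl (range A)"
    using assms by (simp add: orth_compl_def)
next
  fix w' assume w': "w' \<in> orth_compl {z. A z = 0} \<and> A w - A w' \<in> orth_compl (range A)"
  have "A w - A w' = A (w - w')" by (simp add: bounded_clinear_diff[OF bounded_clinear_A])
  then have "cinner (A w - A w') (A w - A w') = 0" using w' by (auto simp: orth_compl_def)
  then have "A w' = A w" using cinner_self_eq_0_iff[of "A w - A w'"] by simp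
  then show "w' = w" using w' assms by (rule orth_compl_ker_unique[OF _ conjunct1])
qed

lemma A_eqI:
  assumes "\<And>u. sip x u = sip y u"
  shows "A x = A y"
proof (rule cinner_eqI)
  fix u
  show "cinner u (A x) = cinner u (A y)"
    using assms[of u] cinner_commute[of u "A x"] cinner_commute[of u "A y"] by (simp add: cinner_A_def)
qed

lemma sharp_A_spec:
  assumes "T \<in> B_A A"
  shows "A (sharp_A A T x) = adjoint_op T (A x)" and "sharp_A A T x \<in> orth_compl {z. A z = 0}"
proof -
  obtain y where "adjoint_op T (A x) = A y" using assms by (force simp: B_A_def)
  moreover obtain w where "A w = A y" "w \<in> orth_compl {z. A z = 0}" using ker_A_decomposition by blast
  ultimately show "A (sharp_A A T x) = adjoint_op T (A x)" "sharp_A A T x \<in> orth_compl {z. A z = 0}"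
    using moore_penrose_A[of w] by (simp_all add: sharp_A_def)
qed

lemma sip_sharp_A:
  assumes "T \<in> B_A A"
  shows "sip (sharp_A A T x) y = sip x (T y)"
proof -
  have "cinner (T y) (A x) = cinner y (adjoint_op T (A x))"
    using assms by (intro cinner_adjoint_op) (simp add: B_A_def)
  then have "cinner (adjoint_op T (A x)) y = cinner (A x) (T y)"
    using cinner_commute[of "A x" "T y"] cinner_commute[of "adjoint_op T (A x)" y] by simp
  then show ?thesis by (simp add: cinner_A_def sharp_A_spec(1)[OF assms])
qed

lemma orth_compl_ker_approx:
  assumes z: "z \<in> orth_compl {z. A z = 0}" and "e > 0"
  shows "\<exists>w. norm (z - A w) < e"
proof -
  have sub: "subspace (range A)" using bounded_clinear_A
    by (intro subspace_UNIV linear_subspace_image) (auto simp: bounded_clinear_def bounded_linear.linear)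
  then have "subspace (closure (range A))" by (rule subspace_closure)
  then obtain m where m: "m \<in> closure (range A)" "\<And>k. k \<in> closure (range A) \<Longrightarrow> inner (z - m) k = 0"
    using closed_subspace_orthogonal_decomposition[OF closed_closure, of "range A" z] by blast
  have in_cl: "A y \<in> closure (range A)" for y using closure_subset[of "range A"] by blast
  have "cinner (A (z - m)) (A (z - m)) = cinner (z - m) (A (A (z - m)))" by (rule A_selfadjoint)
  then have "inner (A (z - m)) (A (z - m)) = inner (z - m) (A (A (z - m)))"
    by (simp add: inner_eq_Re_cinner)
  then have "A (z - m) = 0" using m(2)[OF in_cl] by simp
  then have "inner z (z - m) = 0" using z by (auto simp: orth_compl_def inner_eq_Re_cinner)
  moreover have "inner (z - m) m = 0" by (rule m(2)) fact
  ultimately have "inner (z - m) (z - m) = 0" by (simp add: inner_diff_left inner_diff_right inner_commute)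
  then have "z \<in> closure (range A)" using m(1) by simp
  then obtain w where "dist (A w) z < e"
    using closure_approachable[of z "range A"] assms(2) by blast
  then show ?thesis by (auto simp: dist_norm norm_minus_commute)
qed

text \<open>
  The A-adjoint takes its values in the closure of the range of \<open>A\<close>, so its norm is computed by
  testing against vectors \<open>A w\<close>; tested against such a vector it is the functional
  \<open>y \<mapsto> \<langle>A y, T w\<rangle>\<close>, which is bounded.  Boundedness of the A-adjoint is thus an instance of the uniform
  boundedness principle.
\<close>

lemma bounded_clinear_sharp_A:
  assumes T: "T \<in> B_A A"
  shows "bounded_clinear (sharp_A A T)"
proof -
  let ?X = "sharp_A A T"
  note X = sharp_A_spec[OF T]
  have Asum: "A (?X (x + y)) = A (?X x + ?X y)" for x y
    by (rule A_eqI) (simp add: sip_sharp_A[OF T] sip_add_left)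
  have add: "?X (x + y) = ?X x + ?X y" for x y
    by (rule orth_compl_ker_unique[OF Asum]) (intro X(2) orth_compl_add)+
  have Ascale: "A (?X (c *\<^sub>C x)) = A (c *\<^sub>C ?X x)" for c x
    by (rule A_eqI) (simp add: sip_sharp_A[OF T] sip_scaleC_left)
  have scale: "?X (c *\<^sub>C x) = c *\<^sub>C ?X x" for c x
    by (rule orth_compl_ker_unique[OF Ascale]) (intro X(2) orth_compl_scaleC)+
  define F where "F = {(\<lambda>y. inner (?X y) (A w)) | w. norm (A w) \<le> 1}"
  have "\<exists>C. \<forall>f\<in>F. \<forall>x. \<bar>f x\<bar> \<le> C * norm x"
  proof (rule uniform_boundedness_principle)
    fix f assume "f \<in> F"
    then obtain w where w: "f = (\<lambda>y. inner (?X y) (A w))" by (auto simp: F_def)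
    have "inner (?X y) (A w) = inner (A y) (T w)" for y
      using A_selfadjoint[of "?X y" w] sip_sharp_A[OF T, of y w]
      by (simp add: cinner_A_def inner_eq_Re_cinner)
    then have "f = (\<lambda>y. inner (A y) (T w))" by (simp add: w)
    then show "bounded_linear f"
      using bounded_clinear_A bounded_linear_compose[OF bounded_linear_inner_left[of "T w"], of A]
      by (simp add: bounded_clinear_def)
  next
    fix y
    have "\<bar>f y\<bar> \<le> norm (?X y)" if f: "f \<in> F" for f
    proof -
      obtain w where w: "f = (\<lambda>y. inner (?X y) (A w))" "norm (A w) \<le> 1" using f unfolding F_def by blast
      have "\<bar>f y\<bar> \<le> norm (?X y) * norm (A w)" unfolding w(1) by (rule Cauchy_Schwarz_ineq2)
      also have "\<dots> \<le> norm (?X y) * 1" by (intro mult_left_mono w) simp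
      finally show ?thesis by simp
    qed
    then show "\<exists>C. \<forall>f\<in>F. \<bar>f y\<bar> \<le> C" by blast
  qed
  then obtain C where C: "\<And>f x. f \<in> F \<Longrightarrow> \<bar>f x\<bar> \<le> C * norm x" by blast
  have bd: "norm (?X y) \<le> norm y * C" for y
  proof (rule ccontr)
    assume "\<not> ?thesis"
    then have gt: "C * norm y < norm (?X y)" by (simp add: mult.commute)
    define z where "z = ?X y"
    have "(\<lambda>y. inner (?X y) (A 0)) \<in> F" unfolding F_def
      by (intro CollectI exI[of _ 0]) (simp add: bounded_clinear_zero[OF bounded_clinear_A])
    from C[OF this, of y] have C0: "0 \<le> C * norm y"
      by (simp add: bounded_clinear_zero[OF bounded_clinear_A])
    then have z0: "norm z > 0" using le_less_trans[OF _ gt] by (simp only: z_def)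
    define e where "e = norm z - C * norm y"
    have "e / 2 > 0" using gt by (simp add: e_def z_def)
    then obtain w where w: "norm (z - A w) < e / 2"
      using orth_compl_ker_approx[OF X(2), of "e/2" y] by (auto simp: z_def)
    have zw: "inner z (A w) \<le> C * norm y * norm (A w)"
    proof (cases "A w = 0")
      case False
      define w' where "w' = complex_of_real (1 / norm (A w)) *\<^sub>C w"
      have Aw': "A w' = (1 / norm (A w)) *\<^sub>R A w"
        by (simp add: w'_def bounded_clinear_scaleC[OF bounded_clinear_A] scaleR_eq_scaleC)
      have "(\<lambda>y. inner (?X y) (A w')) \<in> F" unfolding F_def
        by (intro CollectI exI[of _ w']) (simp add: Aw')
      from C[OF this, of y] have "inner z (A w) / norm (A w) \<le> C * norm y"
        using divide_right_mono[OF abs_ge_self norm_ge_zero, of "inner z (A w)" "A w"] by (simp add: Aw' z_def)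
      then show ?thesis using False by (simp add: field_simps)
    qed simp
    have "norm z * norm z = inner z (z - A w) + inner z (A w)"
      by (simp add: inner_diff_right power2_norm_eq_inner flip: power2_eq_square)
    also have "\<dots> \<le> norm z * norm (z - A w) + C * norm y * norm (A w)"
      using norm_cauchy_schwarz[of z "z - A w"] zw by linarith
    also have "\<dots> \<le> norm z * norm (z - A w) + C * norm y * (norm z + norm (z - A w))"
      using norm_triangle_ineq4[of z "z - A w"] by (intro add_left_mono mult_left_mono C0) simp
    finally have "norm z * norm z \<le> norm z * norm (z - A w) + C * norm y * (norm z + norm (z - A w))" .
    also have "\<dots> \<le> norm z * (2 * norm (z - A w)) + C * norm y * norm z"
      using gt mult_right_mono[of "C * norm y" "norm z" "norm (z - A w)"] by (simp add: z_def algebra_simps)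
    also have "\<dots> < norm z * e + C * norm y * norm z"
      using w z0 by (simp add: mult_strict_left_mono)
    also have "\<dots> = norm z * norm z" by (simp add: e_def algebra_simps)
    finally show False by simp
  qed
  show ?thesis unfolding bounded_clinear_def
    using add scale bd by (auto intro!: bounded_linear_intro[where K = C] simp: scaleR_eq_scaleC)
qed

end

section \<open>Operators that are bounded for the seminorm\<close>

definition complex_linear :: "('a::chilbert_space \<Rightarrow> 'a) \<Rightarrow> bool" where
  "complex_linear L \<longleftrightarrow> (\<forall>x y. L (x + y) = L x + L y) \<and> (\<forall>c x. L (c *\<^sub>C x) = c *\<^sub>C L x)"

lemma complex_linear_add: "complex_linear L \<Longrightarrow> L (x + y) = L x + L y"
  and complex_linear_scaleC: "complex_linear L \<Longrightarrow> L (c *\<^sub>C x) = c *\<^sub>C L x"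
  by (simp_all add: complex_linear_def)

lemma complex_linear_zero: "complex_linear L \<Longrightarrow> L 0 = 0"
  using complex_linear_scaleC[of L 0 0] by simp

lemma complex_linear_diff: "complex_linear L \<Longrightarrow> L (x - y) = L x - L y"
  using complex_linear_add[of L x "-1 *\<^sub>C y"] complex_linear_scaleC[of L "-1" y] by simp

lemma complex_linear_comp: "complex_linear L \<Longrightarrow> complex_linear M \<Longrightarrow> complex_linear (\<lambda>x. L (M x))"
  by (simp add: complex_linear_def)

context positive_op
begin

definition A_bounded :: "('a \<Rightarrow> 'a) \<Rightarrow> bool" where
  "A_bounded L \<longleftrightarrow> complex_linear L \<and> (\<exists>C. \<forall>x. nrm (L x) \<le> C * nrm x)"

definition A_symmetric :: "('a \<Rightarrow> 'a) \<Rightarrow> bool" where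
  "A_symmetric L \<longleftrightarrow> (\<forall>x y. sip (L x) y = sip x (L y))"

definition A_bounded_below :: "('a \<Rightarrow> 'a) \<Rightarrow> bool" where
  "A_bounded_below L \<longleftrightarrow> (\<exists>d>0. \<forall>x. d * nrm x \<le> nrm (L x))"

lemma A_boundedI:
  assumes "complex_linear L" "\<And>x. nrm (L x) \<le> C * nrm x"
  shows "A_bounded L"
  using assms by (auto simp: A_bounded_def)

lemma A_bounded_linear: "A_bounded L \<Longrightarrow> complex_linear L"
  by (simp add: A_bounded_def)

lemma A_boundedE:
  assumes "A_bounded L"
  obtains C where "C \<ge> 0" "\<And>x. nrm (L x) \<le> C * nrm x"
proof -
  obtain C where C: "\<And>x. nrm (L x) \<le> C * nrm x" using assms by (auto simp: A_bounded_def)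
  have "nrm (L x) \<le> max C 0 * nrm x" for x
    by (rule order_trans[OF C]) (simp add: mult_right_mono)
  then show ?thesis using that[of "max C 0"] by simp
qed

lemma A_bounded_null: "A_bounded L \<Longrightarrow> nrm x = 0 \<Longrightarrow> nrm (L x) = 0"
  by (metis A_boundedE antisym mult_zero_right nrm_nonneg)

lemma A_bounded_zero [simp]: "A_bounded (\<lambda>_. 0)"
  by (rule A_boundedI[where C = 0]) (simp_all add: complex_linear_def)

lemma A_bounded_ident [simp]: "A_bounded (\<lambda>x. x)"
  by (rule A_boundedI[where C = 1]) (simp_all add: complex_linear_def)

lemma A_bounded_add:
  assumes "A_bounded L" "A_bounded M"
  shows "A_bounded (\<lambda>x. L x + M x)"
proof -
  obtain C D where "\<And>x. nrm (L x) \<le> C * nrm x" "\<And>x. nrm (M x) \<le> D * nrm x"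
    using assms by (meson A_bounded_def)
  then have "nrm (L x + M x) \<le> (C + D) * nrm x" for x
    using nrm_triangle[of "L x" "M x"] by (smt (verit) distrib_right)
  moreover have "complex_linear (\<lambda>x. L x + M x)"
    using assms by (simp add: A_bounded_def complex_linear_def scaleC_add_right)
  ultimately show ?thesis by (rule A_boundedI[rotated])
qed

lemma A_bounded_scaleC:
  assumes "A_bounded L"
  shows "A_bounded (\<lambda>x. c *\<^sub>C L x)"
proof -
  obtain C where "\<And>x. nrm (L x) \<le> C * nrm x" using assms by (meson A_bounded_def)
  then have "nrm (c *\<^sub>C L x) \<le> (cmod c * C) * nrm x" for x
    by (simp add: nrm_scaleC mult.assoc mult_left_mono)
  moreover have "complex_linear (\<lambda>x. c *\<^sub>C L x)"
    using assms by (simp add: A_bounded_def complex_linear_def scaleC_add_right scaleC_scaleC mult.commute)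
  ultimately show ?thesis by (rule A_boundedI[rotated])
qed

lemma A_bounded_diff:
  assumes "A_bounded L" "A_bounded M"
  shows "A_bounded (\<lambda>x. L x - M x)"
  using A_bounded_add[OF assms(1) A_bounded_scaleC[OF assms(2), of "-1"]] by simp

lemma A_bounded_comp:
  assumes "A_bounded L" "A_bounded M"
  shows "A_bounded (\<lambda>x. L (M x))"
proof -
  obtain C where C: "C \<ge> 0" "\<And>x. nrm (L x) \<le> C * nrm x" using A_boundedE[OF assms(1)] by blast
  obtain D where D: "\<And>x. nrm (M x) \<le> D * nrm x" using assms(2) by (meson A_bounded_def)
  have "nrm (L (M x)) \<le> (C * D) * nrm x" for x
    using C(2)[of "M x"] mult_left_mono[OF D C(1), of x] by (simp add: mult.assoc)
  moreover have "complex_linear (\<lambda>x. L (M x))"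
    using assms by (simp add: A_bounded_def complex_linear_comp)
  ultimately show ?thesis by (rule A_boundedI[rotated])
qed

lemma nrm_normalize: "nrm x \<noteq> 0 \<Longrightarrow> nrm (complex_of_real (1 / nrm x) *\<^sub>C x) = 1"
  by (simp add: nrm_scaleC norm_divide)

lemma opnorm_A_bdd_above:
  assumes "A_bounded L"
  shows "bdd_above (insert 0 {nrm (L x) | x. nrm x = 1})"
proof -
  obtain C where "C \<ge> 0" "\<And>x. nrm (L x) \<le> C * nrm x" using A_boundedE[OF assms] by blast
  then show ?thesis by (intro bdd_aboveI[of _ C]) (auto, metis mult.right_neutral)
qed

lemma opnorm_A_nonneg: "A_bounded L \<Longrightarrow> 0 \<le> opnorm_A A L"
  unfolding opnorm_A_def by (intro cSup_upper opnorm_A_bdd_above) auto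

lemma opnorm_A_bound:
  assumes "A_bounded L"
  shows "nrm (L x) \<le> opnorm_A A L * nrm x"
proof (cases "nrm x = 0")
  case True
  then show ?thesis using A_bounded_null[OF assms] by simp
next
  case False
  let ?y = "complex_of_real (1 / nrm x) *\<^sub>C x"
  have "nrm (L ?y) \<le> opnorm_A A L"
    unfolding opnorm_A_def using nrm_normalize[OF False]
    by (intro cSup_upper opnorm_A_bdd_above assms) blast
  moreover have "nrm (L ?y) = nrm (L x) / nrm x"
    by (simp add: complex_linear_scaleC[OF A_bounded_linear[OF assms]] nrm_scaleC norm_divide)
  moreover have "nrm x > 0" using False nrm_nonneg[of x] by linarith
  ultimately show ?thesis by (simp add: pos_divide_le_eq)
qed

lemma opnorm_A_le:
  assumes "0 \<le> C" "\<And>x. nrm x = 1 \<Longrightarrow> nrm (L x) \<le> C"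
  shows "opnorm_A A L \<le> C"
  unfolding opnorm_A_def using assms by (intro cSup_least) auto

text \<open>
  The sequence \<open>nrm (P\<^sup>k x)\<close> is logarithmically convex, whence
  \<open>nrm (P x) ^ k \<le> nrm x ^ (k - 1) * nrm (P\<^sup>k x)\<close>; its growth is controlled by the ordinary operator norm,
  and taking \<open>k\<close>-th roots makes the ratio of the norm to the seminorm of \<open>x\<close> disappear.
\<close>

lemma A_symmetric_imp_A_bounded:
  assumes P: "bounded_clinear P" and sym: "A_symmetric P"
  shows "A_bounded P"
proof -
  obtain K where K: "K > 0" "\<And>x. norm (P x) \<le> norm x * K"
    using P bounded_linear.pos_bounded[of P] by (auto simp: bounded_clinear_def)
  obtain C where C: "C > 0" "\<And>x. nrm x \<le> C * norm x" using nrm_bounded_by_norm by blast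
  have pow: "norm ((P ^^ k) x) \<le> norm x * K ^ k" for k x
  proof (induction k)
    case (Suc k)
    have "norm ((P ^^ Suc k) x) \<le> norm ((P ^^ k) x) * K" using K(2) by simp
    also have "\<dots> \<le> norm x * K ^ k * K" using Suc K(1) by (intro mult_right_mono) auto
    finally show ?case by (simp add: mult_ac)
  qed simp
  have logconv: "(nrm (P y))\<^sup>2 \<le> nrm y * nrm (P (P y))" for y
  proof -
    have "(nrm (P y))\<^sup>2 = Re (sip y (P (P y)))"
      using sym by (simp add: nrm_square A_symmetric_def)
    also have "\<dots> \<le> nrm y * nrm (P (P y))"
      using sip_Cauchy_Schwarz[of y "P (P y)"] complex_Re_le_cmod[of "sip y (P (P y))"] by linarith
    finally show ?thesis .
  qed
  have "nrm (P x) \<le> K * nrm x" for x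
  proof (cases "nrm x = 0 \<or> nrm (P x) = 0")
    case True
    then show ?thesis using logconv[of x] K(1) by auto
  next
    case False
    define a where "a = nrm x"
    define b where "b = nrm (P x)"
    have a: "a > 0" and b: "b > 0"
      using False nrm_nonneg[of x] nrm_nonneg[of "P x"] unfolding a_def b_def by linarith+
    have growth: "nrm ((P ^^ k) x) > 0 \<and> nrm ((P ^^ k) x) * b \<le> a * nrm ((P ^^ Suc k) x)" for k
    proof (induction k)
      case 0
      then show ?case using a by (simp add: a_def b_def)
    next
      case (Suc k)
      let ?n = "\<lambda>k. nrm ((P ^^ k) x)"
      have pos: "?n (Suc k) > 0" using Suc a b by (smt (verit) mult_pos_pos zero_less_mult_pos)
      have "?n (Suc k) * ?n (Suc k) * b \<le> ?n k * ?n (Suc (Suc k)) * b"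
        using logconv[of "(P ^^ k) x"] b by (intro mult_right_mono) (simp_all add: power2_eq_square)
      also have "\<dots> = (?n k * b) * ?n (Suc (Suc k))" by simp
      also have "\<dots> \<le> (a * ?n (Suc k)) * ?n (Suc (Suc k))" using Suc by (intro mult_right_mono) auto
      finally have "?n (Suc k) * b \<le> a * ?n (Suc (Suc k))"
        using pos by (simp add: mult.assoc mult.left_commute)
      then show ?case using pos by simp
    qed
    have ratio: "(b / a) ^ k * a \<le> nrm ((P ^^ k) x)" for k
    proof (induction k)
      case (Suc k)
      have "(b / a) ^ Suc k * a = ((b / a) ^ k * a) * b / a" by simp
      also have "\<dots> \<le> nrm ((P ^^ k) x) * b / a"
        using Suc a b by (intro divide_right_mono mult_right_mono) auto
      also have "\<dots> \<le> nrm ((P ^^ Suc k) x)" using growth[of k] a by (simp add: field_simps)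
      finally show ?case .
    qed (simp add: a_def)
    have "b / (a * K) \<le> 1"
    proof (rule ccontr)
      assume "\<not> ?thesis"
      then have "1 < b / (a * K)" by simp
      from real_arch_pow[OF this, of "C * norm x / a"] obtain k where k: "C * norm x / a < (b / (a * K)) ^ k"
        by blast
      have "(b / a) ^ k * a \<le> C * (norm x * K ^ k)"
        using ratio[of k] C(2)[of "(P ^^ k) x"] mult_left_mono[OF pow[of k x], of C] C(1) by linarith
      then have "(b / (a * K)) ^ k \<le> C * norm x / a"
        using a K(1) by (simp add: field_simps power_mult_distrib power_divide)
      then show False using k by simp
    qed
    then show ?thesis using a K(1) by (simp add: field_simps a_def b_def)
  qed
  moreover have "complex_linear P"
    using P by (simp add: complex_linear_def bounded_clinear_add bounded_clinear_scaleC)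
  ultimately show ?thesis by (rule A_boundedI[rotated])
qed

end


section \<open>Polynomials of an operator and the approximate point spectrum\<close>

text \<open>Complex coefficients, so that a polynomial of an operator splits into linear factors.\<close>

definition op_cpoly :: "('a::chilbert_space \<Rightarrow> 'a) \<Rightarrow> complex poly \<Rightarrow> 'a \<Rightarrow> 'a" where
  "op_cpoly P q = fold_coeffs (\<lambda>a R x. a *\<^sub>C x + P (R x)) q (\<lambda>_. 0)"

abbreviation op_rpoly :: "('a::chilbert_space \<Rightarrow> 'a) \<Rightarrow> real poly \<Rightarrow> 'a \<Rightarrow> 'a" where
  "op_rpoly P p \<equiv> op_cpoly P (map_poly complex_of_real p)"

lemma op_cpoly_0 [simp]: "op_cpoly P 0 x = 0"
  by (simp add: op_cpoly_def)

lemma op_cpoly_pCons: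
  assumes "complex_linear P"
  shows "op_cpoly P (pCons a q) x = a *\<^sub>C x + P (op_cpoly P q x)"
  by (cases "a = 0 \<and> q = 0") (auto simp: op_cpoly_def complex_linear_zero[OF assms])

lemma op_cpoly_add:
  assumes "complex_linear P"
  shows "op_cpoly P (p + q) x = op_cpoly P p x + op_cpoly P q x"
proof (induction p q rule: poly_induct2)
  case 0
  then show ?case by simp
next
  case (pCons a p b q)
  then show ?case
    by (simp add: op_cpoly_pCons assms complex_linear_add[OF assms] scaleC_add_left add_ac)
qed

lemma op_cpoly_smult:
  assumes "complex_linear P"
  shows "op_cpoly P (smult c q) x = c *\<^sub>C op_cpoly P q x"
  by (induction q)
    (simp_all add: op_cpoly_pCons assms complex_linear_scaleC[OF assms] scaleC_add_right scaleC_scaleC)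

lemma op_cpoly_diff:
  assumes "complex_linear P"
  shows "op_cpoly P (p - q) x = op_cpoly P p x - op_cpoly P q x"
  using op_cpoly_add[OF assms, of p "smult (-1) q" x] op_cpoly_smult[OF assms, of "-1" q x] by simp

lemma op_cpoly_mult:
  assumes "complex_linear P"
  shows "op_cpoly P (p * q) x = op_cpoly P p (op_cpoly P q x)"
  by (induction p)
    (simp_all add: op_cpoly_pCons op_cpoly_add op_cpoly_smult assms)

lemma op_cpoly_const:
  assumes "complex_linear P"
  shows "op_cpoly P [:c:] x = c *\<^sub>C x"
  by (simp add: op_cpoly_pCons assms complex_linear_zero[OF assms])

lemma op_rpoly_simps:
  assumes "complex_linear P"
  shows "op_rpoly P (p + q) x = op_rpoly P p x + op_rpoly P q x"
    and "op_rpoly P (p - q) x = op_rpoly P p x - op_rpoly P q x"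
    and "op_rpoly P (p * q) x = op_rpoly P p (op_rpoly P q x)"
    and "op_rpoly P (pCons a p) x = complex_of_real a *\<^sub>C x + P (op_rpoly P p x)"
    and "op_rpoly P 0 x = 0"
proof -
  have "map_poly complex_of_real (p + q) = map_poly complex_of_real p + map_poly complex_of_real q"
    by (intro poly_eqI) (simp add: coeff_map_poly)
  then show "op_rpoly P (p + q) x = op_rpoly P p x + op_rpoly P q x"
    by (simp add: op_cpoly_add assms)
  have "map_poly complex_of_real (p - q) = map_poly complex_of_real p - map_poly complex_of_real q"
    by (intro poly_eqI) (simp add: coeff_map_poly)
  then show "op_rpoly P (p - q) x = op_rpoly P p x - op_rpoly P q x"
    by (simp add: op_cpoly_diff assms)
  have "map_poly complex_of_real (p * q) = map_poly complex_of_real p * map_poly complex_of_real q"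
    by (intro poly_eqI) (simp add: coeff_map_poly coeff_mult)
  then show "op_rpoly P (p * q) x = op_rpoly P p (op_rpoly P q x)"
    by (simp add: op_cpoly_mult assms)
  show "op_rpoly P (pCons a p) x = complex_of_real a *\<^sub>C x + P (op_rpoly P p x)"
    by (simp add: map_poly_pCons op_cpoly_pCons assms)
qed simp

lemma poly_map_poly_of_real: "poly (map_poly complex_of_real p) (complex_of_real t) = complex_of_real (poly p t)"
  by (induction p) (simp_all add: map_poly_pCons)

context positive_op
begin

lemma op_cpoly_A_bounded:
  assumes "A_bounded P"
  shows "A_bounded (op_cpoly P q)"
proof (induction q)
  case 0
  then show ?case by (simp add: op_cpoly_def)
next
  case (pCons a q)
  have "A_bounded (\<lambda>x. a *\<^sub>C x + P (op_cpoly P q x))"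
    by (rule A_bounded_add[OF A_bounded_scaleC[OF A_bounded_ident] A_bounded_comp[OF assms pCons.IH]])
  moreover have "op_cpoly P (pCons a q) = (\<lambda>x. a *\<^sub>C x + P (op_cpoly P q x))"
    by (intro ext op_cpoly_pCons A_bounded_linear assms)
  ultimately show ?case by simp
qed

lemma op_rpoly_A_symmetric:
  assumes P: "A_bounded P" and sym: "A_symmetric P"
  shows "A_symmetric (op_rpoly P p)"
proof (induction p)
  case 0
  then show ?case by (simp add: A_symmetric_def)
next
  case (pCons a p)
  note lin = A_bounded_linear[OF P]
  have comm: "op_rpoly P p (P x) = P (op_rpoly P p x)" for x
  proof -
    have "op_rpoly P p (P x) = op_rpoly P (p * [:0, 1:]) x"
      unfolding op_rpoly_simps(3)[OF lin] by (simp add: op_rpoly_simps lin complex_linear_zero)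
    also have "\<dots> = op_rpoly P ([:0, 1:] * p) x" by (simp only: mult.commute)
    also have "\<dots> = P (op_rpoly P p x)"
      unfolding op_rpoly_simps(3)[OF lin] by (simp add: op_rpoly_simps lin complex_linear_zero)
    finally show ?thesis .
  qed
  show ?case unfolding A_symmetric_def
  proof (intro allI)
    fix x y
    have "sip (P (op_rpoly P p x)) y = sip x (op_rpoly P p (P y))"
      using sym pCons by (simp add: A_symmetric_def)
    then show "sip (op_rpoly P (pCons a p) x) y = sip x (op_rpoly P (pCons a p) y)"
      by (simp add: op_rpoly_simps lin sip_add_left sip_add_right sip_scaleC_left sip_scaleC_right comm)
  qed
qed

text \<open>
  Over the complex numbers a polynomial of \<open>P\<close> is a product of factors \<open>P - \<mu>\<close>, and a composition of operators
  that are bounded below is bounded below.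
\<close>

lemma op_cpoly_bounded_below:
  assumes P: "A_bounded P" and "q \<noteq> 0"
    and roots: "\<And>\<mu>. poly q \<mu> = 0 \<Longrightarrow> A_bounded_below (\<lambda>x. P x - \<mu> *\<^sub>C x)"
  shows "A_bounded_below (op_cpoly P q)"
  using assms(2,3)
proof (induction "degree q" arbitrary: q)
  case 0
  then obtain c where c: "q = [:c:]" "c \<noteq> 0"
    by (metis degree_eq_zeroE pCons_0_0)
  then show ?case unfolding A_bounded_below_def
    by (intro exI[of _ "cmod c"]) (simp add: op_cpoly_const A_bounded_linear P nrm_scaleC)
next
  case (Suc n)
  then have "\<not> constant (poly q)" by (simp add: constant_degree)
  then obtain \<mu> where \<mu>: "poly q \<mu> = 0" using fundamental_theorem_of_algebra by blast
  then obtain q' where q': "q = [:- \<mu>, 1:] * q'" by (auto simp: poly_eq_0_iff_dvd elim: dvdE)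
  have q'0: "q' \<noteq> 0" using q' Suc.prems(1) by auto
  have "degree q = degree [:- \<mu>, 1:] + degree q'" unfolding q' by (rule degree_mult_eq) (use q'0 in auto)
  then have "n = degree q'" using Suc.hyps(2) by simp
  moreover have "A_bounded_below (\<lambda>x. P x - \<nu> *\<^sub>C x)" if "poly q' \<nu> = 0" for \<nu>
    by (rule Suc.prems(2)) (simp add: q' that)
  ultimately have "A_bounded_below (op_cpoly P q')" using Suc.hyps(1) q'0 by blast
  then obtain d where d: "d > 0" "\<And>x. d * nrm x \<le> nrm (op_cpoly P q' x)"
    by (auto simp: A_bounded_below_def)
  obtain e where e: "e > 0" "\<And>x. e * nrm x \<le> nrm (P x - \<mu> *\<^sub>C x)"
    using Suc.prems(2)[OF \<mu>] by (auto simp: A_bounded_below_def)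
  have "(e * d) * nrm x \<le> nrm (op_cpoly P q x)" for x
  proof -
    have "(e * d) * nrm x \<le> e * nrm (op_cpoly P q' x)" using d(2)[of x] e(1) by (simp add: mult.assoc)
    also have "\<dots> \<le> nrm (P (op_cpoly P q' x) - \<mu> *\<^sub>C op_cpoly P q' x)" by (rule e(2))
    also have "P (op_cpoly P q' x) - \<mu> *\<^sub>C op_cpoly P q' x = op_cpoly P q x"
      unfolding q' op_cpoly_mult[OF A_bounded_linear[OF P]]
      by (simp add: op_cpoly_pCons A_bounded_linear P complex_linear_zero scaleC_minus_left)
    finally show ?thesis .
  qed
  then show ?case using d(1) e(1) unfolding A_bounded_below_def by (intro exI[of _ "e * d"]) simp
qed

lemma A_bounded_below_nonreal:
  assumes sym: "A_symmetric P" and "Im \<mu> \<noteq> 0"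
  shows "A_bounded_below (\<lambda>x. P x - \<mu> *\<^sub>C x)"
proof -
  have "\<bar>Im \<mu>\<bar> * nrm x \<le> nrm (P x - \<mu> *\<^sub>C x)" for x
  proof (cases "nrm x = 0")
    case False
    then have pos: "nrm x > 0" using nrm_nonneg[of x] by linarith
    have "sip (P x) x = cnj (sip (P x) x)"
      using sym sip_commute[of x "P x"] by (simp add: A_symmetric_def)
    then have "Im (sip (P x) x) = 0" by (simp add: complex_eq_iff)
    then have "Im (sip (P x - \<mu> *\<^sub>C x) x) = - Im \<mu> * (nrm x)\<^sup>2"
      unfolding sip_diff_left sip_scaleC_left sip_self[of x] by simp
    then have "\<bar>Im \<mu>\<bar> * (nrm x)\<^sup>2 = \<bar>Im (sip (P x - \<mu> *\<^sub>C x) x)\<bar>" by (simp add: abs_mult)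
    also have "\<dots> \<le> cmod (sip (P x - \<mu> *\<^sub>C x) x)" by (rule abs_Im_le_cmod)
    also have "\<dots> \<le> nrm (P x - \<mu> *\<^sub>C x) * nrm x" by (rule sip_Cauchy_Schwarz)
    finally show ?thesis using pos by (simp add: power2_eq_square)
  qed simp
  then show ?thesis using assms(2) unfolding A_bounded_below_def by (intro exI[of _ "\<bar>Im \<mu>\<bar>"]) simp
qed

text \<open>
  For a unit vector \<open>x\<close> on which \<open>L\<close> almost attains its norm \<open>b\<close>, the vector \<open>L\<^sup>2 x - b\<^sup>2 x\<close> is small, since its
  squared seminorm is at most \<open>b\<^sup>2 (b\<^sup>2 - nrm (L x)\<^sup>2)\<close>.
\<close>

lemma square_minus_norm_square_not_bounded_below:
  assumes L: "A_bounded L" and sym: "A_symmetric L" and nz: "nrm z \<noteq> 0"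
  shows "\<not> A_bounded_below (\<lambda>x. L (L x) - complex_of_real ((opnorm_A A L)\<^sup>2) *\<^sub>C x)"
proof
  define b where "b = opnorm_A A L"
  assume "A_bounded_below (\<lambda>x. L (L x) - complex_of_real ((opnorm_A A L)\<^sup>2) *\<^sub>C x)"
  then obtain d where d: "d > 0" "\<And>x. d * nrm x \<le> nrm (L (L x) - complex_of_real (b\<^sup>2) *\<^sub>C x)"
    by (auto simp: A_bounded_below_def b_def)
  have b0: "b \<ge> 0" unfolding b_def by (rule opnorm_A_nonneg) fact
  have key: "d\<^sup>2 \<le> b\<^sup>2 * (b\<^sup>2 - (nrm (L x))\<^sup>2)" if x: "nrm x = 1" for x
  proof -
    have "sip (L (L x)) x = sip (L x) (L x)" "sip x (L (L x)) = sip (L x) (L x)"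
      using sym by (simp_all add: A_symmetric_def)
    then have "(nrm (L (L x) - complex_of_real (b\<^sup>2) *\<^sub>C x))\<^sup>2
        = (nrm (L (L x)))\<^sup>2 - 2 * b\<^sup>2 * (nrm (L x))\<^sup>2 + b\<^sup>2 * b\<^sup>2 * (nrm x)\<^sup>2"
      unfolding nrm_square sip_diff_left sip_diff_right sip_scaleC_left sip_scaleC_right
      by (simp add: algebra_simps flip: of_real_power)
    moreover have "(nrm (L (L x)))\<^sup>2 \<le> b\<^sup>2 * (nrm (L x))\<^sup>2"
      using power_mono[OF opnorm_A_bound[OF L, of "L x"], of 2] by (simp add: power_mult_distrib b_def)
    moreover have "d\<^sup>2 \<le> (nrm (L (L x) - complex_of_real (b\<^sup>2) *\<^sub>C x))\<^sup>2"
      using power_mono[OF d(2)[of x], of 2] d(1) x by simp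
    ultimately show ?thesis using x by (simp add: algebra_simps)
  qed
  have "nrm (complex_of_real (1 / nrm z) *\<^sub>C z) = 1" by (rule nrm_normalize) fact
  from key[OF this] have "b \<noteq> 0" using d(1) by auto
  then have bpos: "b > 0" using b0 by simp
  define c where "c = sqrt (max 0 (b\<^sup>2 - d\<^sup>2 / b\<^sup>2))"
  have "nrm (L x) \<le> c" if x: "nrm x = 1" for x
  proof -
    have "d\<^sup>2 / b\<^sup>2 \<le> b\<^sup>2 - (nrm (L x))\<^sup>2" using key[OF x] bpos by (simp add: field_simps)
    then have "(nrm (L x))\<^sup>2 \<le> b\<^sup>2 - d\<^sup>2 / b\<^sup>2" by linarith
    then show ?thesis unfolding c_def by (intro real_le_rsqrt) linarith
  qed
  then have "b \<le> c" unfolding b_def by (intro opnorm_A_le) (simp add: c_def)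
  then have "b\<^sup>2 \<le> c\<^sup>2" using bpos by (intro power_mono) auto
  also have "c\<^sup>2 < b\<^sup>2" using bpos d(1) by (simp add: c_def)
  finally show False by simp
qed

text \<open>
  This is the spectral mapping theorem combined with the equality of norm and spectral radius, for the real
  part of the approximate point spectrum: \<open>p(P)\<^sup>2 - b\<^sup>2\<close> with \<open>b = \<parallel>p(P)\<parallel>\<close> is not bounded below, so one of the linear
  factors of the polynomial \<open>p\<^sup>2 - b\<^sup>2\<close> yields a point of the spectrum.
\<close>

lemma approximate_spectrum_attains_norm:
  assumes P: "A_bounded P" and sym: "A_symmetric P" and nz: "nrm z \<noteq> 0"
  shows "\<exists>t. \<not> A_bounded_below (\<lambda>x. P x - complex_of_real t *\<^sub>C x) \<and> \<bar>poly p t\<bar> = opnorm_A A (op_rpoly P p)"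
proof -
  note lin = A_bounded_linear[OF P]
  have main: "\<exists>t. \<not> A_bounded_below (\<lambda>x. P x - complex_of_real t *\<^sub>C x) \<and> \<bar>poly p t\<bar> = opnorm_A A (op_rpoly P p)"
    if ne: "p * p - [:(opnorm_A A (op_rpoly P p))\<^sup>2:] \<noteq> 0" for p
  proof -
    define b where "b = opnorm_A A (op_rpoly P p)"
    define q where "q = p * p - [:b\<^sup>2:]"
    have B: "A_bounded (op_rpoly P p)" by (rule op_cpoly_A_bounded) fact
    have b0: "b \<ge> 0" unfolding b_def by (rule opnorm_A_nonneg) fact
    have "op_rpoly P q = (\<lambda>x. op_rpoly P p (op_rpoly P p x) - complex_of_real (b\<^sup>2) *\<^sub>C x)"
      unfolding q_def by (rule ext) (simp add: op_rpoly_simps lin complex_linear_zero)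
    then have "\<not> A_bounded_below (op_rpoly P q)"
      using square_minus_norm_square_not_bounded_below[OF B op_rpoly_A_symmetric[OF P sym] nz]
      by (simp add: b_def)
    moreover have "map_poly complex_of_real q \<noteq> 0"
      using ne by (simp add: q_def b_def map_poly_eq_0_iff)
    ultimately obtain \<mu> where \<mu>: "poly (map_poly complex_of_real q) \<mu> = 0"
        "\<not> A_bounded_below (\<lambda>x. P x - \<mu> *\<^sub>C x)"
      using op_cpoly_bounded_below[OF P] by blast
    then have "Im \<mu> = 0" using A_bounded_below_nonreal[OF sym] by blast
    then have \<mu>_eq: "\<mu> = complex_of_real (Re \<mu>)" by (simp add: complex_eq_iff)
    have "complex_of_real (poly q (Re \<mu>)) = 0"
      using \<mu>(1) poly_map_poly_of_real[of q "Re \<mu>"] \<mu>_eq by simp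
    then have "poly q (Re \<mu>) = 0" by (simp only: of_real_eq_0_iff)
    then have "(poly p (Re \<mu>))\<^sup>2 = b\<^sup>2" by (simp add: q_def power2_eq_square)
    then have "\<bar>poly p (Re \<mu>)\<bar> = b" using b0 by (metis abs_of_nonneg power2_eq_iff abs_minus_cancel)
    then show ?thesis using \<mu>(2) \<mu>_eq by (intro exI[of _ "Re \<mu>"]) (simp add: b_def)
  qed
  show ?thesis
  proof (cases "p * p - [:(opnorm_A A (op_rpoly P p))\<^sup>2:] = 0")
    case False
    then show ?thesis by (rule main)
  next
    case True
    \<comment> \<open>Now \<open>\<bar>p\<bar>\<close> is constant, and any point of the spectrum will do; the polynomial \<open>X\<close> provides one.\<close>
    have "[:0, 1:] * [:0, 1:] - [:(opnorm_A A (op_rpoly P [:0, 1:]))\<^sup>2:] \<noteq> 0" by simp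
    then obtain t where t: "\<not> A_bounded_below (\<lambda>x. P x - complex_of_real t *\<^sub>C x)"
      using main by blast
    have "poly (p * p - [:(opnorm_A A (op_rpoly P p))\<^sup>2:]) t = 0" using True by simp
    then have "(poly p t)\<^sup>2 = (opnorm_A A (op_rpoly P p))\<^sup>2" by (simp add: power2_eq_square)
    moreover have "opnorm_A A (op_rpoly P p) \<ge> 0" by (intro opnorm_A_nonneg op_cpoly_A_bounded P)
    ultimately have "\<bar>poly p t\<bar> = opnorm_A A (op_rpoly P p)"
      by (metis abs_of_nonneg power2_eq_iff abs_minus_cancel)
    then show ?thesis using t by blast
  qed
qed

lemma nrm_op_rpoly_le:
  assumes P: "A_bounded P" and sym: "A_symmetric P"
    and m: "\<And>t. \<not> A_bounded_below (\<lambda>x. P x - complex_of_real t *\<^sub>C x) \<Longrightarrow> \<bar>poly p t\<bar> \<le> m"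
  shows "nrm (op_rpoly P p x) \<le> m * nrm x"
proof (cases "nrm x = 0")
  case True
  then show ?thesis using A_bounded_null[OF op_cpoly_A_bounded[OF P]] by simp
next
  case False
  obtain t where "\<not> A_bounded_below (\<lambda>x. P x - complex_of_real t *\<^sub>C x)"
      "\<bar>poly p t\<bar> = opnorm_A A (op_rpoly P p)"
    using approximate_spectrum_attains_norm[OF P sym False] by blast
  then have "opnorm_A A (op_rpoly P p) \<le> m" using m by metis
  then have "opnorm_A A (op_rpoly P p) * nrm x \<le> m * nrm x" by (rule mult_right_mono) simp
  then show ?thesis using opnorm_A_bound[OF op_cpoly_A_bounded[OF P]] by (meson order_trans)
qed

end


section \<open>A-positive operators\<close>

text \<open>
  The general tangent inequality covers interior points of the domain of convexity only, that is \<open>y > 0\<close>; at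
  \<open>y = 0\<close> the left-hand side is \<open>(1 - k) * a powr k\<close>.
\<close>

lemma powr_above_tangent:
  fixes a y k :: real
  assumes "a > 0" "y \<ge> 0" "k \<ge> 1"
  shows "a powr k + k * a powr (k - 1) * (y - a) \<le> y powr k"
proof (cases "y = 0")
  case True
  have "a powr (k - 1) * a = a powr k" using assms(1) by (simp add: powr_diff)
  then have "a powr k + k * a powr (k - 1) * (0 - a) = (1 - k) * a powr k" by (simp add: algebra_simps)
  also have "\<dots> \<le> 0" using assms(3) by (simp add: mult_nonpos_nonneg)
  finally show ?thesis using True by simp
next
  case False
  have "(k * a powr (k - 1)) * (y - a) \<le> y powr k - a powr k"
  proof (rule convex_on_imp_above_tangent[OF powr_convex[OF assms(3)]])
    show "a \<in> interior {0<..}" using assms(1) by (simp add: interior_open)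
    show "((\<lambda>x. x powr k) has_field_derivative k * a powr (k - 1)) (at a within {0<..})"
      using assms(1) by (auto intro!: derivative_eq_intros)
  qed (use assms False in auto)
  then show ?thesis by simp
qed

locale A_positive_op = positive_op +
  fixes P :: "'a::chilbert_space \<Rightarrow> 'a"
  assumes bounded_clinear_P: "bounded_clinear P"
    and symmetric_P: "A_symmetric P"
    and nonneg_P: "0 \<le> Re (sip (P x) x)"
begin

abbreviation N :: real where "N \<equiv> opnorm_A A P"

lemma A_bounded_P: "A_bounded P"
  using bounded_clinear_P symmetric_P by (rule A_symmetric_imp_A_bounded)

lemma linear_P: "complex_linear P"
  by (rule A_bounded_linear) (rule A_bounded_P)

lemma approximate_spectrum_range:
  assumes "\<not> A_bounded_below (\<lambda>x. P x - complex_of_real t *\<^sub>C x)"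
  shows "t \<in> {0..N}"
proof (rule ccontr)
  assume "t \<notin> {0..N}"
  then consider "t < 0" | "t > N" by fastforce
  then have "A_bounded_below (\<lambda>x. P x - complex_of_real t *\<^sub>C x)"
  proof cases
    case 1
    have "- t * nrm x \<le> nrm (P x - complex_of_real t *\<^sub>C x)" for x
    proof (cases "nrm x = 0")
      case False
      then have pos: "nrm x > 0" using nrm_nonneg[of x] by linarith
      have "- t * (nrm x)\<^sup>2 \<le> Re (sip (P x) x) - t * (nrm x)\<^sup>2" using nonneg_P[of x] by simp
      also have "\<dots> = Re (sip (P x - complex_of_real t *\<^sub>C x) x)"
        unfolding sip_diff_left sip_scaleC_left sip_self[of x] by simp
      also have "\<dots> \<le> nrm (P x - complex_of_real t *\<^sub>C x) * nrm x"
        by (rule order_trans[OF complex_Re_le_cmod sip_Cauchy_Schwarz])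
      finally have "(- t * nrm x) * nrm x \<le> nrm (P x - complex_of_real t *\<^sub>C x) * nrm x"
        by (simp add: power2_eq_square mult.assoc)
      then show ?thesis using pos by (rule mult_right_le_imp_le)
    qed simp
    then show ?thesis using 1 unfolding A_bounded_below_def by (intro exI[of _ "- t"]) simp
  next
    case 2
    have "(t - N) * nrm x \<le> nrm (P x - complex_of_real t *\<^sub>C x)" for x
    proof -
      have "t > 0" using 2 opnorm_A_nonneg[OF A_bounded_P] by linarith
      then have "t * nrm x = nrm (complex_of_real t *\<^sub>C x)" by (simp add: nrm_scaleC)
      also have "\<dots> \<le> nrm (P x - complex_of_real t *\<^sub>C x) + nrm (P x)"
        using nrm_reverse_triangle[of "complex_of_real t *\<^sub>C x" "P x"]
        by (simp add: nrm_diff_commute)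
      also have "nrm (P x) \<le> N * nrm x" by (rule opnorm_A_bound) (rule A_bounded_P)
      finally show ?thesis by (simp add: algebra_simps)
    qed
    then show ?thesis using 2 unfolding A_bounded_below_def by (intro exI[of _ "t - N"]) simp
  qed
  then show False using assms by blast
qed

lemma op_rpoly_nonneg:
  assumes h: "\<And>t. t \<in> {0..N} \<Longrightarrow> 0 \<le> poly h t"
  shows "0 \<le> Re (sip (op_rpoly P h x) x)"
proof -
  obtain c where c: "\<And>t. t \<in> {0..N} \<Longrightarrow> \<bar>poly h t\<bar> \<le> c"
  proof -
    have "bounded (poly h ` {0..N})"
      by (intro compact_imp_bounded compact_continuous_image continuous_intros) auto
    then show ?thesis using that by (force simp: bounded_iff)
  qed
  have "nrm (op_rpoly P (h - [:c / 2:]) x) \<le> c / 2 * nrm x"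
  proof (rule nrm_op_rpoly_le[OF A_bounded_P symmetric_P])
    fix t assume "\<not> A_bounded_below (\<lambda>x. P x - complex_of_real t *\<^sub>C x)"
    then have "t \<in> {0..N}" by (rule approximate_spectrum_range)
    then have "0 \<le> poly h t" "\<bar>poly h t\<bar> \<le> c" by (rule h, rule c)
    moreover have "poly (h - [:c / 2:]) t = poly h t - c / 2" by simp
    ultimately show "\<bar>poly (h - [:c / 2:]) t\<bar> \<le> c / 2" by linarith
  qed
  moreover have "op_rpoly P (h - [:c / 2:]) x = op_rpoly P h x - complex_of_real (c / 2) *\<^sub>C x"
    by (simp add: op_rpoly_simps linear_P complex_linear_zero)
  ultimately have le: "nrm (op_rpoly P h x - complex_of_real (c / 2) *\<^sub>C x) \<le> c / 2 * nrm x" by simp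
  have "- Re (sip (op_rpoly P h x - complex_of_real (c / 2) *\<^sub>C x) x)
      \<le> nrm (op_rpoly P h x - complex_of_real (c / 2) *\<^sub>C x) * nrm x"
    using abs_Re_le_cmod[of "sip (op_rpoly P h x - complex_of_real (c / 2) *\<^sub>C x) x"]
      sip_Cauchy_Schwarz[of "op_rpoly P h x - complex_of_real (c / 2) *\<^sub>C x" x] by linarith
  also have "\<dots> \<le> c / 2 * nrm x * nrm x" by (intro mult_right_mono le) simp
  finally have "- Re (sip (op_rpoly P h x - complex_of_real (c / 2) *\<^sub>C x) x) \<le> c / 2 * (nrm x)\<^sup>2"
    by (simp add: power2_eq_square)
  then show ?thesis unfolding sip_diff_left sip_scaleC_left sip_self[of x] by simp
qed

text \<open>
  The McCarthy inequality \<open>\<langle>P\<^sup>2x,x\<rangle> powr (s/2) \<le> \<langle>P\<^sup>s x,x\<rangle>\<close> for a unit vector, with the power replaced by any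
  polynomial that dominates it up to \<open>e\<close>: by convexity \<open>(t\<^sup>2) powr (s/2)\<close> lies above its tangent line at
  \<open>t\<^sup>2 = nrm (P x)\<^sup>2\<close>, an inequality between polynomials in \<open>t\<close>.
\<close>

lemma McCarthy_inequality:
  assumes s: "s \<ge> 2" and x: "nrm x = 1"
    and p: "\<And>t. t \<in> {0..N} \<Longrightarrow> t powr s - e \<le> poly p t"
  shows "nrm (P x) powr s - e \<le> Re (sip (op_rpoly P p x) x)"
proof -
  define a where "a = (nrm (P x))\<^sup>2"
  \<comment> \<open>The slope of the tangent line; for \<open>a = 0\<close> the horizontal line through the origin serves for every \<open>s\<close>.\<close>
  define u where "u = (if a = 0 then 0 else s / 2 * a powr (s / 2 - 1))"
  define h where "h = p - [:a powr (s / 2) - u * a - e, 0, u:]"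
  have "0 \<le> poly h t" if t: "t \<in> {0..N}" for t
  proof -
    have "a powr (s / 2) + u * (t\<^sup>2 - a) \<le> t powr s"
    proof (cases "a = 0")
      case False
      then have "a > 0" by (simp add: a_def)
      moreover have "(t\<^sup>2) powr (s / 2) = t powr s"
        using t by (simp add: powr_powr flip: powr_numeral)
      ultimately show ?thesis using powr_above_tangent[of a "t\<^sup>2" "s / 2"] s by (simp add: u_def)
    qed (simp add: u_def)
    then show ?thesis using p[OF t] by (simp add: h_def algebra_simps power2_eq_square)
  qed
  then have "0 \<le> Re (sip (op_rpoly P h x) x)" by (rule op_rpoly_nonneg)
  moreover have "op_rpoly P h x = op_rpoly P p x
      - (complex_of_real (a powr (s / 2) - u * a - e) *\<^sub>C x + complex_of_real u *\<^sub>C P (P x))"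
    unfolding h_def
    by (simp add: op_rpoly_simps linear_P complex_linear_zero complex_linear_scaleC)
  moreover have "sip (P (P x)) x = complex_of_real a"
    using symmetric_P by (simp only: A_symmetric_def sip_self a_def)
  moreover have "sip x x = 1" using x by (simp add: sip_self)
  ultimately have "0 \<le> Re (sip (op_rpoly P p x) x) - (a powr (s / 2) - u * a - e + u * a)"
    by (simp add: sip_diff_left sip_add_left sip_scaleC_left)
  moreover have "a powr (s / 2) = nrm (P x) powr s"
    by (simp add: a_def powr_powr flip: powr_numeral)
  ultimately show ?thesis by simp
qed

end

section \<open>The completion\<close>

lemma tendsto_null_squeeze:
  fixes f g :: "nat \<Rightarrow> real"
  assumes "g \<longlonglongrightarrow> 0 + 0" "\<And>n. 0 \<le> f n" "\<And>n. f n \<le> g n"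
  shows "f \<longlonglongrightarrow> 0"
  using tendsto_sandwich[of "\<lambda>_. 0" f sequentially g 0] assms by simp

context positive_op
begin

abbreviation K :: "(nat \<Rightarrow> 'a) set hspace" where "K \<equiv> H_A A"

abbreviation cls :: "(nat \<Rightarrow> 'a) \<Rightarrow> (nat \<Rightarrow> 'a) set" where "cls X \<equiv> null_rel_A A `` {X}"

abbreviation Cau :: "(nat \<Rightarrow> 'a) set" where "Cau \<equiv> Cauchy_A A"

lemma Cauchy_AD: "X \<in> Cau \<Longrightarrow> e > 0 \<Longrightarrow> \<exists>N. \<forall>m\<ge>N. \<forall>n\<ge>N. nrm (X m - X n) < e"
  by (simp add: Cauchy_A_def)

lemma Cauchy_A_const: "(\<lambda>_. x) \<in> Cau"
  by (simp add: Cauchy_A_def)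

lemma Cauchy_A_add:
  assumes "X \<in> Cau" "Y \<in> Cau"
  shows "(\<lambda>n. X n + Y n) \<in> Cau"
  unfolding Cauchy_A_def mem_Collect_eq
proof (intro allI impI)
  fix e :: real assume "e > 0"
  then have "e / 2 > 0" by simp
  obtain M where M: "\<forall>m\<ge>M. \<forall>n\<ge>M. nrm (X m - X n) < e / 2" using Cauchy_AD[OF assms(1) \<open>e / 2 > 0\<close>] by blast
  obtain N where N: "\<forall>m\<ge>N. \<forall>n\<ge>N. nrm (Y m - Y n) < e / 2" using Cauchy_AD[OF assms(2) \<open>e / 2 > 0\<close>] by blast
  have "nrm (X m + Y m - (X n + Y n)) < e" if "m \<ge> max M N" "n \<ge> max M N" for m n
  proof -
    have "nrm (X m + Y m - (X n + Y n)) \<le> nrm (X m - X n) + nrm (Y m - Y n)"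
      using nrm_triangle[of "X m - X n" "Y m - Y n"] by (simp add: algebra_simps)
    moreover have "nrm (X m - X n) < e / 2" "nrm (Y m - Y n) < e / 2" using M N that by auto
    ultimately show ?thesis by linarith
  qed
  then show "\<exists>N. \<forall>m\<ge>N. \<forall>n\<ge>N. nrm (X m + Y m - (X n + Y n)) < e" by blast
qed

lemma Cauchy_A_bounded:
  assumes "X \<in> Cau"
  shows "\<exists>B>0. \<exists>N. \<forall>n\<ge>N. nrm (X n) \<le> B"
proof -
  obtain N where N: "\<forall>m\<ge>N. \<forall>n\<ge>N. nrm (X m - X n) < 1" using Cauchy_AD[OF assms, of 1] by auto
  have "nrm (X n) \<le> 1 + nrm (X N)" if "n \<ge> N" for n
  proof -
    have "nrm (X n) \<le> nrm (X n - X N) + nrm (X N)" using nrm_triangle[of "X n - X N" "X N"] by simp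
    moreover have "nrm (X n - X N) < 1" using N that by simp
    ultimately show ?thesis by linarith
  qed
  moreover have "1 + nrm (X N) > 0" using nrm_nonneg[of "X N"] by linarith
  ultimately show ?thesis by blast
qed

lemma equiv_null_rel_A: "equiv Cau (null_rel_A A)"
proof (rule equivI)
  show "null_rel_A A \<subseteq> Cau \<times> Cau" by (auto simp: null_rel_A_def)
  show "refl_on Cau (null_rel_A A)" by (auto simp: refl_on_def null_rel_A_def)
  show "sym (null_rel_A A)" by (auto simp: sym_def null_rel_A_def nrm_diff_commute)
  show "trans (null_rel_A A)"
  proof (rule transI)
    fix X Y Z assume XY: "(X, Y) \<in> null_rel_A A" and YZ: "(Y, Z) \<in> null_rel_A A"
    have "(\<lambda>n. nrm (X n - Y n) + nrm (Y n - Z n)) \<longlonglongrightarrow> 0 + 0"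
      using XY YZ by (intro tendsto_add) (auto simp: null_rel_A_def)
    then have "(\<lambda>n. nrm (X n - Z n)) \<longlonglongrightarrow> 0"
      by (rule tendsto_null_squeeze) (simp_all add: nrm_triangle_diff)
    then show "(X, Z) \<in> null_rel_A A" using XY YZ by (auto simp: null_rel_A_def)
  qed
qed

lemma cls_eq_iff:
  assumes "X \<in> Cau" "Y \<in> Cau"
  shows "cls X = cls Y \<longleftrightarrow> (\<lambda>n. nrm (X n - Y n)) \<longlonglongrightarrow> 0"
  using eq_equiv_class_iff[OF equiv_null_rel_A assms] assms by (simp add: null_rel_A_def)

lemma mem_clsD: "Y \<in> cls X \<Longrightarrow> Y \<in> Cau \<and> (\<lambda>n. nrm (X n - Y n)) \<longlonglongrightarrow> 0"
  by (simp add: null_rel_A_def)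

lemma cls_self: "X \<in> Cau \<Longrightarrow> X \<in> cls X"
  by (rule equiv_class_self[OF equiv_null_rel_A])

lemma vecs_K: "vecs K = Cau // null_rel_A A"
  by (simp add: H_A_def)

lemma cls_in_vecs: "X \<in> Cau \<Longrightarrow> cls X \<in> vecs K"
  by (simp add: vecs_K quotientI)

lemma vecsE:
  assumes "u \<in> vecs K"
  obtains X where "X \<in> Cau" "u = cls X"
  using assms by (auto simp: vecs_K quotient_def)

text \<open>
  A sequence of operators, uniformly Cauchy on the unit ball of the seminorm, acts on the completion by
  mapping the class of \<open>X\<close> to the class of the diagonal sequence \<open>L n (X n)\<close>.  Polynomials,
  resolvents and continuous functions of an induced operator all have this form, and their sums, products and norms are computed on the original space.
\<close>

definition op_Cauchy :: "(nat \<Rightarrow> 'a \<Rightarrow> 'a) \<Rightarrow> bool" where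
  "op_Cauchy L \<longleftrightarrow> (\<forall>n. A_bounded (L n)) \<and>
     (\<forall>e>0. \<exists>N. \<forall>m\<ge>N. \<forall>n\<ge>N. \<forall>x. nrm (L m x - L n x) \<le> e * nrm x)"

definition lift :: "(nat \<Rightarrow> 'a \<Rightarrow> 'a) \<Rightarrow> (nat \<Rightarrow> 'a) set \<Rightarrow> (nat \<Rightarrow> 'a) set" where
  "lift L = (\<lambda>u\<in>vecs K. \<Union>X\<in>u. cls (\<lambda>n. L n (X n)))"

lemma op_Cauchy_A_bounded: "op_Cauchy L \<Longrightarrow> A_bounded (L n)"
  by (simp add: op_Cauchy_def)

lemma op_Cauchy_linear: "op_Cauchy L \<Longrightarrow> complex_linear (L n)"
  by (simp add: op_Cauchy_def A_bounded_def)

lemma op_CauchyD: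
  "op_Cauchy L \<Longrightarrow> e > 0 \<Longrightarrow> \<exists>N. \<forall>m\<ge>N. \<forall>n\<ge>N. \<forall>x. nrm (L m x - L n x) \<le> e * nrm x"
  by (simp add: op_Cauchy_def)

lemma op_Cauchy_const: "A_bounded P \<Longrightarrow> op_Cauchy (\<lambda>_. P)"
  by (simp add: op_Cauchy_def)

lemma op_Cauchy_bounded:
  assumes "op_Cauchy L"
  shows "\<exists>C>0. \<exists>N. \<forall>n\<ge>N. \<forall>x. nrm (L n x) \<le> C * nrm x"
proof -
  obtain N where N: "\<forall>m\<ge>N. \<forall>n\<ge>N. \<forall>x. nrm (L m x - L n x) \<le> 1 * nrm x"
    using op_CauchyD[OF assms zero_less_one] by blast
  obtain C where C: "C \<ge> 0" "\<And>x. nrm (L N x) \<le> C * nrm x"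
    using A_boundedE[OF op_Cauchy_A_bounded[OF assms]] by blast
  have "nrm (L n x) \<le> (1 + C) * nrm x" if "n \<ge> N" for n x
  proof -
    have "nrm (L n x) \<le> nrm (L n x - L N x) + nrm (L N x)"
      using nrm_triangle[of "L n x - L N x" "L N x"] by simp
    also have "\<dots> \<le> 1 * nrm x + C * nrm x" by (intro add_mono C(2)) (use N that in auto)
    finally show ?thesis by (simp add: distrib_right)
  qed
  then show ?thesis using C(1) by (intro exI[of _ "1 + C"] conjI exI[of _ N]) auto
qed

lemma op_Cauchy_diagonal:
  assumes L: "op_Cauchy L" and X: "X \<in> Cau"
  shows "(\<lambda>n. L n (X n)) \<in> Cau"
  unfolding Cauchy_A_def mem_Collect_eq
proof (intro allI impI)
  fix e :: real assume e: "e > 0"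
  obtain C N1 where C: "C > 0" "\<forall>n\<ge>N1. \<forall>x. nrm (L n x) \<le> C * nrm x" using op_Cauchy_bounded[OF L] by blast
  obtain B N2 where B: "B > 0" "\<forall>n\<ge>N2. nrm (X n) \<le> B" using Cauchy_A_bounded[OF X] by blast
  have "e / (2 * B) > 0" using e B by simp
  from op_CauchyD[OF L this] obtain N3
    where N3: "\<forall>m\<ge>N3. \<forall>n\<ge>N3. \<forall>x. nrm (L m x - L n x) \<le> e / (2 * B) * nrm x" by blast
  have "e / (2 * C) > 0" using e C by simp
  from Cauchy_AD[OF X this] obtain N4 where N4: "\<forall>m\<ge>N4. \<forall>n\<ge>N4. nrm (X m - X n) < e / (2 * C)" by blast
  define N where "N = max (max N1 N2) (max N3 N4)"
  have "nrm (L m (X m) - L n (X n)) < e" if mn: "m \<ge> N" "n \<ge> N" for m n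
  proof -
    have "nrm (L m (X m) - L n (X n)) \<le> nrm (L m (X m) - L n (X m)) + nrm (L n (X m) - L n (X n))"
      by (rule nrm_triangle_diff)
    moreover have "nrm (L m (X m) - L n (X m)) \<le> e / 2"
    proof -
      have "nrm (L m (X m) - L n (X m)) \<le> e / (2 * B) * nrm (X m)" using N3 mn by (simp add: N_def)
      also have "\<dots> \<le> e / (2 * B) * B" using B mn e by (intro mult_left_mono) (auto simp: N_def)
      finally show ?thesis using B(1) by simp
    qed
    moreover have "nrm (L n (X m) - L n (X n)) < e / 2"
    proof -
      have "nrm (L n (X m) - L n (X n)) = nrm (L n (X m - X n))"
        by (simp add: complex_linear_diff[OF op_Cauchy_linear[OF L]])
      also have "\<dots> \<le> C * nrm (X m - X n)" using C mn by (simp add: N_def)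
      also have "\<dots> < C * (e / (2 * C))" using N4 mn C(1) by (intro mult_strict_left_mono) (auto simp: N_def)
      finally show ?thesis using C(1) by simp
    qed
    ultimately show ?thesis by linarith
  qed
  then show "\<exists>N. \<forall>m\<ge>N. \<forall>n\<ge>N. nrm (L m (X m) - L n (X n)) < e" by blast
qed

lemma cls_diagonal_cong:
  assumes L: "op_Cauchy L" and M: "op_Cauchy M" and X: "X \<in> Cau" and Y: "Y \<in> Cau"
    and LM: "\<And>e. e > 0 \<Longrightarrow> \<exists>N. \<forall>n\<ge>N. \<forall>x. nrm (L n x - M n x) \<le> e * nrm x"
    and XY: "(\<lambda>n. nrm (X n - Y n)) \<longlonglongrightarrow> 0"
  shows "cls (\<lambda>n. L n (X n)) = cls (\<lambda>n. M n (Y n))"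
proof (subst cls_eq_iff[OF op_Cauchy_diagonal[OF L X] op_Cauchy_diagonal[OF M Y]], rule LIMSEQ_I)
  fix e :: real assume e: "e > 0"
  obtain C N1 where C: "C > 0" "\<forall>n\<ge>N1. \<forall>x. nrm (M n x) \<le> C * nrm x" using op_Cauchy_bounded[OF M] by blast
  obtain B N2 where B: "B > 0" "\<forall>n\<ge>N2. nrm (X n) \<le> B" using Cauchy_A_bounded[OF X] by blast
  have "e / (2 * B) > 0" using e B by simp
  from LM[OF this] obtain N3 where N3: "\<forall>n\<ge>N3. \<forall>x. nrm (L n x - M n x) \<le> e / (2 * B) * nrm x" by blast
  have "e / (2 * C) > 0" using e C by simp
  from LIMSEQ_D[OF XY this] obtain N4 where N4: "\<forall>n\<ge>N4. nrm (X n - Y n) < e / (2 * C)" by auto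
  define N where "N = max (max N1 N2) (max N3 N4)"
  have "nrm (L n (X n) - M n (Y n)) < e" if n: "n \<ge> N" for n
  proof -
    have "nrm (L n (X n) - M n (Y n)) \<le> nrm (L n (X n) - M n (X n)) + nrm (M n (X n) - M n (Y n))"
      by (rule nrm_triangle_diff)
    moreover have "nrm (L n (X n) - M n (X n)) \<le> e / 2"
    proof -
      have "nrm (L n (X n) - M n (X n)) \<le> e / (2 * B) * nrm (X n)" using N3 n by (simp add: N_def)
      also have "\<dots> \<le> e / (2 * B) * B" using B n e by (intro mult_left_mono) (auto simp: N_def)
      finally show ?thesis using B(1) by simp
    qed
    moreover have "nrm (M n (X n) - M n (Y n)) < e / 2"
    proof -
      have "nrm (M n (X n) - M n (Y n)) = nrm (M n (X n - Y n))"
        by (simp add: complex_linear_diff[OF op_Cauchy_linear[OF M]])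
      also have "\<dots> \<le> C * nrm (X n - Y n)" using C n by (simp add: N_def)
      also have "\<dots> < C * (e / (2 * C))" using N4 n C(1) by (intro mult_strict_left_mono) (auto simp: N_def)
      finally show ?thesis using C(1) by simp
    qed
    ultimately show ?thesis by linarith
  qed
  then show "\<exists>N. \<forall>n\<ge>N. norm (nrm (L n (X n) - M n (Y n)) - 0) < e" by auto
qed

lemma lift_cls:
  assumes L: "op_Cauchy L" and X: "X \<in> Cau"
  shows "lift L (cls X) = cls (\<lambda>n. L n (X n))"
proof -
  have "(\<lambda>Z. cls (\<lambda>n. L n (Z n))) respects null_rel_A A"
  proof (rule congruentI)
    fix Y Z assume YZ: "(Y, Z) \<in> null_rel_A A"
    show "cls (\<lambda>n. L n (Y n)) = cls (\<lambda>n. L n (Z n))"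
      by (rule cls_diagonal_cong[OF L L]) (use YZ in \<open>auto simp: null_rel_A_def\<close>)
  qed
  from UN_equiv_class[OF equiv_null_rel_A this X] show ?thesis
    using X by (simp add: lift_def cls_in_vecs)
qed

lemma lift_eqI:
  assumes "op_Cauchy L" "op_Cauchy M"
    and "\<And>e. e > 0 \<Longrightarrow> \<exists>N. \<forall>n\<ge>N. \<forall>x. nrm (L n x - M n x) \<le> e * nrm x"
  shows "lift L = lift M"
proof
  fix u
  show "lift L u = lift M u"
  proof (cases "u \<in> vecs K")
    case True
    then obtain X where X: "X \<in> Cau" "u = cls X" by (rule vecsE)
    show ?thesis unfolding X(2) lift_cls[OF assms(1) X(1)] lift_cls[OF assms(2) X(1)]
      by (rule cls_diagonal_cong) (use assms X in auto)
  qed (simp add: lift_def)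
qed

lemma Cauchy_A_scaleC:
  assumes "X \<in> Cau"
  shows "(\<lambda>n. c *\<^sub>C X n) \<in> Cau"
  using op_Cauchy_diagonal[OF op_Cauchy_const[OF A_bounded_scaleC[OF A_bounded_ident]] assms] .

lemma Cauchy_A_diff:
  assumes "X \<in> Cau" "Y \<in> Cau"
  shows "(\<lambda>n. X n - Y n) \<in> Cau"
  using Cauchy_A_add[OF assms(1) Cauchy_A_scaleC[OF assms(2), of "-1"]] by simp

lemma vscale_cls:
  assumes "X \<in> Cau"
  shows "vscale K c (cls X) = cls (\<lambda>n. c *\<^sub>C X n)"
  using lift_cls[OF op_Cauchy_const[OF A_bounded_scaleC[OF A_bounded_ident]] assms]
  by (simp add: lift_def H_A_def cls_in_vecs[OF assms, unfolded vecs_K])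

lemma vadd_cls:
  assumes X: "X \<in> Cau" and Y: "Y \<in> Cau"
  shows "vadd K (cls X) (cls Y) = cls (\<lambda>n. X n + Y n)"
proof -
  have "congruent2 (null_rel_A A) (null_rel_A A) (\<lambda>X Y. cls (\<lambda>n. X n + Y n))"
  proof (rule congruent2I'[OF ])
    fix X X' Y Y' assume XX: "(X, X') \<in> null_rel_A A" and YY: "(Y, Y') \<in> null_rel_A A"
    have "(\<lambda>n. nrm (X n - X' n) + nrm (Y n - Y' n)) \<longlonglongrightarrow> 0 + 0"
      using XX YY by (intro tendsto_add) (auto simp: null_rel_A_def)
    moreover have "nrm (X n + Y n - (X' n + Y' n)) \<le> nrm (X n - X' n) + nrm (Y n - Y' n)" for n
      using nrm_triangle[of "X n - X' n" "Y n - Y' n"] by (simp add: algebra_simps)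
    ultimately have "(\<lambda>n. nrm (X n + Y n - (X' n + Y' n))) \<longlonglongrightarrow> 0"
      by (intro tendsto_null_squeeze[where g = "\<lambda>n. nrm (X n - X' n) + nrm (Y n - Y' n)"]) simp_all
    then show "cls (\<lambda>n. X n + Y n) = cls (\<lambda>n. X' n + Y' n)"
      using XX YY by (subst cls_eq_iff) (auto simp: null_rel_A_def intro: Cauchy_A_add)
  qed
  from UN_equiv_class2[OF equiv_null_rel_A equiv_null_rel_A this X Y]
  show ?thesis by (simp add: H_A_def)
qed

lemma vdiff_cls:
  assumes "X \<in> Cau" "Y \<in> Cau"
  shows "vadd K (cls X) (vscale K (-1) (cls Y)) = cls (\<lambda>n. X n - Y n)"
  using assms by (simp add: vscale_cls vadd_cls Cauchy_A_scaleC[of Y "-1", simplified])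

lemma sip_Cauchy:
  assumes X: "X \<in> Cau" and Y: "Y \<in> Cau"
  shows "Cauchy (\<lambda>n. sip (X n) (Y n))"
proof (rule metric_CauchyI)
  fix e :: real assume e: "e > 0"
  obtain B N1 where B: "B > 0" "\<forall>n\<ge>N1. nrm (X n) \<le> B" using Cauchy_A_bounded[OF X] by blast
  obtain D N2 where D: "D > 0" "\<forall>n\<ge>N2. nrm (Y n) \<le> D" using Cauchy_A_bounded[OF Y] by blast
  have "e / (2 * D) > 0" "e / (2 * B) > 0" using e D B by simp_all
  obtain N3 where N3: "\<forall>m\<ge>N3. \<forall>n\<ge>N3. nrm (X m - X n) < e / (2 * D)"
    using Cauchy_AD[OF X \<open>e / (2 * D) > 0\<close>] by blast
  obtain N4 where N4: "\<forall>m\<ge>N4. \<forall>n\<ge>N4. nrm (Y m - Y n) < e / (2 * B)"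
    using Cauchy_AD[OF Y \<open>e / (2 * B) > 0\<close>] by blast
  define N where "N = max (max N1 N2) (max N3 N4)"
  have "dist (sip (X m) (Y m)) (sip (X n) (Y n)) < e" if mn: "m \<ge> N" "n \<ge> N" for m n
  proof -
    have "sip (X m) (Y m) - sip (X n) (Y n) = sip (X m - X n) (Y m) + sip (X n) (Y m - Y n)"
      by (simp add: sip_diff_left sip_diff_right)
    then have "dist (sip (X m) (Y m)) (sip (X n) (Y n)) \<le> cmod (sip (X m - X n) (Y m)) + cmod (sip (X n) (Y m - Y n))"
      by (simp add: dist_norm norm_triangle_ineq)
    also have "\<dots> \<le> nrm (X m - X n) * nrm (Y m) + nrm (X n) * nrm (Y m - Y n)"
      by (intro add_mono sip_Cauchy_Schwarz)
    also have "nrm (X m - X n) * nrm (Y m) \<le> nrm (X m - X n) * D"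
      using D mn by (intro mult_left_mono) (auto simp: N_def)
    also have "nrm (X n) * nrm (Y m - Y n) \<le> B * nrm (Y m - Y n)"
      using B mn by (intro mult_right_mono) (auto simp: N_def)
    also have "nrm (X m - X n) * D < e / (2 * D) * D"
      using N3 mn D(1) by (intro mult_strict_right_mono) (auto simp: N_def)
    also have "B * nrm (Y m - Y n) < B * (e / (2 * B))"
      using N4 mn B(1) by (intro mult_strict_left_mono) (auto simp: N_def)
    finally show ?thesis using B(1) D(1) by simp
  qed
  then show "\<exists>N. \<forall>m\<ge>N. \<forall>n\<ge>N. dist (sip (X m) (Y m)) (sip (X n) (Y n)) < e" by blast
qed

lemma vinner_cls:
  assumes X: "X \<in> Cau" and Y: "Y \<in> Cau"
  shows "(\<lambda>n. sip (X n) (Y n)) \<longlonglongrightarrow> vinner K (cls X) (cls Y)"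
proof -
  obtain l where l: "(\<lambda>n. sip (X n) (Y n)) \<longlonglongrightarrow> l"
    using Cauchy_convergent[OF sip_Cauchy[OF X Y]] by (auto simp: convergent_def)
  have uniq: "l' = l" if X': "X' \<in> cls X" and Y': "Y' \<in> cls Y" and l': "(\<lambda>n. sip (X' n) (Y' n)) \<longlonglongrightarrow> l'" for X' Y' l'
  proof -
    note X'D = mem_clsD[OF X'] and Y'D = mem_clsD[OF Y']
    obtain B N1 where B: "B > 0" "\<forall>n\<ge>N1. nrm (X' n) \<le> B" using Cauchy_A_bounded X'D by blast
    obtain D N2 where D: "D > 0" "\<forall>n\<ge>N2. nrm (Y n) \<le> D" using Cauchy_A_bounded[OF Y] by blast
    have "(\<lambda>n. nrm (X n - X' n) * D + B * nrm (Y n - Y' n)) \<longlonglongrightarrow> 0 * D + B * 0"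
      using X'D Y'D by (intro tendsto_intros) auto
    then have lim: "(\<lambda>n. nrm (X n - X' n) * D + B * nrm (Y n - Y' n)) \<longlonglongrightarrow> 0" by simp
    have "(\<lambda>n. sip (X n) (Y n) - sip (X' n) (Y' n)) \<longlonglongrightarrow> 0"
    proof (rule Lim_null_comparison[OF _ lim], rule eventually_sequentiallyI)
      fix n assume n: "n \<ge> max N1 N2"
      have "sip (X n) (Y n) - sip (X' n) (Y' n) = sip (X n - X' n) (Y n) + sip (X' n) (Y n - Y' n)"
        by (simp add: sip_diff_left sip_diff_right)
      then have "cmod (sip (X n) (Y n) - sip (X' n) (Y' n)) \<le> cmod (sip (X n - X' n) (Y n)) + cmod (sip (X' n) (Y n - Y' n))"
        by (simp add: norm_triangle_ineq)
      also have "\<dots> \<le> nrm (X n - X' n) * nrm (Y n) + nrm (X' n) * nrm (Y n - Y' n)"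
        by (intro add_mono sip_Cauchy_Schwarz)
      also have "\<dots> \<le> nrm (X n - X' n) * D + B * nrm (Y n - Y' n)"
        using B D n by (intro add_mono mult_left_mono mult_right_mono) auto
      finally show "norm (sip (X n) (Y n) - sip (X' n) (Y' n)) \<le> nrm (X n - X' n) * D + B * nrm (Y n - Y' n)" .
    qed
    from LIMSEQ_unique[OF this tendsto_diff[OF l l']] show ?thesis by simp
  qed
  have "vinner K (cls X) (cls Y) = (THE l. \<exists>X'\<in>cls X. \<exists>Y'\<in>cls Y. (\<lambda>n. sip (X' n) (Y' n)) \<longlonglongrightarrow> l)"
    by (simp add: H_A_def)
  also have "\<dots> = l"
  proof (rule the_equality)
    show "\<exists>X'\<in>cls X. \<exists>Y'\<in>cls Y. (\<lambda>n. sip (X' n) (Y' n)) \<longlonglongrightarrow> l"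
      using l cls_self[OF X] cls_self[OF Y] by blast
  qed (use uniq in blast)
  finally have "vinner K (cls X) (cls Y) = l" .
  then show ?thesis using l by simp
qed

lemma vnorm_cls:
  assumes X: "X \<in> Cau"
  shows "(\<lambda>n. nrm (X n)) \<longlonglongrightarrow> vnorm K (cls X)"
  unfolding vnorm_def norm_A_def by (intro tendsto_real_sqrt tendsto_Re vinner_cls X)

lemma vnorm_cls_le:
  assumes X: "X \<in> Cau" and "\<And>n. n \<ge> N \<Longrightarrow> nrm (X n) \<le> c"
  shows "vnorm K (cls X) \<le> c"
  using LIMSEQ_le_const2[OF vnorm_cls[OF X]] assms(2) by blast

lemma vnorm_nonneg: "u \<in> vecs K \<Longrightarrow> 0 \<le> vnorm K u"
  by (elim vecsE) (auto intro: LIMSEQ_le_const[OF vnorm_cls])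

lemma vadd_in_vecs: "u \<in> vecs K \<Longrightarrow> v \<in> vecs K \<Longrightarrow> vadd K u v \<in> vecs K"
  by (elim vecsE) (simp add: vadd_cls cls_in_vecs Cauchy_A_add)

lemma vscale_in_vecs: "u \<in> vecs K \<Longrightarrow> vscale K c u \<in> vecs K"
  by (elim vecsE) (simp add: vscale_cls cls_in_vecs Cauchy_A_scaleC)

lemma vnorm_triangle:
  assumes "u \<in> vecs K" "v \<in> vecs K"
  shows "vnorm K (vadd K u v) \<le> vnorm K u + vnorm K v"
proof -
  obtain X where X: "X \<in> Cau" "u = cls X" using assms(1) by (rule vecsE)
  obtain Y where Y: "Y \<in> Cau" "v = cls Y" using assms(2) by (rule vecsE)
  show ?thesis unfolding X(2) Y(2) vadd_cls[OF X(1) Y(1)]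
    by (rule LIMSEQ_le[OF vnorm_cls tendsto_add[OF vnorm_cls vnorm_cls]])
      (use X Y in \<open>auto intro: nrm_triangle Cauchy_A_add\<close>)
qed

lemma vnorm_vscale:
  assumes "u \<in> vecs K"
  shows "vnorm K (vscale K c u) = cmod c * vnorm K u"
proof -
  obtain X where X: "X \<in> Cau" "u = cls X" using assms(1) by (rule vecsE)
  have "(\<lambda>n. nrm (c *\<^sub>C X n)) \<longlonglongrightarrow> vnorm K (vscale K c u)"
    using vnorm_cls[OF Cauchy_A_scaleC[OF X(1), of c]] X by (simp add: vscale_cls)
  moreover have "(\<lambda>n. nrm (c *\<^sub>C X n)) \<longlonglongrightarrow> cmod c * vnorm K u"
    using tendsto_mult_left[OF vnorm_cls[OF X(1)], of "cmod c"] X by (simp add: nrm_scaleC)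
  ultimately show ?thesis by (rule LIMSEQ_unique)
qed

lemma bounded_ops_in_vecs: "Q \<in> bounded_ops K \<Longrightarrow> u \<in> vecs K \<Longrightarrow> Q u \<in> vecs K"
  by (auto simp: bounded_ops_def PiE_def Pi_def)

lemma opnorm_bdd_above:
  assumes "Q \<in> bounded_ops K"
  shows "bdd_above (insert 0 {vnorm K (Q u) | u. u \<in> vecs K \<and> vnorm K u = 1})"
proof -
  obtain C where "\<forall>u\<in>vecs K. vnorm K (Q u) \<le> C * vnorm K u" using assms by (auto simp: bounded_ops_def)
  then show ?thesis by (intro bdd_aboveI[of _ "max C 0"]) force
qed

lemma opnorm_nonneg: "Q \<in> bounded_ops K \<Longrightarrow> 0 \<le> opnorm K Q"
  unfolding opnorm_def by (intro cSup_upper opnorm_bdd_above) auto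

lemma opnorm_bound:
  assumes Q: "Q \<in> bounded_ops K" and u: "u \<in> vecs K"
  shows "vnorm K (Q u) \<le> opnorm K Q * vnorm K u"
proof (cases "vnorm K u = 0")
  case True
  obtain C where "\<forall>u\<in>vecs K. vnorm K (Q u) \<le> C * vnorm K u" using Q by (auto simp: bounded_ops_def)
  then show ?thesis using True u by fastforce
next
  case False
  then have pos: "vnorm K u > 0" using vnorm_nonneg[OF u] by linarith
  let ?c = "complex_of_real (1 / vnorm K u)"
  have "vnorm K (vscale K ?c u) = 1" using pos by (simp add: vnorm_vscale u norm_divide)
  then have "vnorm K (Q (vscale K ?c u)) \<le> opnorm K Q"
    unfolding opnorm_def using vscale_in_vecs[OF u]
    by (intro cSup_upper opnorm_bdd_above Q) blast
  moreover have "Q (vscale K ?c u) = vscale K ?c (Q u)" using Q u by (auto simp: bounded_ops_def)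
  then have "vnorm K (Q (vscale K ?c u)) = vnorm K (Q u) / vnorm K u"
    using pos by (simp add: vnorm_vscale bounded_ops_in_vecs Q u norm_divide)
  ultimately show ?thesis using pos by (simp add: pos_divide_le_eq)
qed

lemma opnorm_le:
  assumes "0 \<le> c" "\<And>u. u \<in> vecs K \<Longrightarrow> vnorm K u = 1 \<Longrightarrow> vnorm K (Q u) \<le> c"
  shows "opnorm K Q \<le> c"
  unfolding opnorm_def using assms by (intro cSup_least) auto

lemma op_diff_in_bounded_ops:
  assumes Q: "Q \<in> bounded_ops K" and R: "R \<in> bounded_ops K"
  shows "op_diff K Q R \<in> bounded_ops K"
proof -
  have ap: "op_diff K Q R u = vadd K (Q u) (vscale K (-1) (R u))" if "u \<in> vecs K" for u
    using that by (simp add: op_diff_def op_add_def op_scale_def)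
  obtain C where C: "\<forall>u\<in>vecs K. vnorm K (Q u) \<le> C * vnorm K u" using Q by (auto simp: bounded_ops_def)
  obtain D where D: "\<forall>u\<in>vecs K. vnorm K (R u) \<le> D * vnorm K u" using R by (auto simp: bounded_ops_def)
  have ext: "op_diff K Q R \<in> vecs K \<rightarrow>\<^sub>E vecs K"
  proof (rule PiE_I)
    fix u assume "u \<in> vecs K"
    then show "op_diff K Q R u \<in> vecs K"
      by (simp add: ap vadd_in_vecs vscale_in_vecs bounded_ops_in_vecs Q R)
  qed (simp add: op_diff_def op_add_def)
  have add: "op_diff K Q R (vadd K u v) = vadd K (op_diff K Q R u) (op_diff K Q R v)"
    if u: "u \<in> vecs K" and v: "v \<in> vecs K" for u v
  proof -
    obtain X where X: "X \<in> Cau" "Q u = cls X" using bounded_ops_in_vecs[OF Q u] by (rule vecsE)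
    obtain Y where Y: "Y \<in> Cau" "Q v = cls Y" using bounded_ops_in_vecs[OF Q v] by (rule vecsE)
    obtain X' where X': "X' \<in> Cau" "R u = cls X'" using bounded_ops_in_vecs[OF R u] by (rule vecsE)
    obtain Y' where Y': "Y' \<in> Cau" "R v = cls Y'" using bounded_ops_in_vecs[OF R v] by (rule vecsE)
    have "Q (vadd K u v) = vadd K (cls X) (cls Y)" "R (vadd K u v) = vadd K (cls X') (cls Y')"
      using Q R u v X Y X' Y' by (auto simp: bounded_ops_def)
    then show ?thesis using X Y X' Y'
      by (simp add: ap u v vadd_in_vecs vdiff_cls vadd_cls Cauchy_A_add Cauchy_A_diff algebra_simps)
  qed
  have scale: "op_diff K Q R (vscale K c u) = vscale K c (op_diff K Q R u)" if u: "u \<in> vecs K" for c u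
  proof -
    obtain X where X: "X \<in> Cau" "Q u = cls X" using bounded_ops_in_vecs[OF Q u] by (rule vecsE)
    obtain X' where X': "X' \<in> Cau" "R u = cls X'" using bounded_ops_in_vecs[OF R u] by (rule vecsE)
    have "Q (vscale K c u) = vscale K c (cls X)" "R (vscale K c u) = vscale K c (cls X')"
      using Q R u X X' by (auto simp: bounded_ops_def)
    then have "Q (vscale K c u) = cls (\<lambda>n. c *\<^sub>C X n)" "R (vscale K c u) = cls (\<lambda>n. c *\<^sub>C X' n)"
      by (simp_all add: vscale_cls X X')
    then have "op_diff K Q R (vscale K c u) = cls (\<lambda>n. c *\<^sub>C X n - c *\<^sub>C X' n)"
      using X X' by (simp only: ap vscale_in_vecs[OF u] vdiff_cls Cauchy_A_scaleC)
    moreover have "op_diff K Q R u = cls (\<lambda>n. X n - X' n)"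
      using X X' by (simp only: ap u vdiff_cls)
    ultimately show ?thesis using X X'
      by (simp add: vscale_cls Cauchy_A_diff scaleC_diff_right)
  qed
  have "vnorm K (op_diff K Q R u) \<le> (C + D) * vnorm K u" if u: "u \<in> vecs K" for u
  proof -
    have "vnorm K (op_diff K Q R u) \<le> vnorm K (Q u) + vnorm K (vscale K (-1) (R u))"
      unfolding ap[OF u] by (rule vnorm_triangle[OF bounded_ops_in_vecs[OF Q u] vscale_in_vecs[OF bounded_ops_in_vecs[OF R u]]])
    also have "vnorm K (vscale K (-1) (R u)) = vnorm K (R u)"
      by (simp add: vnorm_vscale bounded_ops_in_vecs R u)
    also have "vnorm K (Q u) + vnorm K (R u) \<le> C * vnorm K u + D * vnorm K u"
      using C D u by (intro add_mono) auto
    finally show ?thesis by (simp add: distrib_right)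
  qed
  then show ?thesis using ext add scale by (auto simp: bounded_ops_def)
qed


subsection \<open>Calculus of lifted operators\<close>

lemma lift_in_bounded_ops:
  assumes L: "op_Cauchy L"
  shows "lift L \<in> bounded_ops K"
proof -
  obtain C N where C: "C > 0" "\<forall>n\<ge>N. \<forall>x. nrm (L n x) \<le> C * nrm x" using op_Cauchy_bounded[OF L] by blast
  note lin = op_Cauchy_linear[OF L]
  have ext: "lift L \<in> vecs K \<rightarrow>\<^sub>E vecs K"
  proof (rule PiE_I)
    fix u assume "u \<in> vecs K"
    then show "lift L u \<in> vecs K"
      by (elim vecsE) (simp add: lift_cls L cls_in_vecs op_Cauchy_diagonal)
  qed (simp add: lift_def)
  have add: "lift L (vadd K u v) = vadd K (lift L u) (lift L v)" if "u \<in> vecs K" "v \<in> vecs K" for u v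
    using that by (elim vecsE)
      (simp add: vadd_cls lift_cls L Cauchy_A_add op_Cauchy_diagonal complex_linear_add[OF lin])
  have scale: "lift L (vscale K c u) = vscale K c (lift L u)" if "u \<in> vecs K" for c u
    using that by (elim vecsE)
      (simp add: vscale_cls lift_cls L Cauchy_A_scaleC op_Cauchy_diagonal complex_linear_scaleC[OF lin])
  have "vnorm K (lift L u) \<le> C * vnorm K u" if u: "u \<in> vecs K" for u
  proof -
    obtain X where X: "X \<in> Cau" "u = cls X" using u by (rule vecsE)
    show ?thesis unfolding X(2) lift_cls[OF L X(1)]
      by (rule LIMSEQ_le[OF vnorm_cls[OF op_Cauchy_diagonal[OF L X(1)]] tendsto_mult_left[OF vnorm_cls[OF X(1)]]])
        (use C in blast)
  qed
  then show ?thesis using ext add scale by (auto simp: bounded_ops_def)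
qed

lemma opnorm_lift_le:
  assumes L: "op_Cauchy L" and "0 \<le> c" and c: "\<And>n x. n \<ge> N \<Longrightarrow> nrm (L n x) \<le> c * nrm x"
  shows "opnorm K (lift L) \<le> c"
proof (rule opnorm_le)
  fix u assume u: "u \<in> vecs K" "vnorm K u = 1"
  obtain X where X: "X \<in> Cau" "u = cls X" using u(1) by (rule vecsE)
  have "vnorm K (lift L u) \<le> c * vnorm K u" unfolding X(2) lift_cls[OF L X(1)]
    by (rule LIMSEQ_le[OF vnorm_cls[OF op_Cauchy_diagonal[OF L X(1)]] tendsto_mult_left[OF vnorm_cls[OF X(1)]]])
      (use c in blast)
  then show "vnorm K (lift L u) \<le> c" using u(2) by simp
qed fact

lemma op_Cauchy_add:
  assumes L: "op_Cauchy L" and M: "op_Cauchy M"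
  shows "op_Cauchy (\<lambda>n x. L n x + M n x)"
  unfolding op_Cauchy_def
proof (intro conjI allI impI)
  fix e :: real assume e: "e > 0"
  then have "e / 2 > 0" by simp
  obtain N1 where N1: "\<forall>m\<ge>N1. \<forall>n\<ge>N1. \<forall>x. nrm (L m x - L n x) \<le> e / 2 * nrm x"
    using op_CauchyD[OF L \<open>e / 2 > 0\<close>] by blast
  obtain N2 where N2: "\<forall>m\<ge>N2. \<forall>n\<ge>N2. \<forall>x. nrm (M m x - M n x) \<le> e / 2 * nrm x"
    using op_CauchyD[OF M \<open>e / 2 > 0\<close>] by blast
  have "nrm (L m x + M m x - (L n x + M n x)) \<le> e * nrm x" if "m \<ge> max N1 N2" "n \<ge> max N1 N2" for m n x
  proof -
    have "nrm (L m x + M m x - (L n x + M n x)) \<le> nrm (L m x - L n x) + nrm (M m x - M n x)"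
      using nrm_triangle[of "L m x - L n x" "M m x - M n x"] by (simp add: algebra_simps)
    also have "\<dots> \<le> e / 2 * nrm x + e / 2 * nrm x" using N1 N2 that by (intro add_mono) auto
    finally show ?thesis by simp
  qed
  then show "\<exists>N. \<forall>m\<ge>N. \<forall>n\<ge>N. \<forall>x. nrm (L m x + M m x - (L n x + M n x)) \<le> e * nrm x" by blast
qed (rule A_bounded_add[OF op_Cauchy_A_bounded[OF L] op_Cauchy_A_bounded[OF M]])

lemma op_Cauchy_comp:
  assumes L: "op_Cauchy L" and M: "op_Cauchy M"
  shows "op_Cauchy (\<lambda>n x. L n (M n x))"
  unfolding op_Cauchy_def
proof (intro conjI allI impI)
  fix e :: real assume e: "e > 0"
  obtain C N1 where C: "C > 0" "\<forall>n\<ge>N1. \<forall>x. nrm (L n x) \<le> C * nrm x" using op_Cauchy_bounded[OF L] by blast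
  obtain D N2 where D: "D > 0" "\<forall>n\<ge>N2. \<forall>x. nrm (M n x) \<le> D * nrm x" using op_Cauchy_bounded[OF M] by blast
  have "e / (2 * D) > 0" "e / (2 * C) > 0" using e C D by simp_all
  obtain N3 where N3: "\<forall>m\<ge>N3. \<forall>n\<ge>N3. \<forall>x. nrm (L m x - L n x) \<le> e / (2 * D) * nrm x"
    using op_CauchyD[OF L \<open>e / (2 * D) > 0\<close>] by blast
  obtain N4 where N4: "\<forall>m\<ge>N4. \<forall>n\<ge>N4. \<forall>x. nrm (M m x - M n x) \<le> e / (2 * C) * nrm x"
    using op_CauchyD[OF M \<open>e / (2 * C) > 0\<close>] by blast
  define N where "N = max (max N1 N2) (max N3 N4)"
  have "nrm (L m (M m x) - L n (M n x)) \<le> e * nrm x" if mn: "m \<ge> N" "n \<ge> N" for m n x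
  proof -
    have "nrm (L m (M m x) - L n (M m x)) \<le> e / (2 * D) * nrm (M m x)" using N3 mn by (simp add: N_def)
    also have "\<dots> \<le> e / (2 * D) * (D * nrm x)" using D mn e by (intro mult_left_mono) (auto simp: N_def)
    finally have 1: "nrm (L m (M m x) - L n (M m x)) \<le> e / 2 * nrm x" using D(1) by simp
    have "nrm (L n (M m x) - L n (M n x)) = nrm (L n (M m x - M n x))"
      by (simp add: complex_linear_diff[OF op_Cauchy_linear[OF L]])
    also have "\<dots> \<le> C * nrm (M m x - M n x)" using C mn by (simp add: N_def)
    also have "\<dots> \<le> C * (e / (2 * C) * nrm x)" using N4 mn C(1) by (intro mult_left_mono) (auto simp: N_def)
    finally have 2: "nrm (L n (M m x) - L n (M n x)) \<le> e / 2 * nrm x" using C(1) by simp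
    show ?thesis using nrm_triangle_diff[of "L m (M m x)" "L n (M n x)" "L n (M m x)"] 1 2 by linarith
  qed
  then show "\<exists>N. \<forall>m\<ge>N. \<forall>n\<ge>N. \<forall>x. nrm (L m (M m x) - L n (M n x)) \<le> e * nrm x" by blast
qed (rule A_bounded_comp[OF op_Cauchy_A_bounded[OF L] op_Cauchy_A_bounded[OF M]])

lemma op_Cauchy_scaleC:
  assumes "op_Cauchy L"
  shows "op_Cauchy (\<lambda>n x. c *\<^sub>C L n x)"
  using op_Cauchy_comp[OF op_Cauchy_const[OF A_bounded_scaleC[OF A_bounded_ident]] assms] .

lemma op_Cauchy_diff:
  assumes "op_Cauchy L" "op_Cauchy M"
  shows "op_Cauchy (\<lambda>n x. L n x - M n x)"
  using op_Cauchy_add[OF assms(1) op_Cauchy_scaleC[OF assms(2), of "-1"]] by simp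

lemma lift_id: "op_id K = lift (\<lambda>_ x. x)"
proof
  fix u show "op_id K u = lift (\<lambda>_ x. x) u"
  proof (cases "u \<in> vecs K")
    case True
    then obtain X where "X \<in> Cau" "u = cls X" by (rule vecsE)
    then show ?thesis using lift_cls[OF op_Cauchy_const[OF A_bounded_ident], of X] True
      by (simp add: op_id_def)
  qed (simp add: op_id_def lift_def)
qed

lemma lift_add:
  assumes L: "op_Cauchy L" and M: "op_Cauchy M"
  shows "op_add K (lift L) (lift M) = lift (\<lambda>n x. L n x + M n x)"
proof
  fix u show "op_add K (lift L) (lift M) u = lift (\<lambda>n x. L n x + M n x) u"
  proof (cases "u \<in> vecs K")
    case True
    then obtain X where X: "X \<in> Cau" "u = cls X" by (rule vecsE)
    have "op_add K (lift L) (lift M) u = vadd K (lift L u) (lift M u)" using True by (simp add: op_add_def)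
    then show ?thesis using X
      by (simp add: lift_cls L M op_Cauchy_add vadd_cls op_Cauchy_diagonal)
  qed (simp add: op_add_def lift_def)
qed

lemma lift_scaleC:
  assumes L: "op_Cauchy L"
  shows "op_scale K c (lift L) = lift (\<lambda>n x. c *\<^sub>C L n x)"
proof
  fix u show "op_scale K c (lift L) u = lift (\<lambda>n x. c *\<^sub>C L n x) u"
  proof (cases "u \<in> vecs K")
    case True
    then obtain X where X: "X \<in> Cau" "u = cls X" by (rule vecsE)
    have "op_scale K c (lift L) u = vscale K c (lift L u)" using True by (simp add: op_scale_def)
    then show ?thesis using X
      by (simp add: lift_cls L op_Cauchy_scaleC vscale_cls op_Cauchy_diagonal)
  qed (simp add: op_scale_def lift_def)
qed

lemma lift_diff:
  assumes L: "op_Cauchy L" and M: "op_Cauchy M"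
  shows "op_diff K (lift L) (lift M) = lift (\<lambda>n x. L n x - M n x)"
  unfolding op_diff_def lift_scaleC[OF M] lift_add[OF L op_Cauchy_scaleC[OF M]] by simp

lemma lift_comp:
  assumes L: "op_Cauchy L" and M: "op_Cauchy M"
  shows "op_comp K (lift L) (lift M) = lift (\<lambda>n x. L n (M n x))"
proof
  fix u show "op_comp K (lift L) (lift M) u = lift (\<lambda>n x. L n (M n x)) u"
  proof (cases "u \<in> vecs K")
    case True
    then obtain X where X: "X \<in> Cau" "u = cls X" by (rule vecsE)
    have "op_comp K (lift L) (lift M) u = lift L (lift M u)" using True by (simp add: op_comp_def compose_def)
    then show ?thesis using X
      by (simp add: lift_cls L M op_Cauchy_comp op_Cauchy_diagonal)
  qed (simp add: op_comp_def compose_def lift_def)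
qed

lemma embed_A_eq_cls: "embed_A A x = cls (\<lambda>_. x)"
  by (simp add: embed_A_def)

lemma embed_A_in_vecs: "embed_A A x \<in> vecs K"
  by (simp add: embed_A_eq_cls cls_in_vecs Cauchy_A_const)

lemma vnorm_embed_A: "vnorm K (embed_A A x) = nrm x"
  using LIMSEQ_unique[OF vnorm_cls[OF Cauchy_A_const, of x] tendsto_const] by (simp add: embed_A_eq_cls)

lemma lift_embed_A: "op_Cauchy L \<Longrightarrow> lift L (embed_A A x) = cls (\<lambda>n. L n x)"
  by (simp add: embed_A_eq_cls lift_cls Cauchy_A_const)

text \<open>
  A bounded operator is determined by its values on the dense image of the original space: if \<open>Q\<close> maps the
  class of \<open>X\<close> to the class of \<open>Y\<close>, then \<open>Y n - P (X n)\<close> is the value of \<open>Q\<close> at a difference that tends to \<open>0\<close>,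
  up to the Cauchy error of \<open>Y\<close>.
\<close>

lemma induced_op_eq_lift:
  assumes P: "A_bounded P"
  shows "induced_op A P = lift (\<lambda>_. P)"
  unfolding induced_op_def
proof (rule the_equality)
  show "lift (\<lambda>_. P) \<in> bounded_ops K \<and> (\<forall>x. lift (\<lambda>_. P) (embed_A A x) = embed_A A (P x))"
    by (simp add: lift_in_bounded_ops op_Cauchy_const P embed_A_eq_cls
        lift_cls[OF op_Cauchy_const[OF P] Cauchy_A_const])
next
  fix Q assume Q: "Q \<in> bounded_ops K \<and> (\<forall>x. Q (embed_A A x) = embed_A A (P x))"
  then have Qb: "Q \<in> bounded_ops K" by blast
  show "Q = lift (\<lambda>_. P)"
  proof
    fix u show "Q u = lift (\<lambda>_. P) u"
    proof (cases "u \<in> vecs K")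
      case False
      then show ?thesis using Qb by (auto simp: bounded_ops_def lift_def PiE_def extensional_def)
    next
      case True
      then obtain X where X: "X \<in> Cau" "u = cls X" by (rule vecsE)
      obtain Y where Y: "Y \<in> Cau" "Q u = cls Y" using bounded_ops_in_vecs[OF Qb True] by (rule vecsE)
      define C where "C = opnorm K Q"
      have C: "C \<ge> 0" unfolding C_def by (rule opnorm_nonneg) fact
      have Qdiff: "Q (cls (\<lambda>m. X m - X n)) = cls (\<lambda>m. Y m - P (X n))" for n
      proof -
        have "cls (\<lambda>m. X m - X n) = vadd K u (vscale K (-1) (embed_A A (X n)))"
          by (simp add: X embed_A_eq_cls vdiff_cls Cauchy_A_const)
        also have "Q \<dots> = vadd K (Q u) (vscale K (-1) (Q (embed_A A (X n))))"
          using Qb True embed_A_in_vecs[of "X n"] vscale_in_vecs[OF embed_A_in_vecs[of "X n"], of "-1"]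
          by (simp add: bounded_ops_def)
        also have "\<dots> = cls (\<lambda>m. Y m - P (X n))"
          using Q by (simp add: Y embed_A_eq_cls vdiff_cls Cauchy_A_const)
        finally show ?thesis .
      qed
      have "(\<lambda>n. nrm (Y n - P (X n))) \<longlonglongrightarrow> 0"
      proof (rule LIMSEQ_I)
        fix e :: real assume e: "e > 0"
        define d where "d = e / (2 + C)"
        have d: "d > 0" using e C by (simp add: d_def)
        obtain N1 where N1: "\<forall>m\<ge>N1. \<forall>n\<ge>N1. nrm (X m - X n) < d" using Cauchy_AD[OF X(1) d] by blast
        obtain N2 where N2: "\<forall>m\<ge>N2. \<forall>n\<ge>N2. nrm (Y m - Y n) < d" using Cauchy_AD[OF Y(1) d] by blast
        have "nrm (Y n - P (X n)) < e" if n: "n \<ge> max N1 N2" for n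
        proof -
          have Xn: "(\<lambda>m. X m - X n) \<in> Cau" by (intro Cauchy_A_diff X Cauchy_A_const)
          have Yn: "(\<lambda>m. Y m - P (X n)) \<in> Cau" by (intro Cauchy_A_diff Y Cauchy_A_const)
          have "vnorm K (cls (\<lambda>m. X m - X n)) \<le> d"
            by (rule vnorm_cls_le[OF Xn, of N1]) (use N1 n in \<open>auto intro: less_imp_le\<close>)
          then have "C * vnorm K (cls (\<lambda>m. X m - X n)) \<le> C * d" by (rule mult_left_mono) fact
          then have "vnorm K (cls (\<lambda>m. Y m - P (X n))) \<le> C * d"
            using opnorm_bound[OF Qb cls_in_vecs[OF Xn]] by (simp add: Qdiff C_def)
          moreover have "nrm (Y n - P (X n)) \<le> d + vnorm K (cls (\<lambda>m. Y m - P (X n)))"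
          proof (rule LIMSEQ_le_const[OF tendsto_add[OF tendsto_const vnorm_cls[OF Yn]]], intro exI allI impI)
            fix m assume m: "m \<ge> max N1 N2"
            have "nrm (Y n - Y m) < d" using N2 n m by simp
            then show "nrm (Y n - P (X n)) \<le> d + nrm (Y m - P (X n))"
              using nrm_triangle_diff[of "Y n" "P (X n)" "Y m"] by linarith
          qed
          ultimately have "nrm (Y n - P (X n)) \<le> (1 + C) * d" by (simp add: distrib_right)
          also have "\<dots> < (2 + C) * d" using d by simp
          also have "\<dots> = e" using C by (simp add: d_def)
          finally show ?thesis .
        qed
        then show "\<exists>N. \<forall>n\<ge>N. norm (nrm (Y n - P (X n)) - 0) < e"
          by (intro exI[of _ "max N1 N2"]) auto
      qed
      then show ?thesis
        using X Y op_Cauchy_diagonal[OF op_Cauchy_const[OF P] X(1)]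
        by (simp add: lift_cls op_Cauchy_const P cls_eq_iff)
    qed
  qed
qed

lemma op_poly_lift:
  assumes P: "A_bounded P"
  shows "op_poly K p (lift (\<lambda>_. P)) = lift (\<lambda>_. op_rpoly P p)"
proof (induction p)
  case 0
  have "op_scale K 0 (op_id K) = lift (\<lambda>_. op_rpoly P 0)"
    unfolding lift_id lift_scaleC[OF op_Cauchy_const[OF A_bounded_ident]]
    by (intro arg_cong[where f = lift] ext) simp
  then show ?case by (simp only: op_poly_def fold_coeffs_0_eq id_apply)
next
  case (pCons a p)
  have step: "op_poly K (pCons a p) (lift (\<lambda>_. P)) =
      op_add K (op_scale K (complex_of_real a) (op_id K)) (op_comp K (lift (\<lambda>_. P)) (op_poly K p (lift (\<lambda>_. P))))"
    using pCons.hyps by (auto simp: op_poly_def fold_coeffs_pCons_not_0_0_eq)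
  have 1: "op_Cauchy (\<lambda>_. op_rpoly P p)" by (intro op_Cauchy_const op_cpoly_A_bounded P)
  have 2: "op_Cauchy (\<lambda>_. P)" by (intro op_Cauchy_const P)
  have 3: "op_Cauchy (\<lambda>_ x. x)" by (intro op_Cauchy_const A_bounded_ident)
  show ?case unfolding step pCons.IH lift_id lift_scaleC[OF 3] lift_comp[OF 2 1]
      lift_add[OF op_Cauchy_scaleC[OF 3] op_Cauchy_comp[OF 2 1]]
    by (simp add: op_rpoly_simps A_bounded_linear[OF P])
qed

text \<open>
  A bounded left inverse of \<open>P - z\<close> on the completion, evaluated at vectors of the original space, yields a
  lower bound for \<open>P - z\<close>.
\<close>

lemma approximate_spectrum_in_op_spectrum:
  assumes P: "A_bounded P" and nb: "\<not> A_bounded_below (\<lambda>x. P x - z *\<^sub>C x)"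
  shows "z \<in> op_spectrum K (lift (\<lambda>_. P))"
proof (rule ccontr)
  have M: "op_Cauchy (\<lambda>_ x. P x - z *\<^sub>C x)"
    by (intro op_Cauchy_const A_bounded_diff P A_bounded_scaleC A_bounded_ident)
  have eq: "op_diff K (lift (\<lambda>_. P)) (op_scale K z (op_id K)) = lift (\<lambda>_ x. P x - z *\<^sub>C x)"
    by (simp add: lift_id lift_scaleC lift_diff op_Cauchy_const P A_bounded_scaleC)
  assume "z \<notin> op_spectrum K (lift (\<lambda>_. P))"
  then obtain R where R: "R \<in> bounded_ops K" "op_comp K R (lift (\<lambda>_ x. P x - z *\<^sub>C x)) = op_id K"
    by (auto simp: op_spectrum_def eq)
  define C where "C = opnorm K R"
  have C: "C \<ge> 0" unfolding C_def by (rule opnorm_nonneg) fact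
  have le: "nrm x \<le> C * nrm (P x - z *\<^sub>C x)" for x
  proof -
    have "embed_A A x = op_comp K R (lift (\<lambda>_ x. P x - z *\<^sub>C x)) (embed_A A x)"
      by (simp add: R(2) op_id_def embed_A_in_vecs)
    also have "\<dots> = R (embed_A A (P x - z *\<^sub>C x))"
      using embed_A_in_vecs lift_embed_A[OF M] by (simp add: op_comp_def compose_def embed_A_eq_cls)
    finally have "nrm x = vnorm K (R (embed_A A (P x - z *\<^sub>C x)))" by (metis vnorm_embed_A)
    also have "\<dots> \<le> C * nrm (P x - z *\<^sub>C x)"
      using opnorm_bound[OF R(1) embed_A_in_vecs] by (simp add: C_def vnorm_embed_A)
    finally show ?thesis .
  qed
  have "1 / (C + 1) * nrm x \<le> nrm (P x - z *\<^sub>C x)" for x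
  proof -
    have "nrm x \<le> (C + 1) * nrm (P x - z *\<^sub>C x)"
      using le[of x] nrm_nonneg[of "P x - z *\<^sub>C x"] unfolding distrib_right by linarith
    then show ?thesis using C by (simp add: pos_divide_le_eq mult.commute)
  qed
  then have "A_bounded_below (\<lambda>x. P x - z *\<^sub>C x)"
    unfolding A_bounded_below_def using C by (intro exI[of _ "1 / (C + 1)"]) simp
  then show False using nb by blast
qed

end

section \<open>Spectrum and functional calculus of an A-positive operator\<close>

context A_positive_op
begin

text \<open>
  The Neumann series: \<open>P - N/2\<close> has norm at most \<open>N/2\<close>, because its approximate spectrum lies in \<open>[-N/2, N/2]\<close>.
  Hence \<open>P - t = d (g - 1)\<close> with \<open>d = t - N/2\<close> and \<open>\<parallel>g\<parallel> < 1\<close> for every real \<open>t\<close> outside \<open>[0, N]\<close>.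
\<close>

lemma op_spectrum_real_range:
  assumes "complex_of_real t \<in> op_spectrum K (lift (\<lambda>_. P))"
  shows "t \<in> {0..N}"
proof (rule ccontr)
  assume t: "t \<notin> {0..N}"
  define d where "d = t - N / 2"
  define \<rho> where "\<rho> = N / 2 / \<bar>d\<bar>"
  have N0: "N \<ge> 0" by (rule opnorm_A_nonneg) (rule A_bounded_P)
  have dN: "N / 2 < \<bar>d\<bar>" using t N0 by (auto simp: d_def abs_if)
  then have d0: "d \<noteq> 0" using N0 by auto
  have \<rho>: "0 \<le> \<rho>" "\<rho> < 1" using N0 dN by (auto simp: \<rho>_def)
  define g where "g = (\<lambda>x. complex_of_real (1 / d) *\<^sub>C (P x - complex_of_real (N / 2) *\<^sub>C x))"
  have gA: "A_bounded g" unfolding g_def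
    by (intro A_bounded_scaleC A_bounded_diff A_bounded_P A_bounded_ident)
  note glin = A_bounded_linear[OF gA]
  have g_le: "nrm (g x) \<le> \<rho> * nrm x" for x
  proof -
    have "nrm (op_rpoly P [:- (N / 2), 1:] x) \<le> N / 2 * nrm x"
    proof (rule nrm_op_rpoly_le[OF A_bounded_P symmetric_P])
      fix u assume "\<not> A_bounded_below (\<lambda>x. P x - complex_of_real u *\<^sub>C x)"
      then have "0 \<le> u" "u \<le> N" using approximate_spectrum_range by auto
      moreover have "poly [:- (N / 2), 1:] u = u - N / 2" by simp
      ultimately show "\<bar>poly [:- (N / 2), 1:] u\<bar> \<le> N / 2" by linarith
    qed
    moreover have "op_rpoly P [:- (N / 2), 1:] x = P x - complex_of_real (N / 2) *\<^sub>C x"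
      by (simp add: op_rpoly_simps linear_P complex_linear_zero scaleC_minus_left)
    ultimately have "nrm (P x - complex_of_real (N / 2) *\<^sub>C x) \<le> N / 2 * nrm x" by simp
    then have "nrm (P x - complex_of_real (N / 2) *\<^sub>C x) / \<bar>d\<bar> \<le> N / 2 * nrm x / \<bar>d\<bar>"
      by (rule divide_right_mono) simp
    then show ?thesis by (simp add: g_def nrm_scaleC norm_divide \<rho>_def)
  qed
  have gpow: "nrm ((g ^^ n) x) \<le> \<rho> ^ n * nrm x" for n x
  proof (induction n)
    case (Suc n)
    have "nrm ((g ^^ Suc n) x) \<le> \<rho> * nrm ((g ^^ n) x)" using g_le by simp
    also have "\<dots> \<le> \<rho> * (\<rho> ^ n * nrm x)" by (intro mult_left_mono Suc \<rho>)
    finally show ?case by simp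
  qed simp
  \<comment> \<open>\<open>G n\<close> is the partial sum of the powers \<open>g\<^sup>k\<close> with \<open>k < n\<close>, and \<open>R n = - G n / d\<close> approximates the inverse.\<close>
  define G where "G = rec_nat (\<lambda>x. 0) (\<lambda>_ H x. x + g (H x))"
  have G0: "G 0 x = 0" and GS: "G (Suc n) x = x + g (G n x)" for n x by (simp_all add: G_def)
  have G_bounded: "A_bounded (G n)" for n
  proof (induction n)
    case 0
    then show ?case by (simp add: G_def)
  next
    case (Suc n)
    have "G (Suc n) = (\<lambda>x. x + g (G n x))" by (rule ext) (rule GS)
    then show ?case using A_bounded_add[OF A_bounded_ident A_bounded_comp[OF gA Suc]] by simp
  qed
  have G_le: "nrm (G n x) \<le> 1 / (1 - \<rho>) * nrm x" for n x
  proof (induction n)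
    case 0
    then show ?case using \<rho> by (simp add: G0)
  next
    case (Suc n)
    have "nrm (G (Suc n) x) \<le> nrm x + nrm (g (G n x))" unfolding GS by (rule nrm_triangle)
    also have "nrm (g (G n x)) \<le> \<rho> * nrm (G n x)" by (rule g_le)
    also have "\<rho> * nrm (G n x) \<le> \<rho> * (1 / (1 - \<rho>) * nrm x)" by (intro mult_left_mono Suc \<rho>)
    also have "nrm x + \<rho> * (1 / (1 - \<rho>) * nrm x) = 1 / (1 - \<rho>) * nrm x" using \<rho> by (simp add: field_simps)
    finally show ?case by simp
  qed
  have G_diff: "G (n + k) x - G n x = (g ^^ n) (G k x)" for n k x
    by (induction n) (simp_all add: G0 GS complex_linear_diff[OF glin, symmetric])
  have G_dist: "nrm (G m x - G n x) \<le> \<rho> ^ n / (1 - \<rho>) * nrm x" if "m \<ge> n" for m n x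
  proof -
    have "nrm (G m x - G n x) = nrm ((g ^^ n) (G (m - n) x))" using G_diff[of n "m - n" x] that by simp
    also have "\<dots> \<le> \<rho> ^ n * nrm (G (m - n) x)" by (rule gpow)
    also have "\<dots> \<le> \<rho> ^ n * (1 / (1 - \<rho>) * nrm x)" by (intro mult_left_mono G_le zero_le_power \<rho>)
    finally show ?thesis by simp
  qed
  have \<rho>_lim: "(\<lambda>n. \<rho> ^ n / (1 - \<rho>)) \<longlonglongrightarrow> 0"
    using tendsto_divide[OF LIMSEQ_realpow_zero tendsto_const, of \<rho> "1 - \<rho>"] \<rho> by simp
  have G_Cauchy: "op_Cauchy G" unfolding op_Cauchy_def
  proof (intro conjI allI impI)
    fix e :: real assume "e > 0"
    from order_tendstoD(2)[OF \<rho>_lim this] obtain M where M: "\<And>n. n \<ge> M \<Longrightarrow> \<rho> ^ n / (1 - \<rho>) < e"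
      by (auto simp: eventually_sequentially)
    have le: "nrm (G m x - G n x) \<le> e * nrm x" if "m \<ge> n" "n \<ge> M" for m n x
      using G_dist[OF that(1), of x] mult_right_mono[OF less_imp_le[OF M[OF that(2)]] nrm_nonneg[of x]] by linarith
    have "nrm (G m x - G n x) \<le> e * nrm x" if "m \<ge> M" "n \<ge> M" for m n x
      using le[of n m x] le[of m n x] that by (cases "m \<ge> n") (auto simp: nrm_diff_commute)
    then show "\<exists>M. \<forall>m\<ge>M. \<forall>n\<ge>M. \<forall>x. nrm (G m x - G n x) \<le> e * nrm x" by blast
  qed (rule G_bounded)
  define R where "R = (\<lambda>n x. complex_of_real (- 1 / d) *\<^sub>C G n x)"
  have R_Cauchy: "op_Cauchy R" unfolding R_def by (rule op_Cauchy_scaleC) (rule G_Cauchy)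
  define Z where "Z = (\<lambda>x. P x - complex_of_real t *\<^sub>C x)"
  have Z_bounded: "A_bounded Z" unfolding Z_def
    by (intro A_bounded_diff A_bounded_P A_bounded_scaleC A_bounded_ident)
  have Z_eq: "Z x = complex_of_real d *\<^sub>C (g x - x)" for x
  proof -
    have "complex_of_real d *\<^sub>C g x = P x - complex_of_real (N / 2) *\<^sub>C x"
      using d0 by (simp add: g_def scaleC_scaleC)
    then show ?thesis
      by (simp add: Z_def d_def scaleC_diff_right scaleC_diff_left algebra_simps)
  qed
  have G_left: "G n (g x - x) = (g ^^ n) x - x" for n x
    by (induction n) (simp_all add: G0 GS complex_linear_diff[OF glin])
  have G_right: "g (G n x) - G n x = (g ^^ n) x - x" for n x
  proof (induction n)
    case 0
    then show ?case by (simp add: G0 complex_linear_zero[OF glin])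
  next
    case (Suc n)
    have "g (G (Suc n) x) - G (Suc n) x = g x - x + g (g (G n x) - G n x)"
      by (simp add: GS complex_linear_add[OF glin] complex_linear_diff[OF glin])
    also have "\<dots> = (g ^^ Suc n) x - x" by (simp add: Suc complex_linear_diff[OF glin])
    finally show ?case .
  qed
  have RZ: "R n (Z x) = x - (g ^^ n) x" and ZR: "Z (R n x) = x - (g ^^ n) x" for n x
  proof -
    have "R n (Z x) = complex_of_real (- 1 / d) *\<^sub>C complex_of_real d *\<^sub>C ((g ^^ n) x - x)"
      by (simp only: R_def Z_eq G_left complex_linear_scaleC[OF A_bounded_linear[OF G_bounded]])
    then show "R n (Z x) = x - (g ^^ n) x" using d0 by (simp add: scaleC_scaleC)
    have "Z (R n x) = complex_of_real (- 1 / d) *\<^sub>C complex_of_real d *\<^sub>C ((g ^^ n) x - x)"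
      unfolding R_def complex_linear_scaleC[OF A_bounded_linear[OF Z_bounded]] by (simp only: Z_eq G_right)
    then show "Z (R n x) = x - (g ^^ n) x" using d0 by (simp add: scaleC_scaleC)
  qed
  have small: "\<exists>M. \<forall>n\<ge>M. \<forall>x. nrm ((x - (g ^^ n) x) - x) \<le> e * nrm x" if e: "e > 0" for e
  proof -
    have "(\<lambda>n. \<rho> ^ n) \<longlonglongrightarrow> 0" using \<rho> by (intro LIMSEQ_realpow_zero)
    from order_tendstoD(2)[OF this e] obtain M where M: "\<And>n. n \<ge> M \<Longrightarrow> \<rho> ^ n < e"
      by (auto simp: eventually_sequentially)
    have "nrm ((x - (g ^^ n) x) - x) \<le> e * nrm x" if "n \<ge> M" for n x
      using gpow[of n x] mult_right_mono[OF less_imp_le[OF M[OF that]] nrm_nonneg[of x]]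
      by (simp add: nrm_minus)
    then show ?thesis by blast
  qed
  note Z_Cauchy = op_Cauchy_const[OF Z_bounded] and id_Cauchy = op_Cauchy_const[OF A_bounded_ident]
  have "lift (\<lambda>n x. R n (Z x)) = op_id K" "lift (\<lambda>n x. Z (R n x)) = op_id K"
    unfolding lift_id
    by (rule lift_eqI[OF op_Cauchy_comp[OF R_Cauchy Z_Cauchy] id_Cauchy], simp add: RZ small[simplified])
      (rule lift_eqI[OF op_Cauchy_comp[OF Z_Cauchy R_Cauchy] id_Cauchy], simp add: ZR small[simplified])
  then have "op_comp K (lift R) (lift (\<lambda>_. Z)) = op_id K" "op_comp K (lift (\<lambda>_. Z)) (lift R) = op_id K"
    by (simp_all only: lift_comp[OF R_Cauchy Z_Cauchy] lift_comp[OF Z_Cauchy R_Cauchy])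
  moreover have "op_diff K (lift (\<lambda>_. P)) (op_scale K (complex_of_real t) (op_id K)) = lift (\<lambda>_. Z)"
    unfolding lift_id lift_scaleC[OF id_Cauchy] lift_diff[OF op_Cauchy_const[OF A_bounded_P] op_Cauchy_scaleC[OF id_Cauchy]]
    by (simp only: Z_def)
  ultimately show False using assms lift_in_bounded_ops[OF R_Cauchy] by (auto simp: op_spectrum_def)
qed

abbreviation spec :: "real set" where
  "spec \<equiv> {t. complex_of_real t \<in> op_spectrum K (lift (\<lambda>_. P))}"

lemma nrm_op_rpoly_diff_le:
  assumes "\<And>t. t \<in> spec \<Longrightarrow> \<bar>poly p t - poly q t\<bar> \<le> e"
  shows "nrm (op_rpoly P p x - op_rpoly P q x) \<le> e * nrm x"
proof -
  have "nrm (op_rpoly P (p - q) x) \<le> e * nrm x"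
    using approximate_spectrum_in_op_spectrum[OF A_bounded_P] assms
    by (intro nrm_op_rpoly_le[OF A_bounded_P symmetric_P]) simp
  then show ?thesis by (simp add: op_rpoly_simps linear_P)
qed

lemma op_Cauchy_op_rpoly:
  assumes p: "uniform_limit spec (\<lambda>n. poly (p n)) f sequentially"
  shows "op_Cauchy (\<lambda>n. op_rpoly P (p n))"
  unfolding op_Cauchy_def
proof (intro conjI allI impI)
  fix e :: real assume "e > 0"
  then have "e / 2 > 0" by simp
  from uniform_limitD[OF p this] obtain M where M: "\<And>n t. n \<ge> M \<Longrightarrow> t \<in> spec \<Longrightarrow> dist (poly (p n) t) (f t) < e / 2"
    by (force simp: eventually_sequentially)
  have "nrm (op_rpoly P (p m) x - op_rpoly P (p n) x) \<le> e * nrm x" if "m \<ge> M" "n \<ge> M" for m n x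
  proof (rule nrm_op_rpoly_diff_le)
    fix t assume "t \<in> spec"
    then show "\<bar>poly (p m) t - poly (p n) t\<bar> \<le> e"
      using M[OF that(1), of t] M[OF that(2), of t] unfolding dist_real_def by linarith
  qed
  then show "\<exists>M. \<forall>m\<ge>M. \<forall>n\<ge>M. \<forall>x. nrm (op_rpoly P (p m) x - op_rpoly P (p n) x) \<le> e * nrm x" by blast
qed (intro op_cpoly_A_bounded A_bounded_P)

text \<open>
  The norm of \<open>q(P) - p(P)\<close> is at most the distance of \<open>q\<close> and \<open>p\<close> on the spectrum.  Therefore any two sequences
  of polynomials that converge to \<open>f\<close> there have the same limit in the operator norm, and this limit is
  represented by either sequence.
\<close>

lemma cont_fun_calc_eq_lift:
  assumes p: "uniform_limit spec (\<lambda>n. poly (p n)) f sequentially"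
  shows "cont_fun_calc K f (lift (\<lambda>_. P)) = lift (\<lambda>n. op_rpoly P (p n))"
  unfolding cont_fun_calc_def
proof (rule the_equality)
  let ?R = "lift (\<lambda>n. op_rpoly P (p n))"
  note Lp = op_Cauchy_op_rpoly[OF p]
  have const: "op_Cauchy (\<lambda>_. op_rpoly P q)" for q by (intro op_Cauchy_const op_cpoly_A_bounded A_bounded_P)
  have Rb: "?R \<in> bounded_ops K" by (rule lift_in_bounded_ops) (rule Lp)
  have conv: "(\<lambda>n. opnorm K (op_diff K (op_poly K (q n) (lift (\<lambda>_. P))) ?R)) \<longlonglongrightarrow> 0"
    if q: "uniform_limit spec (\<lambda>n. poly (q n)) f sequentially" for q
  proof (rule LIMSEQ_I)
    fix e :: real assume e: "e > 0"
    then have "e / 4 > 0" by simp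
    from uniform_limitD[OF p this] obtain M1 where M1: "\<And>n t. n \<ge> M1 \<Longrightarrow> t \<in> spec \<Longrightarrow> dist (poly (p n) t) (f t) < e / 4"
      by (force simp: eventually_sequentially)
    from uniform_limitD[OF q \<open>e / 4 > 0\<close>] obtain M2 where M2: "\<And>n t. n \<ge> M2 \<Longrightarrow> t \<in> spec \<Longrightarrow> dist (poly (q n) t) (f t) < e / 4"
      by (force simp: eventually_sequentially)
    have "\<bar>opnorm K (op_diff K (op_poly K (q n) (lift (\<lambda>_. P))) ?R)\<bar> < e" if n: "n \<ge> M2" for n
    proof -
      have eq: "op_diff K (op_poly K (q n) (lift (\<lambda>_. P))) ?R
          = lift (\<lambda>m x. op_rpoly P (q n) x - op_rpoly P (p m) x)"
        unfolding op_poly_lift[OF A_bounded_P] lift_diff[OF const Lp] ..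
      have Ld: "op_Cauchy (\<lambda>m x. op_rpoly P (q n) x - op_rpoly P (p m) x)"
        by (rule op_Cauchy_diff[OF const Lp])
      have "opnorm K (lift (\<lambda>m x. op_rpoly P (q n) x - op_rpoly P (p m) x)) \<le> e / 2"
      proof (rule opnorm_lift_le[OF Ld, where N = M1])
        fix m x assume m: "m \<ge> M1"
        show "nrm (op_rpoly P (q n) x - op_rpoly P (p m) x) \<le> e / 2 * nrm x"
        proof (rule nrm_op_rpoly_diff_le)
          fix t assume "t \<in> spec"
          then show "\<bar>poly (q n) t - poly (p m) t\<bar> \<le> e / 2"
            using M1[OF m, of t] M2[OF n, of t] unfolding dist_real_def by linarith
        qed
      qed (use e in simp)
      moreover have "0 \<le> opnorm K (lift (\<lambda>m x. op_rpoly P (q n) x - op_rpoly P (p m) x))"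
        by (rule opnorm_nonneg[OF lift_in_bounded_ops[OF Ld]])
      ultimately show ?thesis unfolding eq using e by linarith
    qed
    then show "\<exists>M. \<forall>n\<ge>M. norm (opnorm K (op_diff K (op_poly K (q n) (lift (\<lambda>_. P))) ?R) - 0) < e" by auto
  qed
  then show "?R \<in> bounded_ops K \<and> (\<forall>q. uniform_limit spec (\<lambda>n. poly (q n)) f sequentially \<longrightarrow>
      (\<lambda>n. opnorm K (op_diff K (op_poly K (q n) (lift (\<lambda>_. P))) ?R)) \<longlonglongrightarrow> 0)"
    using Rb by blast
  fix R' assume R': "R' \<in> bounded_ops K \<and> (\<forall>q. uniform_limit spec (\<lambda>n. poly (q n)) f sequentially \<longrightarrow>
      (\<lambda>n. opnorm K (op_diff K (op_poly K (q n) (lift (\<lambda>_. P))) R')) \<longlonglongrightarrow> 0)"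
  then have R'b: "R' \<in> bounded_ops K" by blast
  show "R' = ?R"
  proof
    fix u show "R' u = ?R u"
    proof (cases "u \<in> vecs K")
      case False
      then show ?thesis using R'b Rb by (auto simp: bounded_ops_def PiE_def extensional_def)
    next
      case u: True
      obtain X where X: "X \<in> Cau" "R' u = cls X" using bounded_ops_in_vecs[OF R'b u] by (rule vecsE)
      obtain Y where Y: "Y \<in> Cau" "?R u = cls Y" using bounded_ops_in_vecs[OF Rb u] by (rule vecsE)
      let ?q = "\<lambda>n. op_poly K (p n) (lift (\<lambda>_. P))"
      have qb: "?q n \<in> bounded_ops K" for n
        unfolding op_poly_lift[OF A_bounded_P] by (rule lift_in_bounded_ops) (rule const)
      have "vnorm K (cls (\<lambda>k. X k - Y k)) \<le> (opnorm K (op_diff K (?q n) R') + opnorm K (op_diff K (?q n) ?R)) * vnorm K u"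
        for n
      proof -
        obtain W where W: "W \<in> Cau" "?q n u = cls W" using bounded_ops_in_vecs[OF qb u] by (rule vecsE)
        have dX: "op_diff K (?q n) R' u = cls (\<lambda>k. W k - X k)"
          and dY: "op_diff K (?q n) ?R u = cls (\<lambda>k. W k - Y k)"
          using u W X Y vdiff_cls[of W X] vdiff_cls[of W Y] by (simp_all add: op_diff_def op_add_def op_scale_def)
        have "vnorm K (cls (\<lambda>k. X k - Y k)) \<le> vnorm K (cls (\<lambda>k. W k - X k)) + vnorm K (cls (\<lambda>k. W k - Y k))"
        proof (rule LIMSEQ_le[OF vnorm_cls tendsto_add[OF vnorm_cls vnorm_cls]])
          show "\<exists>N. \<forall>k\<ge>N. nrm (X k - Y k) \<le> nrm (W k - X k) + nrm (W k - Y k)"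
            using nrm_triangle_diff by (metis nrm_diff_commute)
        qed (intro Cauchy_A_diff W X Y)+
        also have "\<dots> \<le> opnorm K (op_diff K (?q n) R') * vnorm K u + opnorm K (op_diff K (?q n) ?R) * vnorm K u"
          unfolding dX[symmetric] dY[symmetric]
          by (intro add_mono opnorm_bound op_diff_in_bounded_ops qb R'b Rb u)
        finally show ?thesis by (simp add: distrib_right)
      qed
      moreover have "(\<lambda>n. (opnorm K (op_diff K (?q n) R') + opnorm K (op_diff K (?q n) ?R)) * vnorm K u) \<longlonglongrightarrow> (0 + 0) * vnorm K u"
        by (intro tendsto_mult_right tendsto_add conv p) (use R' p in blast)
      ultimately have "vnorm K (cls (\<lambda>k. X k - Y k)) \<le> (0 + 0) * vnorm K u"
        by (intro LIMSEQ_le_const) auto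
      then have "vnorm K (cls (\<lambda>k. X k - Y k)) = 0"
        using vnorm_nonneg[OF cls_in_vecs[OF Cauchy_A_diff[OF X(1) Y(1)]]] by simp
      then have "(\<lambda>k. nrm (X k - Y k)) \<longlonglongrightarrow> 0" using vnorm_cls[OF Cauchy_A_diff[OF X(1) Y(1)]] by simp
      then show ?thesis using X Y by (simp add: cls_eq_iff)
    qed
  qed
qed

end

text \<open>
  The functional calculus refers to polynomials as elements of a type, whereas the Stone-Weierstrass theorem
  provides polynomial functions.
\<close>

lemma polynomial_uniform_approximation:
  fixes f :: "real \<Rightarrow> real"
  assumes f: "continuous_on {a..b} f"
  shows "\<exists>p. uniform_limit {a..b} (\<lambda>n. poly (p n)) f sequentially"
proof -
  have "\<exists>p. \<forall>t\<in>{a..b}. \<bar>poly p t - f t\<bar> < e" if e: "e > 0" for e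
  proof -
    obtain g where g: "real_polynomial_function g" "\<And>t. t \<in> {a..b} \<Longrightarrow> \<bar>f t - g t\<bar> < e"
      using Stone_Weierstrass_real_polynomial_function[OF compact_Icc f e] by blast
    obtain c n where c: "g = (\<lambda>x. \<Sum>i\<le>n. c i * x ^ i)"
      using real_polynomial_function_imp_sum[OF g(1)] by blast
    have "poly (\<Sum>i\<le>n. monom (c i) i) t = g t" for t
      by (simp add: c poly_sum poly_monom)
    then show ?thesis using g(2) by (intro exI[of _ "\<Sum>i\<le>n. monom (c i) i"]) (simp add: abs_minus_commute)
  qed
  then have "\<exists>p. \<forall>t\<in>{a..b}. \<bar>poly p t - f t\<bar> < 1 / real (Suc n)" for n by simp
  then obtain p where p: "\<And>n t. t \<in> {a..b} \<Longrightarrow> \<bar>poly (p n) t - f t\<bar> < 1 / real (Suc n)" by metis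
  have "uniform_limit {a..b} (\<lambda>n. poly (p n)) f sequentially"
  proof (rule uniform_limitI)
    fix e :: real assume "e > 0"
    then obtain M where M: "1 / real (Suc M) < e" using nat_approx_posE by blast
    show "\<forall>\<^sub>F n in sequentially. \<forall>t\<in>{a..b}. dist (poly (p n) t) (f t) < e"
    proof (rule eventually_sequentiallyI, intro ballI)
      fix n t assume n: "M \<le> n" and t: "t \<in> {a..b}"
      have "1 / real (Suc n) \<le> 1 / real (Suc M)" using n by (intro divide_left_mono) auto
      then show "dist (poly (p n) t) (f t) < e" using p[OF t, of n] M by (simp add: dist_real_def)
    qed
  qed
  then show ?thesis by blast
qed

context A_positive_op
begin

text \<open>
  The witness \<open>L\<close> consists of polynomials of \<open>P\<close> that approximate the power uniformly on \<open>[0, N]\<close>; the McCarthy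
  inequality holds for each of them up to the error of the approximation.
\<close>

lemma powr_A_eq_lift:
  assumes s: "s \<ge> 2"
  shows "\<exists>L. op_Cauchy L \<and> powr_A A P s = lift L \<and>
    (\<forall>e>0. \<exists>M. \<forall>n\<ge>M. \<forall>x. nrm x = 1 \<longrightarrow> nrm (P x) powr s - e \<le> Re (sip (L n x) x))"
proof -
  have "continuous_on {0..N} (\<lambda>t. t powr s)"
    using s by (intro continuous_on_powr' continuous_intros) auto
  then obtain p where p: "uniform_limit {0..N} (\<lambda>n. poly (p n)) (\<lambda>t. t powr s) sequentially"
    using polynomial_uniform_approximation by blast
  have ps: "uniform_limit spec (\<lambda>n. poly (p n)) (\<lambda>t. t powr s) sequentially"
    by (rule uniform_limit_on_subset[OF p]) (use op_spectrum_real_range in blast)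
  have "powr_A A P s = lift (\<lambda>n. op_rpoly P (p n))"
    unfolding powr_A_def induced_op_eq_lift[OF A_bounded_P] by (rule cont_fun_calc_eq_lift) (rule ps)
  moreover have "\<exists>M. \<forall>n\<ge>M. \<forall>x. nrm x = 1 \<longrightarrow> nrm (P x) powr s - e \<le> Re (sip (op_rpoly P (p n) x) x)"
    if "e > 0" for e
  proof -
    from uniform_limitD[OF p that] obtain M
      where M: "\<And>n t. n \<ge> M \<Longrightarrow> t \<in> {0..N} \<Longrightarrow> dist (poly (p n) t) (t powr s) < e"
      by (force simp: eventually_sequentially)
    have "nrm (P x) powr s - e \<le> Re (sip (op_rpoly P (p n) x) x)" if "n \<ge> M" "nrm x = 1" for n x
    proof (rule McCarthy_inequality[OF s that(2)])
      fix t assume "t \<in> {0..N}"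
      from M[OF that(1) this] show "t powr s - e \<le> poly (p n) t" by (simp add: dist_real_def)
    qed
    then show ?thesis by blast
  qed
  ultimately show ?thesis using op_Cauchy_op_rpoly[OF ps] by blast
qed

lemma McCarthy_inequality_nat:
  assumes "k \<ge> 2" "nrm x = 1"
  shows "nrm (P x) ^ k \<le> Re (sip ((P ^^ k) x) x)"
proof -
  have eq: "op_rpoly P (monom 1 k) x = (P ^^ k) x"
  proof (induction k)
    case 0
    then show ?case by (simp add: monom_0 op_rpoly_simps linear_P complex_linear_zero)
  next
    case (Suc k)
    then show ?case by (simp add: monom_Suc op_rpoly_simps linear_P)
  qed
  have "nrm (P x) powr real k - 0 \<le> Re (sip (op_rpoly P (monom 1 k) x) x)"
    by (rule McCarthy_inequality) (use assms in \<open>auto simp: poly_monom powr_realpow'\<close>)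
  then show ?thesis using assms by (simp add: eq powr_realpow')
qed

end

lemma (in positive_op) sharp_A_positive:
  assumes T: "T \<in> B_A A"
  shows "A_positive_op A (sharp_A A T \<circ> T)"
proof
  have "bounded_clinear T" using T by (simp add: B_A_def)
  then show "bounded_clinear (sharp_A A T \<circ> T)"
    by (intro bounded_clinear_comp bounded_clinear_sharp_A T)
  have l: "sip (sharp_A A T (T x)) y = sip (T x) (T y)" for x y by (rule sip_sharp_A) (rule T)
  have r: "sip x (sharp_A A T (T y)) = sip (T x) (T y)" for x y
    using l[of y x] sip_commute[of x "sharp_A A T (T y)"] sip_commute[of "T y" "T x"] by simp
  show "A_symmetric (sharp_A A T \<circ> T)" by (simp add: A_symmetric_def l r)
  show "0 \<le> Re (sip ((sharp_A A T \<circ> T) x) x)" for x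
    by (simp add: l nrm_square[symmetric])
qed

text \<open>
  By the Cauchy-Schwarz inequality \<open>\<langle>(P\<^sup>s + Q\<^sup>s) x, x\<rangle>\<close> is at most the seminorm of \<open>P\<^sup>s + Q\<^sup>s\<close>, and the McCarthy
  inequalities for \<open>P\<close> and \<open>Q\<close> bound it from below.  For a non-integral exponent the argument is carried out
  along the sequences that represent the powers, with an error that tends to \<open>0\<close>.
\<close>

lemma (in positive_op) powers_le_seminorm_sum_powers:
  assumes P: "A_positive_op A P" and Q: "A_positive_op A Q" and s: "s \<ge> 2" and x: "nrm x = 1"
  shows "nrm (P x) powr s + nrm (Q x) powr s \<le> seminorm_sum_powers A P Q s"
proof -
  interpret P: A_positive_op A P by fact
  interpret Q: A_positive_op A Q by fact
  show ?thesis
  proof (cases "s \<in> \<nat>")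
    case True
    then obtain k where k: "s = real k" by (auto simp: Nats_def)
    then have k2: "k \<ge> 2" using s by simp
    let ?L = "\<lambda>x. (P ^^ k) x + (Q ^^ k) x"
    have pow: "A_bounded R \<Longrightarrow> A_bounded (R ^^ k)" for R :: "'a \<Rightarrow> 'a" and k
    proof (induction k)
      case 0
      then show ?case by (simp add: id_def)
    next
      case (Suc k)
      then show ?case using A_bounded_comp[of R "R ^^ k"] by (simp add: o_def)
    qed
    have L: "A_bounded ?L"
      by (rule A_bounded_add[OF pow[OF P.A_bounded_P] pow[OF Q.A_bounded_P]])
    have "nrm (P x) ^ k + nrm (Q x) ^ k \<le> Re (sip (?L x) x)"
      unfolding sip_add_left using P.McCarthy_inequality_nat[OF k2 x] Q.McCarthy_inequality_nat[OF k2 x] by simp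
    also have "\<dots> \<le> nrm (?L x) * nrm x" by (rule order_trans[OF complex_Re_le_cmod sip_Cauchy_Schwarz])
    also have "\<dots> \<le> opnorm_A A ?L" using opnorm_A_bound[OF L, of x] x by simp
    finally show ?thesis using True k2 by (simp add: seminorm_sum_powers_def k powr_realpow')
  next
    case False
    obtain L where L: "op_Cauchy L" "powr_A A P s = lift L"
        "\<And>e. e > 0 \<Longrightarrow> \<exists>M. \<forall>n\<ge>M. \<forall>x. nrm x = 1 \<longrightarrow> nrm (P x) powr s - e \<le> Re (sip (L n x) x)"
      using P.powr_A_eq_lift[OF s] by blast
    obtain L' where L': "op_Cauchy L'" "powr_A A Q s = lift L'"
        "\<And>e. e > 0 \<Longrightarrow> \<exists>M. \<forall>n\<ge>M. \<forall>x. nrm x = 1 \<longrightarrow> nrm (Q x) powr s - e \<le> Re (sip (L' n x) x)"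
      using Q.powr_A_eq_lift[OF s] by blast
    let ?Z = "\<lambda>n x. L n x + L' n x"
    have Z: "op_Cauchy ?Z" by (rule op_Cauchy_add) fact+
    have sum: "seminorm_sum_powers A P Q s = opnorm K (lift ?Z)"
      using False by (simp add: seminorm_sum_powers_def L(2) L'(2) lift_add[OF L(1) L'(1)])
    have Zx: "(\<lambda>n. ?Z n x) \<in> Cau" by (rule op_Cauchy_diagonal[OF Z Cauchy_A_const])
    have "vnorm K (lift ?Z (embed_A A x)) \<le> opnorm K (lift ?Z) * vnorm K (embed_A A x)"
      by (rule opnorm_bound[OF lift_in_bounded_ops[OF Z] embed_A_in_vecs])
    then have le: "vnorm K (cls (\<lambda>n. ?Z n x)) \<le> opnorm K (lift ?Z)"
      by (simp add: vnorm_embed_A x lift_embed_A[OF Z])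
    have "nrm (P x) powr s + nrm (Q x) powr s \<le> vnorm K (cls (\<lambda>n. ?Z n x)) + e" if e: "e > 0" for e
    proof (rule LIMSEQ_le_const[OF tendsto_add[OF vnorm_cls[OF Zx] tendsto_const]])
      have "e / 2 > 0" using e by simp
      obtain M where M: "\<And>n. n \<ge> M \<Longrightarrow> nrm (P x) powr s - e / 2 \<le> Re (sip (L n x) x)"
        using L(3)[OF \<open>e / 2 > 0\<close>] x by blast
      obtain M' where M': "\<And>n. n \<ge> M' \<Longrightarrow> nrm (Q x) powr s - e / 2 \<le> Re (sip (L' n x) x)"
        using L'(3)[OF \<open>e / 2 > 0\<close>] x by blast
      have "nrm (P x) powr s + nrm (Q x) powr s \<le> nrm (?Z n x) + e" if "n \<ge> max M M'" for n
      proof -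
        have "nrm (P x) powr s + nrm (Q x) powr s - e \<le> Re (sip (?Z n x) x)"
          unfolding sip_add_left using M[of n] M'[of n] that by simp
        also have "\<dots> \<le> nrm (?Z n x) * nrm x" by (rule order_trans[OF complex_Re_le_cmod sip_Cauchy_Schwarz])
        finally show ?thesis using x by simp
      qed
      then show "\<exists>N. \<forall>n\<ge>N. nrm (P x) powr s + nrm (Q x) powr s \<le> nrm (?Z n x) + e" by blast
    qed
    then have "nrm (P x) powr s + nrm (Q x) powr s \<le> vnorm K (cls (\<lambda>n. ?Z n x))" by (rule field_le_epsilon)
    then show ?thesis using le sum by simp
  qed
qed

section \<open>The numerical radius inequality\<close>

lemma powr_midpoint_convex:
  fixes a b r :: real
  assumes "a \<ge> 0" "b \<ge> 0" "r \<ge> 1"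
  shows "((a + b) / 2) powr r \<le> (a powr r + b powr r) / 2"
proof (cases "a + b = 0")
  case True
  then show ?thesis using assms by simp
next
  case False
  define m where "m = (a + b) / 2"
  have "m > 0" using False assms by (simp add: m_def)
  then have "m powr r + r * m powr (r - 1) * (a - m) \<le> a powr r"
      "m powr r + r * m powr (r - 1) * (b - m) \<le> b powr r"
    using assms by (simp_all add: powr_above_tangent)
  moreover have "r * m powr (r - 1) * (b - m) = - (r * m powr (r - 1) * (a - m))"
    by (simp add: m_def field_simps)
  ultimately show ?thesis by (simp add: m_def)
qed

lemma powr_mult_le_mean:
  fixes a b r :: real
  assumes "a \<ge> 0" "b \<ge> 0"
  shows "(a * b) powr r \<le> (a powr (2 * r) + b powr (2 * r)) / 2"
proof -
  have sq: "x powr (2 * r) = (x powr r)\<^sup>2" for x :: real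
    by (simp only: mult_2 powr_add power2_eq_square)
  have "0 \<le> (a powr r - b powr r)\<^sup>2" by simp
  then show ?thesis using assms by (simp add: sq powr_mult power2_diff)
qed

lemma powr_le_imp_le_powr_inverse:
  fixes t y s :: real
  assumes "t \<ge> 0" "s > 0" "t powr s \<le> y"
  shows "t \<le> y powr (1 / s)"
proof -
  have "t = (t powr s) powr (1 / s)" using assms by (simp add: powr_powr)
  also have "\<dots> \<le> y powr (1 / s)" using assms by (intro powr_mono2) auto
  finally show ?thesis .
qed

context positive_op
begin

lemma w_A_bounds:
  assumes "0 \<le> c" and c: "\<And>x. nrm x = 1 \<Longrightarrow> cmod (sip (T x) x) \<le> c"
  shows "0 \<le> w_A A T" and "w_A A T \<le> c" and "\<And>x. nrm x = 1 \<Longrightarrow> cmod (sip (T x) x) \<le> w_A A T"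
proof -
  have bdd: "bdd_above (insert 0 {cmod (sip (T x) x) | x. nrm x = 1})"
    using assms by (intro bdd_aboveI[of _ c]) auto
  show "0 \<le> w_A A T" unfolding w_A_def by (intro cSup_upper bdd) auto
  show "w_A A T \<le> c" unfolding w_A_def using assms by (intro cSup_least) auto
  show "cmod (sip (T x) x) \<le> w_A A T" if "nrm x = 1" for x
    unfolding w_A_def using that by (intro cSup_upper bdd) auto
qed

text \<open>
  With \<open>P\<close> and \<open>Q\<close> the products of \<open>T\<close> and \<open>S\<close> with their A-adjoints, the squared modulus of
  \<open>\<langle>S\<^sup># T x,x\<rangle>\<close> is at most \<open>\<langle>P x,x\<rangle> \<langle>x,Q x\<rangle>\<close>, to which Buzano's inequality applies.
\<close>

lemma w_A_powr_bounds:
  assumes T: "T \<in> B_A A" and S: "S \<in> B_A A" and r: "r \<ge> 1" and unit: "nrm z = 1"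
  defines "n \<equiv> seminorm_sum_powers A (sharp_A A T \<circ> T) (sharp_A A S \<circ> S) (2 * r) / 2"
    and "W \<equiv> w_A A (sharp_A A S \<circ> S \<circ> sharp_A A T \<circ> T) powr r"
  shows "W \<le> n" and "w_A A (sharp_A A S \<circ> T) powr (4 * r) \<le> ((n + W) / 2)\<^sup>2"
proof -
  define P where "P = sharp_A A T \<circ> T"
  define Q where "Q = sharp_A A S \<circ> S"
  have PQ: "A_positive_op A P" "A_positive_op A Q"
    unfolding P_def Q_def by (intro sharp_A_positive T S)+
  have n_bound: "(nrm (P x) * nrm (Q x)) powr r \<le> n" if "nrm x = 1" for x
    using powr_mult_le_mean[of "nrm (P x)" "nrm (Q x)" r]
      powers_le_seminorm_sum_powers[OF PQ _ that, of "2 * r"] r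
    by (simp add: n_def P_def Q_def)
  have n0: "n \<ge> 0" using n_bound[OF unit] powr_ge_zero order_trans by blast
  have QP: "sip (Q (P x)) x = sip (P x) (Q x)" for x
    using A_positive_op.symmetric_P[OF PQ(2)] by (simp add: A_symmetric_def)
  have prod_bound: "cmod (sip ((Q \<circ> P) x) x) \<le> n powr (1 / r)" if x: "nrm x = 1" for x
  proof -
    have "cmod (sip ((Q \<circ> P) x) x) \<le> nrm (P x) * nrm (Q x)" by (simp add: QP sip_Cauchy_Schwarz)
    also have "\<dots> \<le> n powr (1 / r)"
      using r n_bound[OF x] by (intro powr_le_imp_le_powr_inverse) auto
    finally show ?thesis .
  qed
  define w where "w = w_A A (Q \<circ> P)"
  have w_bounds: "0 \<le> w" "w \<le> n powr (1 / r)" "\<And>x. nrm x = 1 \<Longrightarrow> cmod (sip ((Q \<circ> P) x) x) \<le> w"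
    unfolding w_def using w_A_bounds[OF powr_ge_zero prod_bound] by blast+
  have W: "W = w powr r" by (simp add: W_def w_def P_def Q_def o_assoc)
  have "w powr r \<le> (n powr (1 / r)) powr r" using w_bounds(1,2) r by (intro powr_mono2) auto
  then show "W \<le> n" using r n0 by (simp add: W powr_powr)
  define X where "X = (n + W) / 2"
  have num_bound: "cmod (sip ((sharp_A A S \<circ> T) x) x) \<le> X powr (1 / (2 * r))" if x: "nrm x = 1" for x
  proof (rule powr_le_imp_le_powr_inverse)
    define t where "t = cmod (sip ((sharp_A A S \<circ> T) x) x)"
    have "t \<le> nrm (T x) * nrm (S x)" by (simp add: t_def sip_sharp_A[OF S] sip_Cauchy_Schwarz)
    then have "t\<^sup>2 \<le> (nrm (T x))\<^sup>2 * (nrm (S x))\<^sup>2"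
      unfolding power_mult_distrib[symmetric] by (intro power_mono) (simp_all add: t_def)
    also have "\<dots> = cmod (sip (P x) x) * cmod (sip x (Q x))"
    proof -
      have "sip (P x) x = complex_of_real ((nrm (T x))\<^sup>2)" "sip (Q x) x = complex_of_real ((nrm (S x))\<^sup>2)"
        by (simp_all only: P_def Q_def o_apply sip_sharp_A[OF T] sip_sharp_A[OF S] sip_self)
      moreover have "cmod (sip x (Q x)) = cmod (sip (Q x) x)" by (subst sip_commute) simp
      ultimately show ?thesis by (simp add: norm_power)
    qed
    also have "\<dots> \<le> (nrm (P x) * nrm (Q x) + cmod (sip (P x) (Q x))) / 2"
      by (rule Buzano_inequality) (rule x)
    also have "cmod (sip (P x) (Q x)) \<le> w" using w_bounds(3)[OF x] by (simp add: QP)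
    finally have "t\<^sup>2 \<le> (nrm (P x) * nrm (Q x) + w) / 2" by simp
    then have "(t\<^sup>2) powr r \<le> ((nrm (P x) * nrm (Q x) + w) / 2) powr r"
      using r by (intro powr_mono2) auto
    also have "\<dots> \<le> ((nrm (P x) * nrm (Q x)) powr r + w powr r) / 2"
      using r w_bounds(1) by (intro powr_midpoint_convex) auto
    also have "\<dots> \<le> X" using n_bound[OF x] by (simp add: X_def W)
    also have "(t\<^sup>2) powr r = t powr (2 * r)"
      by (simp add: t_def powr_powr flip: powr_numeral)
    finally show "cmod (sip ((sharp_A A S \<circ> T) x) x) powr (2 * r) \<le> X" by (simp add: t_def)
  qed (use r in auto)
  have num_bounds: "0 \<le> w_A A (sharp_A A S \<circ> T)" "w_A A (sharp_A A S \<circ> T) \<le> X powr (1 / (2 * r))"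
    using w_A_bounds[OF powr_ge_zero num_bound] by blast+
  have "w_A A (sharp_A A S \<circ> T) powr (4 * r) \<le> (X powr (1 / (2 * r))) powr (4 * r)"
    using num_bounds(1,2) r by (intro powr_mono2) auto
  also have "\<dots> = X powr 2" using r by (simp add: powr_powr)
  also have "\<dots> = X\<^sup>2" using n0 by (simp add: X_def W)
  finally show "w_A A (sharp_A A S \<circ> T) powr (4 * r) \<le> ((n + W) / 2)\<^sup>2" by (simp add: X_def)
qed

end

text \<open>
  The two coefficients, for \<open>n\<^sup>2\<close> and \<open>n W\<close>, add up to \<open>1\<close>, and the first is at least \<open>1/4\<close>.  Since \<open>W \<le> n\<close>, the
  right-hand side is smallest for the coefficients \<open>1/4\<close> and \<open>3/4\<close>.
\<close>

lemma mean_square_le_weighted: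
  fixes \<alpha> \<beta> n W :: real
  assumes \<alpha>: "0 \<le> \<alpha>" and \<beta>: "0 \<le> \<beta>" and W: "0 \<le> W" "W \<le> n"
  shows "((n + W) / 2)\<^sup>2 \<le> ((2 * \<beta> + 1) * (1 + \<alpha>\<^sup>2) + 2 * \<alpha>) / (16 * (1 + \<beta>)) * (2 * n)\<^sup>2
      + ((1 - \<alpha>) * (2 + (1 + \<alpha>) * (1 + 2 * \<beta>))) / (8 * (1 + \<beta>)) * (2 * n) * W"
proof -
  define B where "B = 1 + \<beta>"
  define E where "E = (2 * \<beta> + 1) * (1 + \<alpha>\<^sup>2) + 2 * \<alpha>"
  have B: "B > 0" using \<beta> by (simp add: B_def)
  have F: "(1 - \<alpha>) * (2 + (1 + \<alpha>) * (1 + 2 * \<beta>)) = 4 * B - E"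
    by (simp add: B_def E_def algebra_simps power2_eq_square)
  have "E - B = \<beta> + (2 * \<beta> + 1) * \<alpha>\<^sup>2 + 2 * \<alpha>" by (simp add: B_def E_def algebra_simps)
  then have EB: "0 \<le> E - B" using \<alpha> \<beta> by simp
  have "0 \<le> (E - B) * (n * (n - W)) + B * (W * (n - W))"
    using EB B W by (intro add_nonneg_nonneg mult_nonneg_nonneg) auto
  also have "\<dots> = E * n\<^sup>2 + (4 * B - E) * (n * W) - B * (n + W)\<^sup>2"
    by (simp add: algebra_simps power2_eq_square)
  finally have "B * (n + W)\<^sup>2 \<le> E * n\<^sup>2 + (4 * B - E) * (n * W)" by simp
  then have "(n + W)\<^sup>2 \<le> (E * n\<^sup>2 + (4 * B - E) * (n * W)) / B"
    using B by (simp add: pos_le_divide_eq mult.commute)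
  then have "(n + W)\<^sup>2 / 4 \<le> (E * n\<^sup>2 + (4 * B - E) * (n * W)) / B / 4"
    by (rule divide_right_mono) simp
  also have "\<dots> = E / (16 * B) * (2 * n)\<^sup>2 + (4 * B - E) / (8 * B) * (2 * n) * W"
    using B by (simp add: field_simps power2_eq_square)
  finally have "((n + W) / 2)\<^sup>2 \<le> E / (16 * B) * (2 * n)\<^sup>2 + (4 * B - E) / (8 * B) * (2 * n) * W"
    by (simp add: power_divide)
  then show ?thesis unfolding F E_def[symmetric] B_def[symmetric] .
qed

theorem theorem3p8:
  fixes A T S :: "'a::chilbert_space \<Rightarrow> 'a"
    and \<alpha> r \<beta> :: real
  assumes nontrivial: "\<exists>x::'a. x \<noteq> 0"
    and A: "positive_operator A"
    and T: "T \<in> B_A A"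
    and S: "S \<in> B_A A"
    and \<alpha>: "\<alpha> \<in> {0..1}"
    and r: "r \<ge> 1"
    and \<beta>: "\<beta> \<ge> 0"
  shows "w_A A (sharp_A A S \<circ> T) powr (4 * r)
    \<le> ((2 * \<beta> + 1) * (1 + \<alpha>\<^sup>2) + 2 * \<alpha>) / (16 * (1 + \<beta>))
        * (seminorm_sum_powers A (sharp_A A T \<circ> T) (sharp_A A S \<circ> S) (2 * r))\<^sup>2
      + ((1 - \<alpha>) * (2 + (1 + \<alpha>) * (1 + 2 * \<beta>))) / (8 * (1 + \<beta>))
        * seminorm_sum_powers A (sharp_A A T \<circ> T) (sharp_A A S \<circ> S) (2 * r)
        * w_A A (sharp_A A S \<circ> S \<circ> sharp_A A T \<circ> T) powr r"
proof -
  interpret positive_op A by unfold_locales (rule A)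
  show ?thesis
  proof (cases "\<exists>z. nrm z = 1")
    case True
    then obtain z where z: "nrm z = 1" by blast
    let ?n = "seminorm_sum_powers A (sharp_A A T \<circ> T) (sharp_A A S \<circ> S) (2 * r) / 2"
    let ?W = "w_A A (sharp_A A S \<circ> S \<circ> sharp_A A T \<circ> T) powr r"
    note bounds = w_A_powr_bounds[OF T S r z]
    have "((?n + ?W) / 2)\<^sup>2 \<le> ((2 * \<beta> + 1) * (1 + \<alpha>\<^sup>2) + 2 * \<alpha>) / (16 * (1 + \<beta>)) * (2 * ?n)\<^sup>2
        + ((1 - \<alpha>) * (2 + (1 + \<alpha>) * (1 + 2 * \<beta>))) / (8 * (1 + \<beta>)) * (2 * ?n) * ?W"
      using \<alpha> \<beta> bounds(1) by (intro mean_square_le_weighted) auto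
    with bounds(2) show ?thesis by simp
  next
    case False
    \<comment> \<open>Only for \<open>A = 0\<close>; both numerical radii are then the supremum of \<open>{0}\<close>.\<close>
    then have "w_A A R = 0" for R by (simp add: w_A_def)
    then show ?thesis using \<alpha> r \<beta> by simp
  qed
qed

end
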